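(* Let $N=\{1,\dots,n\}$ and let $u,v,z_1,\dots,z_n$ be variables. Then $$F(u,v,\mathfrak Z_N)\;=\;\sum_{J\subseteq N}F(u+v+z_J,\,\mathfrak Z_{J^c})\sum_{I\subseteq J}(-1)^{|J\smallsetminus I|}\bigl(Z_{|J|}(u+z_I)+Z_{|J|}(v+z_I)\bigr).$$
   Context: For $J\subseteq N$ write $\mathfrak Z_J=(z_j)_{j\in J}$, $z_J=\sum_{j\in J}z_j$ (so $z_\emptyset=0$), $J^c=N\smallsetminus J$. Correlators: define $\beta_k$ by $\frac{z/2}{\sinh(z/2)}=\sum_{k\ge0}\beta_kz^k$ and, for a partition $\lambda$, $Q_0(\lambda)=1$, $Q_k(\lambda)=\frac{1}{(k-1)!}\sum_{i\ge1}\bigl[(\lambda_i-i+\tfrac12)^{k-1}-(-i+\tfrac12)^{k-1}\bigr]+\beta_k$ for $k\ge1$. For a function $f$ on partitions, $\langle f\rangle_q=\sum_\lambda f(\lambda)q^{|\lambda|}\big/\sum_\lambda q^{|\lambda|}$. The $m$-point Bloch-Okounkov correlator is $$F(x_1,\dots,x_m)=\sum_{k_1,\dots,k_m\ge0}\langle Q_{k_1}\cdots Q_{k_m}\rangle_q\,x_1^{k_1-1}\cdots x_m^{k_m-1},$$ which is the Laurent expansion at the origin of a meromorphic function (for fixed $|q|<1$), symmetric in its arguments, denoted by the same letter; the claimed identity is an identity of meromorphic functions. Theta function: $\theta(z)=\sum_{\nu\in\mathbb Z+\frac12}(-1)^{\lfloor\nu\rfloor}e^{\nu z}q^{\nu^2/2}$,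 with $'$ denoting $d/dz$. The functions $Z_\ell(u)$, $\ell\ge0$, are defined by $$\frac{\theta(u+v)\,\theta'(0)}{\theta(u)\,\theta(v)}=\frac1v+\sum_{\ell=0}^\infty Z_\ell(u)\,\frac{v^\ell}{\ell!}.$$ *)

theory Defs
  imports "HOL-Complex_Analysis.Complex_Analysis" "HOL-Library.More_List"
begin

section \<open>Meromorphic functions of several variables\<close>

text \<open>
  The number of variables is a number, not a type, so the points of \<open>\<complex>\<^sup>m\<close> are encoded as the
  sequences vanishing from index \<open>m\<close> on, with the subspace topology of the product topology;
  this is the encoding that \<^const>\<open>Euclidean_space\<close> uses for \<open>\<real>\<^sup>m\<close>.
\<close>

definition complex_space :: "nat \<Rightarrow> (nat \<Rightarrow> complex) set" where
  "complex_space m = {x. \<forall>i\<ge>m. x i = 0}"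

definition open_in_space :: "nat \<Rightarrow> (nat \<Rightarrow> complex) set \<Rightarrow> bool" where
  "open_in_space m U \<longleftrightarrow> openin (top_of_set (complex_space m)) U"

text \<open>Continuous and holomorphic in each variable separately; meant for \<open>U\<close> open in \<open>\<complex>\<^sup>m\<close>.\<close>

definition holomorphic_several ::
    "nat \<Rightarrow> (nat \<Rightarrow> complex) set \<Rightarrow> ((nat \<Rightarrow> complex) \<Rightarrow> complex) \<Rightarrow> bool" where
  "holomorphic_several m U f \<longleftrightarrow>
     continuous_on U f \<and>
     (\<forall>x\<in>U. \<forall>i<m. (\<lambda>w. f (x(i := w))) field_differentiable at (x i))"

text \<open>
  Meromorphic on \<open>\<complex>\<^sup>m\<close>: locally a quotient \<open>g / h\<close> of holomorphic functions whose denominator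
  vanishes identically on no nonempty open set. A meromorphic function is represented by a total
  function; its values where the denominator vanishes carry no information.
\<close>

definition meromorphic_several :: "nat \<Rightarrow> ((nat \<Rightarrow> complex) \<Rightarrow> complex) \<Rightarrow> bool" where
  "meromorphic_several m f \<longleftrightarrow>
     (\<forall>a\<in>complex_space m. \<exists>U g h.
        open_in_space m U \<and> a \<in> U \<and>
        holomorphic_several m U g \<and> holomorphic_several m U h \<and>
        U \<subseteq> closure {x\<in>U. h x \<noteq> 0} \<and>
        (\<forall>x\<in>U. h x \<noteq> 0 \<longrightarrow> f x = g x / h x))"

text \<open>
  Two meromorphic functions on \<open>\<complex>\<^sup>m\<close> are equal iff their representatives agree on a dense open
  subset of \<open>\<complex>\<^sup>m\<close>.
\<close>

definition generically :: "nat \<Rightarrow> ((nat \<Rightarrow> complex) \<Rightarrow> bool) \<Rightarrow> bool" where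
  "generically m P \<longleftrightarrow>
     (\<exists>D. open_in_space m D \<and> complex_space m \<subseteq> closure D \<and> (\<forall>x\<in>D. P x))"


section \<open>Bloch--Okounkov correlators\<close>

text \<open>
  A partition is a weakly decreasing, eventually zero sequence. Indices start at \<open>0\<close>: the value
  \<open>\<lambda> i\<close> is the part usually written \<open>\<lambda>\<close> with index \<open>i + 1\<close>.
\<close>

definition partitions :: "(nat \<Rightarrow> nat) set" where
  "partitions = {lam. antimono lam \<and> finite {i. lam i \<noteq> 0}}"

definition psize :: "(nat \<Rightarrow> nat) \<Rightarrow> nat" where
  "psize lam = (\<Sum>i | lam i \<noteq> 0. lam i)"

definition beta :: "nat \<Rightarrow> complex" where
  "beta k = fps_nth ((fps_X / 2) / ((fps_exp (1/2) - fps_exp (- (1/2))) / 2)) k"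

text \<open>
  Because of the index shift, \<open>\<lambda>\<close> with index \<open>i\<close> minus \<open>i\<close> plus \<open>1/2\<close>, for \<open>i \<ge> 1\<close>, becomes
  \<open>\<lambda> i - i - 1/2\<close>, for \<open>i \<ge> 0\<close>. Only finitely many terms of the series are nonzero.
\<close>

definition Q :: "nat \<Rightarrow> (nat \<Rightarrow> nat) \<Rightarrow> complex" where
  "Q k lam =
     (if k = 0 then 1
      else 1 / fact (k - 1) *
             (\<Sum>i. (of_nat (lam i) - of_nat i - 1/2) ^ (k - 1) - (- of_nat i - 1/2) ^ (k - 1))
           + beta k)"

definition qbracket :: "complex \<Rightarrow> ((nat \<Rightarrow> nat) \<Rightarrow> complex) \<Rightarrow> complex" where
  "qbracket q f =
     (\<Sum>\<^sub>\<infinity>lam\<in>partitions. f lam * q ^ psize lam) / (\<Sum>\<^sub>\<infinity>lam\<in>partitions. q ^ psize lam)"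

text \<open>
  \<open>f\<close> is meromorphic on \<open>\<complex>\<^sup>m\<close> and its Laurent expansion at the origin is the generating series of
  the \<open>q\<close>-brackets. This determines \<open>f\<close> up to equality of meromorphic functions.
\<close>

definition is_correlator :: "complex \<Rightarrow> nat \<Rightarrow> ((nat \<Rightarrow> complex) \<Rightarrow> complex) \<Rightarrow> bool" where
  "is_correlator q m f \<longleftrightarrow>
     meromorphic_several m f \<and>
     (\<exists>r>0. \<forall>x\<in>complex_space m. (\<forall>i<m. 0 < norm (x i) \<and> norm (x i) < r) \<longrightarrow>
        ((\<lambda>k. qbracket q (\<lambda>lam. \<Prod>i<m. Q (k i) lam) * (\<Prod>i<m. x i powi (int (k i) - 1)))
           has_sum f x) {k :: nat \<Rightarrow> nat. \<forall>i\<ge>m. k i = 0})"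

definition correlator :: "complex \<Rightarrow> nat \<Rightarrow> (nat \<Rightarrow> complex) \<Rightarrow> complex" where
  "correlator q m = (SOME f. is_correlator q m f)"

definition F :: "complex \<Rightarrow> complex list \<Rightarrow> complex" where
  "F q xs = correlator q (length xs) (nth_default 0 xs)"


section \<open>Theta function\<close>

text \<open>
  The fractional powers of \<open>q\<close> are \<open>q powr s = exp (s * Ln q)\<close>, meaningful for \<open>q \<noteq> 0\<close>. Another
  branch of the logarithm changes \<open>theta\<close> by a constant factor, which cancels in \<open>Z\<close>.
\<close>

definition theta :: "complex \<Rightarrow> complex \<Rightarrow> complex" where
  "theta q z =
     (\<Sum>\<^sub>\<infinity>\<nu>\<in>range (\<lambda>k::int. of_int k + 1/2 :: real).
        (-1) powi \<lfloor>\<nu>\<rfloor> * exp (of_real \<nu> * z) * q powr of_real (\<nu>\<^sup>2 / 2))"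

definition Z :: "complex \<Rightarrow> nat \<Rightarrow> complex \<Rightarrow> complex" where
  "Z q l u =
     fact l * fls_nth (laurent_expansion
       (\<lambda>v. theta q (u + v) * deriv (theta q) 0 / (theta q u * theta q v)) 0) (int l)"

end

theory Submission
  imports Defs
begin

text \<open>
  The generating series of the correlators is a grand canonical sum over partitions of all charges.
  Read as a sum over Maya diagrams, it makes the sites independent, and emptying a site turns it into
  a recursion whose coefficients are the Kronecker sums \<open>\<Sum>\<^sub>k exp (k x) c\<^sub>n(k)\<close> of the cumulants \<open>c\<^sub>n(k)\<close>
  of the occupation numbers \<open>p = E / (E - 1)\<close> with \<open>E = exp w q\<^sup>k\<close>. Applying the recursion to \<open>u\<close> and \<open>v\<close>
  leaves an identity for products of two Kronecker sums, which is the partial fraction identity for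
  two occupation numbers at different sites together with \<open>p\<^sup>2 = p - p'\<close> at equal sites. The charge
  factors out as a theta function of the sum of all variables, the same on both sides of the recursion,
  and cancels; the case of one variable identifies the Kronecker sums with quotients of theta functions,
  hence their expansion coefficients with the functions \<open>Z\<close>. This proves the identity where all
  variables have small positive real parts. By induction its right-hand side continues the correlators
  to meromorphic functions, and the identity theorem extends the equality.
\<close>

section \<open>Several complex variables\<close>

text \<open>In charge zero the sites are not independent, since as many particles must be added as
  removed; summing over all charges lifts this constraint at the price of a fugacity
  \<open>exp w\<close>, which has to drop out again. The sign in \<open>site_weight\<close> makes
  the charge sum alternate, so that it becomes the odd theta function of the statement. Sums over
  occupied sites run down to minus infinity and converge only for positive real parts, hence the
  local identity lives on an open set with the origin on its boundary. The functions Z enter as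
  Kronecker sums from which the site 0, singular at \<open>w = 0\<close>, is taken out. This site
  contributes Bernoulli-type constants; the alternating sum over I removes them for every nonempty
  J, and for empty J the two constants 1/2 add up to the 1 that accounts for the term p in p^2 = p -
  p'. The correlators are chosen among meromorphic functions whose existence is not known
  beforehand, so existence has to be proved along the same recursion, starting from theta'(0)/theta
  in one variable.\<close>

definition polydisc :: "nat \<Rightarrow> (nat \<Rightarrow> complex) \<Rightarrow> real \<Rightarrow> (nat \<Rightarrow> complex) set" where
  "polydisc m a r = {x \<in> complex_space m. \<forall>i<m. norm (x i - a i) < r}"

lemma open_coordinates: "open {x :: nat \<Rightarrow> complex. \<forall>i<m. norm (x i - a i) < r}"
proof -
  have "open {x :: nat \<Rightarrow> complex. norm (x i - a i) < r}" for i
    by (intro open_Collect_less continuous_intros continuous_on_product_coordinates)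
  moreover have "{x :: nat \<Rightarrow> complex. \<forall>i<m. norm (x i - a i) < r} =
      (\<Inter>i\<in>{..<m}. {x. norm (x i - a i) < r})"
    by auto
  ultimately show ?thesis
    by (metis (no_types, lifting) finite_lessThan open_INT)
qed

lemma open_in_space_Int_open: "open T \<Longrightarrow> open_in_space m (complex_space m \<inter> T)"
  unfolding open_in_space_def by (auto simp: openin_open)

lemma open_in_spaceE:
  assumes "open_in_space m U"
  obtains T where "open T" "U = complex_space m \<inter> T"
  using assms unfolding open_in_space_def by (auto simp: openin_open)

lemma open_in_space_subset: "open_in_space m U \<Longrightarrow> U \<subseteq> complex_space m"
  by (metis open_in_spaceE inf_le1)

lemma open_in_space_Int: "open_in_space m U \<Longrightarrow> open_in_space m V \<Longrightarrow> open_in_space m (U \<inter> V)"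
  unfolding open_in_space_def by auto

lemma open_in_space_Union: "(\<And>U. U \<in> \<U> \<Longrightarrow> open_in_space m U) \<Longrightarrow> open_in_space m (\<Union>\<U>)"
  unfolding open_in_space_def by auto

lemma open_in_space_meets_dense:
  assumes "open_in_space m U" "x \<in> U" "x \<in> closure D" "D \<subseteq> complex_space m"
  shows "U \<inter> D \<noteq> {}"
proof -
  obtain T where T: "open T" "U = complex_space m \<inter> T" using open_in_spaceE[OF assms(1)] by metis
  have "T \<inter> closure D \<noteq> {}" using assms(2,3) T(2) by blast
  hence "T \<inter> D \<noteq> {}" using T(1) by (simp add: open_Int_closure_eq_empty)
  thus ?thesis using T(2) assms(4) by blast
qed

lemma open_in_space_polydisc: "open_in_space m (polydisc m a r)"
proof -
  have "polydisc m a r = complex_space m \<inter> {x. \<forall>i<m. norm (x i - a i) < r}"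
    by (auto simp: polydisc_def)
  thus ?thesis
    by (simp add: open_in_space_Int_open open_coordinates)
qed

lemma open_in_space_whole: "open_in_space m (complex_space m)"
  by (simp add: open_in_space_def)

lemma polydisc_center: "a \<in> complex_space m \<Longrightarrow> 0 < r \<Longrightarrow> a \<in> polydisc m a r"
  by (auto simp: polydisc_def)

lemma polydisc_subset_space: "polydisc m a r \<subseteq> complex_space m"
  by (auto simp: polydisc_def)

lemma polydisc_mono: "r \<le> s \<Longrightarrow> polydisc m a r \<subseteq> polydisc m a s"
  by (force simp: polydisc_def)

text \<open>Basic open sets of the product topology may also restrict coordinates from
  \<open>m\<close> on, but there all points of the space are 0, so only the radii of the first
  \<open>m\<close> coordinates matter.\<close>

lemma polydisc_subset_open:
  assumes "open_in_space m U" "a \<in> U"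
  obtains r where "0 < r" "polydisc m a r \<subseteq> U"
proof -
  obtain T where T: "open T" "U = complex_space m \<inter> T"
    using assms(1) by (rule open_in_spaceE)
  have a: "a \<in> complex_space m" "a \<in> T" using assms T by auto
  have "openin (product_topology (\<lambda>i. euclidean) UNIV) T"
    using T(1) unfolding open_fun_def by auto
  from product_topology_open_contains_basis[OF this a(2)]
  obtain X where X: "a \<in> (\<Pi>\<^sub>E i\<in>UNIV. X i)" "\<And>i. open (X i)" "finite {i. X i \<noteq> UNIV}"
      "(\<Pi>\<^sub>E i\<in>UNIV. X i) \<subseteq> T"
    by auto
  have "\<exists>r>0. ball (a i) r \<subseteq> X i" for i
    using X(1) X(2)[of i] by (meson PiE_mem UNIV_I openE)
  then obtain r where r: "\<And>i. r i > 0" "\<And>i. ball (a i) (r i) \<subseteq> X i" by metis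
  \<comment> \<open>The inserted 1 keeps the minimum defined for \<open>m = 0\<close>.\<close>
  define \<rho> where "\<rho> = Min (insert 1 (r ` {..<m}))"
  have "\<rho> > 0" unfolding \<rho>_def using r(1) by (auto simp: Min_gr_iff)
  moreover have "polydisc m a \<rho> \<subseteq> U"
  proof
    fix x assume x: "x \<in> polydisc m a \<rho>"
    have "x i \<in> X i" for i
    proof (cases "i < m")
      case True
      hence "\<rho> \<le> r i" unfolding \<rho>_def by (intro Min_le) auto
      hence "x i \<in> ball (a i) (r i)"
        using x True by (fastforce simp: polydisc_def dist_norm norm_minus_commute)
      thus ?thesis using r(2) by blast
    next
      case False
      hence "x i = a i" using x a(1) by (auto simp: polydisc_def complex_space_def)
      thus ?thesis using X(1) by auto
    qed
    hence "x \<in> T" using X(4) by auto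
    thus "x \<in> U" using x T(2) by (auto simp: polydisc_def)
  qed
  ultimately show ?thesis using that by blast
qed

lemma polydisc_update:
  assumes "x \<in> polydisc m a r" "i < m" "norm (w - a i) < r"
  shows "x(i := w) \<in> polydisc m a r"
  using assms by (auto simp: polydisc_def complex_space_def)

lemma holomorphic_several_line:
  assumes g: "holomorphic_several m (polydisc m a r) g" and x: "x \<in> polydisc m a r" and i: "i < m"
  shows "(\<lambda>w. g (x(i := w))) holomorphic_on ball (a i) r"
  unfolding holomorphic_on_def
proof
  fix w assume w: "w \<in> ball (a i) r"
  hence "x(i := w) \<in> polydisc m a r"
    by (intro polydisc_update x i) (auto simp: dist_norm norm_minus_commute)
  hence "(\<lambda>v. g ((x(i := w))(i := v))) field_differentiable at ((x(i := w)) i)"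
    using g i unfolding holomorphic_several_def by blast
  hence "(\<lambda>v. g (x(i := v))) field_differentiable at w" by simp
  thus "(\<lambda>v. g (x(i := v))) field_differentiable at w within ball (a i) r"
    by (rule field_differentiable_at_within)
qed

text \<open>Propagates the vanishing one coordinate at a time, so no joint differentiability is needed.\<close>

lemma polydisc_identity:
  assumes g: "holomorphic_several m (polydisc m a r) g"
    and U: "open_in_space m U" "U \<noteq> {}" "U \<subseteq> polydisc m a r" and zero: "\<And>x. x \<in> U \<Longrightarrow> g x = 0"
    and p: "p \<in> polydisc m a r"
  shows "g p = 0"
proof -
  obtain b where b: "b \<in> U" using U by auto
  obtain d where d: "0 < d" "polydisc m b d \<subseteq> U" using polydisc_subset_open[OF U(1) b] by blast
  have br: "b \<in> polydisc m a r" using b U by auto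
  have "\<forall>x\<in>polydisc m a r. (\<forall>i<m. k \<le> i \<longrightarrow> norm (x i - b i) < d) \<longrightarrow> g x = 0" if "k \<le> m" for k
    using that
  proof (induction k)
    case 0
    show ?case using zero d(2) by (auto simp: polydisc_def subset_iff)
  next
    case (Suc k)
    have k: "k < m" using Suc by simp
    show ?case
    proof (intro ballI impI)
      fix x assume x: "x \<in> polydisc m a r" and xb: "\<forall>i<m. Suc k \<le> i \<longrightarrow> norm (x i - b i) < d"
      define f where "f = (\<lambda>w. g (x(k := w)))"
      have f: "f holomorphic_on ball (a k) r"
        unfolding f_def using g x k by (rule holomorphic_several_line)
      have bk: "b k \<in> ball (a k) r" using br k by (auto simp: polydisc_def dist_norm norm_minus_commute)
      have "f w = 0" if "w \<in> ball (a k) r \<inter> ball (b k) d" for w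
      proof -
        have "x(k := w) \<in> polydisc m a r"
          using that by (intro polydisc_update x k) (auto simp: dist_norm norm_minus_commute)
        moreover have "\<forall>i<m. k \<le> i \<longrightarrow> norm ((x(k := w)) i - b i) < d"
          using xb that by (auto simp: dist_norm norm_minus_commute)
        ultimately show ?thesis using Suc k by (auto simp: f_def)
      qed
      moreover have "x k \<in> ball (a k) r"
        using x k by (auto simp: polydisc_def dist_norm norm_minus_commute)
      moreover have "ball (a k) r \<inter> ball (b k) d \<noteq> {}" using bk d(1) by auto
      ultimately have "f (x k) = 0"
        using analytic_continuation_open[of "ball (a k) r \<inter> ball (b k) d" "ball (a k) r" f "\<lambda>_. 0"] f
        by (auto simp: holomorphic_on_const)
      thus "g x = 0" by (simp add: f_def)
    qed
  qed
  from this[of m] show ?thesis using p by auto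
qed

lemma polydisc_nonzero_dense:
  assumes "holomorphic_several m (polydisc m a r) h" "\<exists>x\<in>polydisc m a r. h x \<noteq> 0"
    "open_in_space m U" "U \<noteq> {}" "U \<subseteq> polydisc m a r"
  shows "\<exists>x\<in>U. h x \<noteq> 0"
  using polydisc_identity[OF assms(1,3-5)] assms(2) by blast

lemma open_in_space_nonzero:
  assumes "continuous_on U h" "open_in_space m U"
  shows "open_in_space m {x\<in>U. h x \<noteq> (0 :: complex)}"
proof -
  have "openin (top_of_set U) (U \<inter> h -` (- {0}))"
    using assms(1) by (intro continuous_openin_preimage_gen) auto
  moreover have "U \<inter> h -` (- {0}) = {x\<in>U. h x \<noteq> 0}" by auto
  ultimately show ?thesis
    using assms(2) unfolding open_in_space_def by (metis openin_trans)
qed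

lemma holomorphic_several_subset:
  "holomorphic_several m U f \<Longrightarrow> V \<subseteq> U \<Longrightarrow> holomorphic_several m V f"
  unfolding holomorphic_several_def by (blast intro: continuous_on_subset)

lemma holomorphic_several_const: "holomorphic_several m U (\<lambda>_. c)"
  by (auto simp: holomorphic_several_def)

lemma holomorphic_several_add:
  "holomorphic_several m U f \<Longrightarrow> holomorphic_several m U g \<Longrightarrow> holomorphic_several m U (\<lambda>x. f x + g x)"
  by (auto simp: holomorphic_several_def intro!: continuous_intros derivative_intros)

lemma holomorphic_several_mult:
  "holomorphic_several m U f \<Longrightarrow> holomorphic_several m U g \<Longrightarrow> holomorphic_several m U (\<lambda>x. f x * g x)"
  by (auto simp: holomorphic_several_def intro!: continuous_intros derivative_intros)

text \<open>
  Meromorphic on a subset of \<open>\<complex>\<^sup>m\<close>, with polydiscs as the neighbourhoods; there a holomorphic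
  denominator vanishes on no open set as soon as it is not identically zero.
\<close>

definition quotient_on :: "nat \<Rightarrow> (nat \<Rightarrow> complex) set \<Rightarrow> ((nat \<Rightarrow> complex) \<Rightarrow> complex) \<Rightarrow>
    ((nat \<Rightarrow> complex) \<Rightarrow> complex) \<Rightarrow> ((nat \<Rightarrow> complex) \<Rightarrow> complex) \<Rightarrow> bool" where
  "quotient_on m U f g h \<longleftrightarrow> holomorphic_several m U g \<and> holomorphic_several m U h \<and>
     (\<exists>x\<in>U. h x \<noteq> 0) \<and> (\<forall>x\<in>U. h x \<noteq> 0 \<longrightarrow> f x = g x / h x)"

definition meromorphic_in :: "nat \<Rightarrow> (nat \<Rightarrow> complex) set \<Rightarrow> ((nat \<Rightarrow> complex) \<Rightarrow> complex) \<Rightarrow> bool" where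
  "meromorphic_in m W f \<longleftrightarrow> (\<forall>a\<in>W. \<exists>r>0. \<exists>g h. quotient_on m (polydisc m a r) f g h)"

lemma meromorphic_inE:
  assumes "meromorphic_in m W f" "a \<in> W"
  obtains r g h where "0 < r" "quotient_on m (polydisc m a r) f g h"
  using assms unfolding meromorphic_in_def by blast

text \<open>Only the existence of a point with \<open>h x \<noteq> 0\<close> could fail on a smaller
  polydisc, and the identity principle excludes that. The centre may move.\<close>

lemma quotient_on_shrink:
  assumes "quotient_on m (polydisc m a r) f g h" "polydisc m b s \<subseteq> polydisc m a r"
    "b \<in> complex_space m" "0 < s"
  shows "quotient_on m (polydisc m b s) f g h"
proof -
  have "\<exists>x\<in>polydisc m b s. h x \<noteq> 0"
    by (rule polydisc_nonzero_dense[of m a r h])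
       (use assms polydisc_center[of b m s] open_in_space_polydisc in \<open>auto simp: quotient_on_def\<close>)
  thus ?thesis
    using assms holomorphic_several_subset[OF _ assms(2)] unfolding quotient_on_def by blast
qed

text \<open>For a holomorphic denominator on a polydisc, nonvanishing somewhere and nonvanishing on
  a dense set are the same, by the identity principle. This trades the density condition of the
  definition for one that survives restriction and products.\<close>

lemma meromorphic_several_iff: "meromorphic_several m f \<longleftrightarrow> meromorphic_in m (complex_space m) f"
proof
  assume f: "meromorphic_several m f"
  show "meromorphic_in m (complex_space m) f"
    unfolding meromorphic_in_def
  proof
    fix a assume a: "a \<in> complex_space m"
    then obtain U g h where U: "open_in_space m U" "a \<in> U" "holomorphic_several m U g"
        "holomorphic_several m U h" "U \<subseteq> closure {x\<in>U. h x \<noteq> 0}"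
        "\<forall>x\<in>U. h x \<noteq> 0 \<longrightarrow> f x = g x / h x"
      using f unfolding meromorphic_several_def by meson
    obtain r where r: "0 < r" "polydisc m a r \<subseteq> U" using polydisc_subset_open[OF U(1,2)] by blast
    have "polydisc m a r \<inter> {x\<in>U. h x \<noteq> 0} \<noteq> {}"
      by (rule open_in_space_meets_dense[OF open_in_space_polydisc polydisc_center[OF a r(1)]])
         (use polydisc_center[OF a r(1)] r(2) U(5) open_in_space_subset[OF U(1)] in auto)
    hence "\<exists>x\<in>polydisc m a r. h x \<noteq> 0" by auto
    hence "quotient_on m (polydisc m a r) f g h"
      using U(3,4,6) r(2) unfolding quotient_on_def by (auto intro: holomorphic_several_subset)
    thus "\<exists>r>0. \<exists>g h. quotient_on m (polydisc m a r) f g h" using r(1) by blast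
  qed
next
  assume f: "meromorphic_in m (complex_space m) f"
  show "meromorphic_several m f"
    unfolding meromorphic_several_def
  proof
    fix a assume a: "a \<in> complex_space m"
    obtain r g h where r: "0 < r" "quotient_on m (polydisc m a r) f g h"
      using meromorphic_inE[OF f a] by metis
    let ?U = "polydisc m a r"
    have "?U \<subseteq> closure {x\<in>?U. h x \<noteq> 0}"
    proof (rule subsetI, rule ccontr)
      fix x assume x: "x \<in> ?U" "x \<notin> closure {x\<in>?U. h x \<noteq> 0}"
      let ?V = "?U \<inter> (complex_space m \<inter> - closure {x\<in>?U. h x \<noteq> 0})"
      have "\<exists>y\<in>?V. h y \<noteq> 0"
        by (rule polydisc_nonzero_dense[of m a r h])
           (use x r(2) polydisc_subset_space[of m a r] in \<open>auto simp: quotient_on_def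
              intro!: open_in_space_Int open_in_space_polydisc open_in_space_Int_open\<close>)
      thus False using closure_subset[of "{x\<in>?U. h x \<noteq> 0}"] by auto
    qed
    thus "\<exists>U g h. open_in_space m U \<and> a \<in> U \<and> holomorphic_several m U g \<and> holomorphic_several m U h \<and>
        U \<subseteq> closure {x\<in>U. h x \<noteq> 0} \<and> (\<forall>x\<in>U. h x \<noteq> 0 \<longrightarrow> f x = g x / h x)"
      using r open_in_space_polydisc polydisc_center[OF a r(1)] unfolding quotient_on_def
      by (intro exI[of _ ?U] exI[of _ g] exI[of _ h]) auto
  qed
qed

section \<open>Algebra of meromorphic functions and their identity theorem\<close>

lemma meromorphic_in_subset: "meromorphic_in m W f \<Longrightarrow> V \<subseteq> W \<Longrightarrow> meromorphic_in m V f"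
  unfolding meromorphic_in_def by blast

lemma meromorphic_in_quotient:
  assumes W: "open_in_space m W" and "holomorphic_several m W g" "holomorphic_several m W h"
    and nz: "\<And>U. open_in_space m U \<Longrightarrow> U \<noteq> {} \<Longrightarrow> U \<subseteq> W \<Longrightarrow> \<exists>x\<in>U. h x \<noteq> 0"
    and "\<And>x. x \<in> W \<Longrightarrow> h x \<noteq> 0 \<Longrightarrow> f x = g x / h x"
  shows "meromorphic_in m W f"
  unfolding meromorphic_in_def
proof
  fix a assume a: "a \<in> W"
  obtain r where r: "0 < r" "polydisc m a r \<subseteq> W" using polydisc_subset_open[OF W a] by blast
  have "polydisc m a r \<noteq> {}" using polydisc_center r a W open_in_space_subset by blast
  hence "quotient_on m (polydisc m a r) f g h"
    using assms r nz[OF open_in_space_polydisc] unfolding quotient_on_def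
    by (auto intro: holomorphic_several_subset)
  thus "\<exists>r>0. \<exists>g h. quotient_on m (polydisc m a r) f g h" using r(1) by blast
qed

lemma meromorphic_in_const:
  "W \<subseteq> complex_space m \<Longrightarrow> meromorphic_in m W (\<lambda>_. c)"
  by (rule meromorphic_in_subset[of _ "complex_space m"],
      rule meromorphic_in_quotient[of m "complex_space m" "\<lambda>_. c" "\<lambda>_. 1"])
     (auto intro: open_in_space_whole holomorphic_several_const)

text \<open>The common part of sum and product: both quotients are brought to one polydisc, where
  the product of the denominators is not identically zero because holomorphic functions on a
  polydisc have no zero divisors.\<close>

lemma meromorphic_in_combine:
  assumes f: "meromorphic_in m W f1" "meromorphic_in m W f2" and W: "W \<subseteq> complex_space m"
    and comb: "\<And>r a g1 h1 g2 h2. 0 < r \<Longrightarrow> a \<in> W \<Longrightarrow> quotient_on m (polydisc m a r) f1 g1 h1 \<Longrightarrow>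
      quotient_on m (polydisc m a r) f2 g2 h2 \<Longrightarrow> \<exists>x\<in>polydisc m a r. h1 x * h2 x \<noteq> 0 \<Longrightarrow>
      \<exists>g h. quotient_on m (polydisc m a r) f g h"
  shows "meromorphic_in m W f"
  unfolding meromorphic_in_def
proof
  fix a assume aW: "a \<in> W"
  hence a: "a \<in> complex_space m" using W by auto
  obtain r1 g1 h1 where 1: "0 < r1" "quotient_on m (polydisc m a r1) f1 g1 h1"
    using meromorphic_inE[OF f(1) aW] by metis
  obtain r2 g2 h2 where 2: "0 < r2" "quotient_on m (polydisc m a r2) f2 g2 h2"
    using meromorphic_inE[OF f(2) aW] by metis
  define r where "r = min r1 r2"
  have r: "0 < r" using 1 2 by (simp add: r_def)
  have q1: "quotient_on m (polydisc m a r) f1 g1 h1"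
    using quotient_on_shrink[OF 1(2) _ a r] by (simp add: polydisc_mono r_def)
  have q2: "quotient_on m (polydisc m a r) f2 g2 h2"
    using quotient_on_shrink[OF 2(2) _ a r] by (simp add: polydisc_mono r_def)
  have "\<exists>x\<in>{x\<in>polydisc m a r. h1 x \<noteq> 0}. h2 x \<noteq> 0"
    by (rule polydisc_nonzero_dense[of m a r h2])
       (use q1 q2 in \<open>auto simp: quotient_on_def holomorphic_several_def
          intro!: open_in_space_nonzero open_in_space_polydisc\<close>)
  hence "\<exists>g h. quotient_on m (polydisc m a r) f g h" using comb[OF r aW q1 q2] by auto
  thus "\<exists>r>0. \<exists>g h. quotient_on m (polydisc m a r) f g h" using r by blast
qed

lemma meromorphic_in_add:
  assumes "meromorphic_in m W f1" "meromorphic_in m W f2" "W \<subseteq> complex_space m"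
  shows "meromorphic_in m W (\<lambda>x. f1 x + f2 x)"
proof (rule meromorphic_in_combine[OF assms])
  fix r a g1 h1 g2 h2
  assume "quotient_on m (polydisc m a r) f1 g1 h1" "quotient_on m (polydisc m a r) f2 g2 h2"
    "\<exists>x\<in>polydisc m a r. h1 x * h2 x \<noteq> 0"
  hence "quotient_on m (polydisc m a r) (\<lambda>x. f1 x + f2 x) (\<lambda>x. g1 x * h2 x + g2 x * h1 x) (\<lambda>x. h1 x * h2 x)"
    unfolding quotient_on_def
    by (auto intro!: holomorphic_several_add holomorphic_several_mult simp: add_frac_eq)
  thus "\<exists>g h. quotient_on m (polydisc m a r) (\<lambda>x. f1 x + f2 x) g h" by blast
qed

lemma meromorphic_in_mult:
  assumes "meromorphic_in m W f1" "meromorphic_in m W f2" "W \<subseteq> complex_space m"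
  shows "meromorphic_in m W (\<lambda>x. f1 x * f2 x)"
proof (rule meromorphic_in_combine[OF assms])
  fix r a g1 h1 g2 h2
  assume "quotient_on m (polydisc m a r) f1 g1 h1" "quotient_on m (polydisc m a r) f2 g2 h2"
    "\<exists>x\<in>polydisc m a r. h1 x * h2 x \<noteq> 0"
  hence "quotient_on m (polydisc m a r) (\<lambda>x. f1 x * f2 x) (\<lambda>x. g1 x * g2 x) (\<lambda>x. h1 x * h2 x)"
    unfolding quotient_on_def
    by (auto intro!: holomorphic_several_add holomorphic_several_mult simp: add_frac_eq)
  thus "\<exists>g h. quotient_on m (polydisc m a r) (\<lambda>x. f1 x * f2 x) g h" by blast
qed

lemma meromorphic_in_sum:
  assumes "\<And>i. i \<in> I \<Longrightarrow> meromorphic_in m W (f i)" "W \<subseteq> complex_space m"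
  shows "meromorphic_in m W (\<lambda>x. \<Sum>i\<in>I. f i x)"
  using assms(1)
proof (induction I rule: infinite_finite_induct)
  case (insert i I)
  then show ?case using assms(2) by (auto intro!: meromorphic_in_add)
qed (auto intro!: meromorphic_in_const assms(2))

text \<open>\<open>D\<close> is the largest open subset of \<open>W\<close> on which
  \<open>f\<close> vanishes, and its closure in \<open>W\<close> is shown to be open in
  \<open>W\<close>. Only density can be concluded, since the values of \<open>f\<close> on the zero
  set of a denominator are arbitrary.\<close>

lemma meromorphic_identity:
  assumes f: "meromorphic_in m W f" and W: "open_in_space m W" "connected W"
    and U: "open_in_space m U" "U \<noteq> {}" "U \<subseteq> W" "\<And>x. x \<in> U \<Longrightarrow> f x = 0"
  obtains D where "open_in_space m D" "D \<subseteq> W" "W \<subseteq> closure D" "\<And>x. x \<in> D \<Longrightarrow> f x = 0"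
proof -
  define D where "D = \<Union>{O'. open_in_space m O' \<and> O' \<subseteq> W \<and> (\<forall>x\<in>O'. f x = 0)}"
  have D: "open_in_space m D"
    unfolding D_def by (rule open_in_space_Union) simp
  have D': "D \<subseteq> W" "\<And>x. x \<in> D \<Longrightarrow> f x = 0"
    unfolding D_def by blast+
  have DI: "O' \<subseteq> D" if "open_in_space m O'" "O' \<subseteq> W" "\<And>x. x \<in> O' \<Longrightarrow> f x = 0" for O'
    using that unfolding D_def by blast
  have WS: "W \<subseteq> complex_space m" using W(1) by (rule open_in_space_subset)
  \<comment> \<open>Near a limit point of \<open>D\<close> the numerator vanishes on an open set,
    hence on the whole polydisc; off the zeros of the denominator \<open>f\<close> is then 0, and
    these points are dense.\<close>
  have spread: "\<exists>r>0. polydisc m a r \<subseteq> W \<inter> closure D" if aW: "a \<in> W" "a \<in> closure D" for a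
  proof -
    have a: "a \<in> complex_space m" using aW WS by auto
    obtain r1 g h where q1: "0 < r1" "quotient_on m (polydisc m a r1) f g h"
      using meromorphic_inE[OF f aW(1)] by metis
    obtain r2 where r2: "0 < r2" "polydisc m a r2 \<subseteq> W"
      using polydisc_subset_open[OF W(1) aW(1)] by blast
    define r where "r = min r1 r2"
    have r: "0 < r" "polydisc m a r \<subseteq> W"
      using q1 r2 polydisc_mono[of r r2 m a] by (auto simp: r_def)
    have q: "quotient_on m (polydisc m a r) f g h"
      using quotient_on_shrink[OF q1(2) _ a r(1)] by (simp add: polydisc_mono r_def)
    let ?P = "polydisc m a r"
    let ?N = "{x\<in>?P. h x \<noteq> 0}"
    have N: "open_in_space m ?N"
      using q by (auto simp: quotient_on_def holomorphic_several_def
          intro!: open_in_space_nonzero open_in_space_polydisc)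
    have ne: "D \<inter> ?P \<noteq> {}"
      using open_in_space_meets_dense[OF open_in_space_polydisc polydisc_center[OF a r(1)] aW(2)] D'(1) WS
      by auto
    have PD: "open_in_space m (D \<inter> ?P)"
      by (intro open_in_space_Int D open_in_space_polydisc)
    have "\<exists>x\<in>D \<inter> ?P. h x \<noteq> 0"
      by (rule polydisc_nonzero_dense[of m a r h]) (use q ne PD in \<open>auto simp: quotient_on_def\<close>)
    hence ne': "(D \<inter> ?P) \<inter> ?N \<noteq> {}" by auto
    have g0: "g x = 0" if "x \<in> ?P" for x
    proof (rule polydisc_identity[of m a r g "(D \<inter> ?P) \<inter> ?N"])
      show "g x = 0" if "x \<in> (D \<inter> ?P) \<inter> ?N" for x
        using that q D'(2)[of x] by (auto simp: quotient_on_def)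
    qed (use q ne' that in \<open>auto simp: quotient_on_def intro!: open_in_space_Int PD N\<close>)
    have ND: "?N \<subseteq> D"
      by (rule DI[OF N]) (use r(2) q g0 in \<open>auto simp: quotient_on_def\<close>)
    have "?P \<subseteq> closure D"
    proof (rule subsetI, rule ccontr)
      fix x assume x: "x \<in> ?P" "x \<notin> closure D"
      let ?V = "?P \<inter> (complex_space m \<inter> - closure D)"
      have "\<exists>y\<in>?V. h y \<noteq> 0"
        by (rule polydisc_nonzero_dense[of m a r h])
           (use x q polydisc_subset_space[of m a r] in \<open>auto simp: quotient_on_def
              intro!: open_in_space_Int open_in_space_polydisc open_in_space_Int_open\<close>)
      thus False using ND closure_subset[of D] by auto
    qed
    thus ?thesis using r by blast
  qed
  have "closedin (top_of_set W) (W \<inter> closure D)" by (simp add: closedin_closed_Int)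
  moreover have "openin (top_of_set W) (W \<inter> closure D)"
  proof (subst openin_subopen, intro ballI)
    fix a assume "a \<in> W \<inter> closure D"
    then obtain r where r: "r > 0" "polydisc m a r \<subseteq> W \<inter> closure D" "a \<in> complex_space m"
      using spread WS by (metis IntE subsetD)
    have "openin (top_of_set W) (polydisc m a r)"
      using open_in_space_polydisc[of m a r] r(2) WS unfolding open_in_space_def
      by (metis inf.bounded_iff openin_subset_trans)
    thus "\<exists>T. openin (top_of_set W) T \<and> a \<in> T \<and> T \<subseteq> W \<inter> closure D"
      using r polydisc_center[OF r(3,1)] by blast
  qed
  moreover have "W \<inter> closure D \<noteq> {}"
    using DI[OF U(1,3,4)] U(2,3) closure_subset[of D] by blast
  ultimately have "W \<inter> closure D = W" using W(2) unfolding connected_clopen by blast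
  hence "W \<subseteq> closure D" by blast
  thus ?thesis using that D D' by blast
qed

lemma connected_star:
  fixes W :: "(nat \<Rightarrow> complex) set"
  assumes "\<And>x t. x \<in> W \<Longrightarrow> 0 \<le> t \<Longrightarrow> t \<le> 1 \<Longrightarrow> (\<lambda>i. complex_of_real t * x i) \<in> W"
  shows "connected W"
proof -
  have "connected ((\<lambda>t i. complex_of_real t * x i) ` {0..1})" for x :: "nat \<Rightarrow> complex"
    by (intro connected_continuous_image continuous_on_coordinatewise_then_product continuous_intros) auto
  moreover have "W = (\<Union>x\<in>W. (\<lambda>t i. complex_of_real t * x i) ` {0..1})"
  proof
    have "x \<in> (\<lambda>t i. complex_of_real t * x i) ` {0..1}" for x :: "nat \<Rightarrow> complex"
      by (rule image_eqI[of _ _ 1]) auto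
    thus "W \<subseteq> (\<Union>x\<in>W. (\<lambda>t i. complex_of_real t * x i) ` {0..1})" by blast
  qed (use assms in auto)
  moreover have "(\<lambda>i. 0) \<in> \<Inter>((\<lambda>x. (\<lambda>t i. complex_of_real t * x i) ` {0..1}) ` W)"
    by (auto intro: image_eqI[of _ _ "0::real"])
  ultimately show ?thesis
    by (metis (no_types, lifting) connected_Union empty_iff imageE)
qed

lemma connected_complex_space: "connected (complex_space m)"
  by (rule connected_star) (auto simp: complex_space_def)

lemma connected_polydisc: "connected (polydisc m (\<lambda>_. 0) r)"
proof (rule connected_star)
  fix x and t :: real assume x: "x \<in> polydisc m (\<lambda>_. 0) r" and t: "0 \<le> t" "t \<le> 1"
  have "norm (complex_of_real t * x i) \<le> norm (x i)" for i
    using t by (simp add: norm_mult mult_left_le_one_le)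
  thus "(\<lambda>i. complex_of_real t * x i) \<in> polydisc m (\<lambda>_. 0) r"
    using x by (auto simp: polydisc_def complex_space_def intro: le_less_trans)
qed

text \<open>The identity theorem gives agreement only on a dense set, while
  \<open>is_correlator\<close> prescribes the values on a whole punctured polydisc. By continuity
  \<open>S\<close> equals \<open>g / h\<close> wherever \<open>h\<close> is nonzero, so
  \<open>f\<close> may be overwritten by \<open>S\<close> on \<open>V\<close> without touching
  numerators and denominators.\<close>

lemma meromorphic_in_modify:
  assumes f: "meromorphic_in m W f" and W: "W \<subseteq> complex_space m"
    and V: "open_in_space m V" "continuous_on V S"
    and D: "D \<subseteq> complex_space m" "V \<subseteq> closure D" "\<And>x. x \<in> D \<Longrightarrow> x \<in> V \<Longrightarrow> f x = S x"
  shows "meromorphic_in m W (\<lambda>x. if x \<in> V then S x else f x)"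
  unfolding meromorphic_in_def
proof
  fix a assume aW: "a \<in> W"
  obtain r g h where r: "0 < r" and q: "quotient_on m (polydisc m a r) f g h"
    using meromorphic_inE[OF f aW] by metis
  let ?P = "polydisc m a r"
  have S: "S x = g x / h x" if x: "x \<in> ?P" "h x \<noteq> 0" "x \<in> V" for x
  proof (rule ccontr)
    assume neq: "S x \<noteq> g x / h x"
    let ?N = "{x\<in>?P. h x \<noteq> 0} \<inter> V"
    have N: "open_in_space m ?N"
      using q V(1) by (auto simp: quotient_on_def holomorphic_several_def
          intro!: open_in_space_Int open_in_space_nonzero open_in_space_polydisc)
    have gh: "continuous_on ?P g" "continuous_on ?P h"
      using q by (auto simp: quotient_on_def holomorphic_several_def)
    have "continuous_on ?N (\<lambda>x. S x - g x / h x)"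
      by (intro continuous_intros continuous_on_subset[OF gh(1)] continuous_on_subset[OF gh(2)]
          continuous_on_subset[OF V(2)]) auto
    hence "open_in_space m {x\<in>?N. S x - g x / h x \<noteq> 0}"
      using N by (rule open_in_space_nonzero)
    from open_in_space_meets_dense[OF this, of x D]
    obtain y where y: "y \<in> D" "y \<in> ?N" "S y \<noteq> g y / h y"
      using x neq D(1,2) by auto
    have "f y = g y / h y" using q y(2) by (auto simp: quotient_on_def)
    moreover have "f y = S y" using D(3)[of y] y by auto
    ultimately show False using y(3) by simp
  qed
  have "quotient_on m ?P (\<lambda>x. if x \<in> V then S x else f x) g h"
    using q S unfolding quotient_on_def by auto
  thus "\<exists>r>0. \<exists>g h. quotient_on m (polydisc m a r) (\<lambda>x. if x \<in> V then S x else f x) g h"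
    using r by blast
qed

text \<open>The linear map that adds up the variables with equal label \<open>s i\<close>; a
  variable with label at least \<open>k\<close> is dropped. Both the merged argument u + v + z_J and
  the linear forms u + z_I arise in this way.\<close>

definition collect :: "nat \<Rightarrow> nat \<Rightarrow> (nat \<Rightarrow> nat) \<Rightarrow> (nat \<Rightarrow> complex) \<Rightarrow> nat \<Rightarrow> complex" where
  "collect m k s x = (\<lambda>j. if j < k then \<Sum>i | i < m \<and> s i = j. x i else 0)"

text \<open>Moving one variable translates at most one coordinate of the image, so holomorphy of a
  pullback in each variable is the chain rule with a translation.\<close>

lemma collect_update:
  assumes "i < m"
  shows "collect m k s (x(i := w)) =
    (if s i < k then (collect m k s x)(s i := w + (collect m k s x (s i) - x i)) else collect m k s x)"
proof
  fix j
  have [simp]: "finite {i. i < m \<and> s i = j}" for j by (rule finite_subset[of _ "{..<m}"]) auto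
  have "(\<Sum>l | l < m \<and> s l = s i. (x(i := w)) l) =
      (x(i := w)) i + (\<Sum>l \<in> {l. l < m \<and> s l = s i} - {i}. (x(i := w)) l)"
    by (rule sum.remove) (use assms in auto)
  moreover have "(\<Sum>l | l < m \<and> s l = s i. x l) =
      x i + (\<Sum>l \<in> {l. l < m \<and> s l = s i} - {i}. x l)"
    by (rule sum.remove) (use assms in auto)
  moreover have "(\<Sum>l \<in> {l. l < m \<and> s l = s i} - {i}. (x(i := w)) l) =
      (\<Sum>l \<in> {l. l < m \<and> s l = s i} - {i}. x l)"
    by (intro sum.cong) auto
  ultimately have 1: "(\<Sum>l | l < m \<and> s l = s i. (x(i := w)) l) =
      w + ((\<Sum>l | l < m \<and> s l = s i. x l) - x i)"
    by simp
  have 2: "(\<Sum>l | l < m \<and> s l = j. (x(i := w)) l) = (\<Sum>l | l < m \<and> s l = j. x l)" if "s i \<noteq> j"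
    using that by (intro sum.cong) auto
  show "collect m k s (x(i := w)) j = (if s i < k then (collect m k s x)(s i := w +
      (collect m k s x (s i) - x i)) else collect m k s x) j"
    using 1 2 by (auto simp: collect_def)
qed

lemma collect_in_space: "collect m k s x \<in> complex_space k"
  by (auto simp: collect_def complex_space_def)

text \<open>A coordinate of the image is a sum of at most \<open>m\<close> variables; dividing by
  \<open>m + 1\<close> instead of \<open>m\<close> gives a strict bound and allows
  \<open>m = 0\<close>.\<close>

lemma collect_polydisc:
  assumes "x \<in> polydisc m a (r / (real m + 1))" "0 < r"
  shows "collect m k s x \<in> polydisc k (collect m k s a) r"
proof -
  have "norm (collect m k s x j - collect m k s a j) < r" if "j < k" for j
  proof -
    let ?I = "{i. i < m \<and> s i = j}"
    have fin: "finite ?I" by (rule finite_subset[of _ "{..<m}"]) auto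
    have "card ?I \<le> card {..<m}" by (rule card_mono) auto
    hence card: "card ?I \<le> m" by simp
    have "norm (collect m k s x j - collect m k s a j) = norm (\<Sum>i\<in>?I. x i - a i)"
      using that by (simp add: collect_def sum_subtractf)
    also have "\<dots> \<le> (\<Sum>i\<in>?I. r / (real m + 1))"
      by (rule sum_norm_le) (use assms in \<open>auto simp: polydisc_def intro: less_imp_le\<close>)
    also have "\<dots> = real (card ?I) * (r / (real m + 1))" by simp
    also have "\<dots> \<le> real m * (r / (real m + 1))"
      using card assms(2) by (intro mult_right_mono) auto
    also have "\<dots> < r" using assms(2) by (simp add: field_simps)
    finally show ?thesis .
  qed
  thus ?thesis by (auto simp: polydisc_def collect_in_space)
qed

lemma continuous_on_collect: "continuous_on X (collect m k s)"
proof (rule continuous_on_coordinatewise_then_product)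
  fix j show "continuous_on X (\<lambda>x. collect m k s x j)"
    by (cases "j < k") (auto simp: collect_def intro!: continuous_intros continuous_on_product_coordinates
        continuous_on_subset[OF continuous_on_product_coordinates])
qed

lemma holomorphic_several_collect:
  assumes g: "holomorphic_several k V g" and UV: "\<And>x. x \<in> U \<Longrightarrow> collect m k s x \<in> V"
  shows "holomorphic_several m U (\<lambda>x. g (collect m k s x))"
  unfolding holomorphic_several_def
proof (intro conjI ballI allI impI)
  have "continuous_on (collect m k s ` U) g"
    using g UV by (auto simp: holomorphic_several_def intro: continuous_on_subset)
  thus "continuous_on U (\<lambda>x. g (collect m k s x))"
    using continuous_on_compose2[OF _ continuous_on_collect] by blast
  fix x i assume x: "x \<in> U" and i: "i < m"
  show "(\<lambda>w. g (collect m k s (x(i := w)))) field_differentiable at (x i)"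
  proof (cases "s i < k")
    case True
    let ?y = "collect m k s x"
    have "(\<lambda>v. g (?y(s i := v))) field_differentiable at (?y (s i))"
      using g UV[OF x] True by (auto simp: holomorphic_several_def)
    moreover have "(\<lambda>w. w + (?y (s i) - x i)) field_differentiable at (x i)"
      by (intro derivative_intros)
    ultimately have "((\<lambda>v. g (?y(s i := v))) \<circ> (\<lambda>w. w + (?y (s i) - x i))) field_differentiable at (x i)"
      by (intro field_differentiable_compose) auto
    thus ?thesis using True i by (simp add: collect_update o_def)
  qed (use i in \<open>simp add: collect_update\<close>)
qed

text \<open>Every label has a variable \<open>t j\<close> to which the whole correction can be
  given; the other variables stay put.\<close>

lemma collect_onto:
  assumes onto: "{..<k} \<subseteq> s ` {..<m}" and a: "a \<in> complex_space m" and r: "0 < r"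
    and y: "y \<in> polydisc k (collect m k s a) r"
  obtains x where "x \<in> polydisc m a r" "collect m k s x = y"
proof -
  have "\<exists>i<m. s i = j" if "j < k" for j using onto that by blast
  then obtain t where t: "\<And>j. j < k \<Longrightarrow> t j < m" "\<And>j. j < k \<Longrightarrow> s (t j) = j" by metis
  define x where "x = (\<lambda>i. a i + (if i < m \<and> s i < k \<and> i = t (s i) then y (s i) - collect m k s a (s i) else 0))"
  have "x \<in> polydisc m a r"
    using a y r by (auto simp: x_def polydisc_def complex_space_def)
  moreover have "collect m k s x j = y j" for j
  proof (cases "j < k")
    case True
    have "(\<Sum>i | i < m \<and> s i = j. x i) = (\<Sum>i | i < m \<and> s i = j. a i) +
        (\<Sum>i | i < m \<and> s i = j. if i = t j then y j - collect m k s a j else 0)"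
      unfolding x_def using True by (subst sum.distrib[symmetric], intro sum.cong) auto
    also have "(\<Sum>i | i < m \<and> s i = j. if i = t j then y j - collect m k s a j else 0) =
        y j - collect m k s a j"
      using True t by (subst sum.delta) auto
    finally show ?thesis using True by (simp add: collect_def)
  next
    case False
    thus ?thesis using y by (auto simp: collect_def polydisc_def complex_space_def)
  qed
  ultimately show ?thesis using that by blast
qed

text \<open>Surjectivity of the linear map is what prevents the pulled back denominator from
  vanishing identically.\<close>

lemma meromorphic_in_collect:
  assumes f: "meromorphic_in k (complex_space k) f" and onto: "{..<k} \<subseteq> s ` {..<m}"
  shows "meromorphic_in m (complex_space m) (\<lambda>x. f (collect m k s x))"
  unfolding meromorphic_in_def
proof
  fix a assume a: "a \<in> complex_space m"
  let ?b = "collect m k s a"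
  obtain r g h where r: "0 < r" and q: "quotient_on k (polydisc k ?b r) f g h"
    using meromorphic_inE[OF f collect_in_space] by metis
  \<comment> \<open>\<open>collect\<close> maps the polydisc of radius \<open>d\<close> into that of
    radius \<open>r\<close>; a point with \<open>h y \<noteq> 0\<close> is sought within radius
    \<open>d\<close> of the image centre, where it is certain to be attained.\<close>
  define d where "d = r / (real m + 1)"
  have d: "0 < d" "d \<le> r" using r by (auto simp: d_def field_simps)
  have "\<exists>y\<in>polydisc k ?b d. h y \<noteq> 0"
    using quotient_on_shrink[OF q polydisc_mono[OF d(2)] collect_in_space d(1)]
    by (simp add: quotient_on_def)
  then obtain y where y: "y \<in> polydisc k ?b d" "h y \<noteq> 0" by blast
  obtain x where x: "x \<in> polydisc m a d" "collect m k s x = y"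
    using collect_onto[OF onto a d(1) y(1)] by metis
  have sub: "collect m k s x \<in> polydisc k ?b r" if "x \<in> polydisc m a d" for x
    using collect_polydisc[of x m a r] that r by (simp add: d_def)
  have "quotient_on m (polydisc m a d) (\<lambda>x. f (collect m k s x)) (\<lambda>x. g (collect m k s x))
      (\<lambda>x. h (collect m k s x))"
    unfolding quotient_on_def
  proof (intro conjI)
    show "\<exists>x\<in>polydisc m a d. h (collect m k s x) \<noteq> 0" using x y by blast
    show "\<forall>x\<in>polydisc m a d. h (collect m k s x) \<noteq> 0 \<longrightarrow>
        f (collect m k s x) = g (collect m k s x) / h (collect m k s x)"
      using sub q by (auto simp: quotient_on_def)
  qed (use sub q in \<open>auto simp: quotient_on_def intro!: holomorphic_several_collect[where V = "polydisc k ?b r"]\<close>)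
  thus "\<exists>r>0. \<exists>g h. quotient_on m (polydisc m a r) (\<lambda>x. f (collect m k s x)) g h"
    using d(1) by blast
qed

lemma meromorphic_in_one:
  assumes "g holomorphic_on UNIV" "h holomorphic_on UNIV" "\<exists>z. h z \<noteq> (0::complex)"
    and "\<And>z. h z \<noteq> 0 \<Longrightarrow> f z = g z / h z"
  shows "meromorphic_in 1 (complex_space 1) (\<lambda>x. f (x 0))"
proof -
  have hol: "holomorphic_several 1 (complex_space 1) (\<lambda>x. g (x 0))" if "g holomorphic_on UNIV" for g
    unfolding holomorphic_several_def
  proof (intro conjI ballI allI impI)
    show "continuous_on (complex_space 1) (\<lambda>x. g (x 0))"
      by (rule continuous_on_compose2[OF holomorphic_on_imp_continuous_on[OF that]])
         (auto intro: continuous_on_subset[OF continuous_on_product_coordinates])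
    show "(\<lambda>w. g ((x(i := w)) 0)) field_differentiable at (x i)" if "i < 1" for x :: "nat \<Rightarrow> complex" and i
      using that \<open>g holomorphic_on UNIV\<close> by (auto simp: holomorphic_on_def)
  qed
  obtain z where z: "h z \<noteq> 0" using assms(3) by blast
  show ?thesis
    unfolding meromorphic_in_def
  proof
    fix a :: "nat \<Rightarrow> complex" assume a: "a \<in> complex_space 1"
    \<comment> \<open>Large enough for the disc about \<open>a 0\<close> to contain a point where
      \<open>h\<close> is nonzero; with entire \<open>g\<close> and \<open>h\<close> any radius is
      allowed.\<close>
    define r where "r = norm (z - a 0) + 1"
    have "(\<lambda>i. if i = 0 then z else 0) \<in> polydisc 1 a r"
      by (auto simp: polydisc_def complex_space_def r_def)
    hence "\<exists>x\<in>polydisc 1 a r. h (x 0) \<noteq> 0" using z by (auto intro!: bexI[of _ "\<lambda>i. if i = 0 then z else 0"])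
    hence "quotient_on 1 (polydisc 1 a r) (\<lambda>x. f (x 0)) (\<lambda>x. g (x 0)) (\<lambda>x. h (x 0))"
      unfolding quotient_on_def
      using holomorphic_several_subset[OF hol[OF assms(1)] polydisc_subset_space]
        holomorphic_several_subset[OF hol[OF assms(2)] polydisc_subset_space] assms(4) by simp
    moreover have "0 < r" by (simp add: r_def add_nonneg_pos)
    ultimately show "\<exists>r>0. \<exists>g h. quotient_on 1 (polydisc 1 a r) (\<lambda>x. f (x 0)) g h" by blast
  qed
qed

section \<open>Infinite sums over finite sets\<close>

lemma summable_on_int_geometric:
  fixes r :: real
  assumes "0 \<le> r" "r < 1"
  shows "(\<lambda>k::int. r ^ nat \<bar>k\<bar>) summable_on UNIV"
proof -
  have s: "(\<lambda>n::nat. r ^ n) summable_on UNIV"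
    using assms by (intro norm_summable_imp_summable_on) (auto simp: norm_power intro!: summable_geometric)
  have "(\<lambda>k::int. r ^ nat \<bar>k\<bar>) summable_on {0..}"
    by (rule summable_on_reindex_bij_witness[of _ int nat UNIV "\<lambda>n. r ^ n", THEN iffD2]) (use s in auto)
  moreover have "(\<lambda>k::int. r ^ nat \<bar>k\<bar>) summable_on {..0}"
    by (rule summable_on_reindex_bij_witness[of _ "\<lambda>n. - int n" "\<lambda>k. nat (- k)" UNIV "\<lambda>n. r ^ n", THEN iffD2])
       (use s in auto)
  ultimately have "(\<lambda>k::int. r ^ nat \<bar>k\<bar>) summable_on {0..} \<union> {..0}"
    by (rule summable_on_union)
  moreover have "{0..} \<union> {..0} = (UNIV :: int set)" by auto
  ultimately show ?thesis by simp
qed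

text \<open>A finite family of sets lies in the power set of its union, so its partial sum is at
  most a finite product of factors \<open>a i + 1\<close>, hence at most \<open>exp\<close> of the
  sum of the \<open>a i\<close>.\<close>

lemma prod_summable_on_finite_sets:
  fixes a :: "'i \<Rightarrow> real"
  assumes a: "\<And>i. i \<in> I \<Longrightarrow> 0 \<le> a i" "a summable_on I"
  shows "(\<lambda>D. \<Prod>i\<in>D. a i) summable_on {D. finite D \<and> D \<subseteq> I}"
    and "infsum (\<lambda>D. \<Prod>i\<in>D. a i) {D. finite D \<and> D \<subseteq> I} \<le> exp (infsum a I)"
proof -
  have bound: "(\<Sum>D\<in>\<F>. \<Prod>i\<in>D. a i) \<le> exp (infsum a I)"
    if "\<F> \<subseteq> {D. finite D \<and> D \<subseteq> I}" "finite \<F>" for \<F>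
  proof -
    let ?U = "\<Union>\<F>"
    have U: "finite ?U" "?U \<subseteq> I" using that by auto
    have "(\<Sum>D\<in>\<F>. \<Prod>i\<in>D. a i) \<le> (\<Sum>D\<in>Pow ?U. \<Prod>i\<in>D. a i)"
      by (rule sum_mono2) (use U a(1) in \<open>auto intro!: prod_nonneg a(1) simp: subset_iff\<close>)
    also have "\<dots> = (\<Prod>i\<in>?U. a i + 1)"
      using prod_add[of ?U a "\<lambda>_. 1"] U(1) by simp
    also have "\<dots> \<le> (\<Prod>i\<in>?U. exp (a i))"
      by (rule prod_mono) (use U a(1) in \<open>auto simp: add.commute intro: add_nonneg_nonneg\<close>)
    also have "\<dots> = exp (\<Sum>i\<in>?U. a i)" using U(1) by (simp add: exp_sum)
    also have "(\<Sum>i\<in>?U. a i) \<le> infsum a I"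
      by (rule finite_sum_le_infsum) (use a U in auto)
    finally show ?thesis by simp
  qed
  have nn: "0 \<le> (\<Prod>i\<in>D. a i)" if "D \<in> {D. finite D \<and> D \<subseteq> I}" for D
    using that a(1) by (auto intro!: prod_nonneg)
  show s: "(\<lambda>D. \<Prod>i\<in>D. a i) summable_on {D. finite D \<and> D \<subseteq> I}"
    by (rule nonneg_bdd_above_summable_on) (use nn bound in \<open>auto intro!: bdd_aboveI2\<close>)
  show "infsum (\<lambda>D. \<Prod>i\<in>D. a i) {D. finite D \<and> D \<subseteq> I} \<le> exp (infsum a I)"
    by (rule infsum_le_finite_sums[OF s]) (use bound in auto)
qed

lemma infsum_finite_sets_insert:
  fixes a :: "'i \<Rightarrow> complex"
  assumes s: "(\<lambda>i. norm (a i)) summable_on insert j I" and j: "j \<notin> I"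
  shows "infsum (\<lambda>D. \<Prod>i\<in>D. a i) {D. finite D \<and> D \<subseteq> insert j I} =
    (1 + a j) * infsum (\<lambda>D. \<Prod>i\<in>D. a i) {D. finite D \<and> D \<subseteq> I}"
proof -
  let ?f = "\<lambda>D. \<Prod>i\<in>D. a i" and ?A = "{D. finite D \<and> D \<subseteq> I}"
  have bij: "bij_betw (insert j) ?A {D. finite D \<and> D \<subseteq> insert j I \<and> j \<in> D}"
    by (rule bij_betwI[where g = "\<lambda>D. D - {j}"]) (use j in auto)
  have eq: "?f (insert j D) = a j * ?f D" if "D \<in> ?A" for D
    using that j by (subst prod.insert) auto
  have "(\<lambda>D. norm (?f D)) summable_on {D. finite D \<and> D \<subseteq> insert j I}"
    using prod_summable_on_finite_sets(1)[OF _ s] by (simp add: prod_norm)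
  hence sA: "?f summable_on {D. finite D \<and> D \<subseteq> insert j I}" by (rule abs_summable_summable)
  have "{D. finite D \<and> D \<subseteq> insert j I} = ?A \<union> {D. finite D \<and> D \<subseteq> insert j I \<and> j \<in> D}"
    by auto
  hence "infsum ?f {D. finite D \<and> D \<subseteq> insert j I} =
      infsum ?f ?A + infsum ?f {D. finite D \<and> D \<subseteq> insert j I \<and> j \<in> D}"
    using j by (simp only:) (subst infsum_Un_disjoint, use sA in \<open>auto intro: summable_on_subset_banach\<close>)
  also have "infsum ?f {D. finite D \<and> D \<subseteq> insert j I \<and> j \<in> D} = infsum (\<lambda>D. ?f (insert j D)) ?A"
    by (rule infsum_reindex_bij_betw[OF bij, symmetric])
  also have "\<dots> = infsum (\<lambda>D. a j * ?f D) ?A" by (rule infsum_cong) (use eq in auto)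
  also have "\<dots> = a j * infsum ?f ?A" by (rule infsum_cmult_right')
  finally show ?thesis by (simp add: algebra_simps)
qed

text \<open>The sum is the expansion of the infinite product of the factors \<open>1 + a i\<close>.
  Finitely many nonzero factors are split off; the tail is so small that its expansion lies within
  distance 1 of 1.\<close>

lemma infsum_finite_sets_nonzero:
  fixes a :: "'i \<Rightarrow> complex"
  assumes s: "(\<lambda>i. norm (a i)) summable_on UNIV" and nz: "\<And>i. 1 + a i \<noteq> 0"
  shows "infsum (\<lambda>D. \<Prod>i\<in>D. a i) {D. finite D} \<noteq> 0"
proof -
  let ?f = "\<lambda>D. \<Prod>i\<in>D. a i" and ?E = "\<lambda>I. {D. finite D \<and> D \<subseteq> I}"
  have sI: "(\<lambda>i. norm (a i)) summable_on I" for I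
    using s by (rule summable_on_subset_banach) auto
  \<comment> \<open>A tail below \<open>ln 2\<close> keeps the expansion of the norms below 2, of
    which 1 belongs to the empty set.\<close>
  obtain J where J: "finite J" "norm (infsum (\<lambda>i. norm (a i)) UNIV - (\<Sum>i\<in>J. norm (a i))) < ln 2"
  proof -
    have "0 < ln 2 / (2 :: real)" by simp
    from infsum_finite_approximation[OF s this]
    obtain J where "finite J" "dist (\<Sum>i\<in>J. norm (a i)) (infsum (\<lambda>i. norm (a i)) UNIV) \<le> ln 2 / 2"
      by blast
    moreover have "ln 2 / 2 < (ln 2 :: real)" by simp
    ultimately show ?thesis using that[of J] unfolding dist_norm
      by (metis le_less_trans norm_minus_commute)
  qed
  have "infsum (\<lambda>i. norm (a i)) UNIV = infsum (\<lambda>i. norm (a i)) J + infsum (\<lambda>i. norm (a i)) (- J)"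
    using infsum_Un_disjoint[where A = J and B = "- J", OF sI sI] by (simp add: Compl_partition)
  hence tail: "infsum (\<lambda>i. norm (a i)) (- J) < ln 2" using J by simp
  have sn: "(\<lambda>D. norm (?f D)) summable_on ?E I" for I
    using prod_summable_on_finite_sets(1)[OF _ sI] by (simp add: prod_norm)
  have step: "infsum ?f (?E (K \<union> - J)) = (\<Prod>i\<in>K. 1 + a i) * infsum ?f (?E (- J))"
    if "finite K" "K \<subseteq> J" for K
    using that
  proof (induction K)
    case (insert k K)
    have "infsum ?f (?E (insert k (K \<union> - J))) = (1 + a k) * infsum ?f (?E (K \<union> - J))"
      by (rule infsum_finite_sets_insert) (use insert sI in auto)
    thus ?case using insert by (simp add: mult.assoc)
  qed simp
  have "norm (infsum ?f (?E (- J)) - 1) < 1"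
  proof -
    have un: "?E (- J) = {{}} \<union> (?E (- J) - {{}})" by auto
    have sf: "?f summable_on (?E (- J))" using sn by (rule abs_summable_summable)
    have "infsum ?f (?E (- J)) = 1 + infsum ?f (?E (- J) - {{}})"
      by (subst un, subst infsum_Un_disjoint) (use sf in \<open>auto intro: summable_on_subset_banach\<close>)
    moreover have "infsum (\<lambda>D. norm (?f D)) (?E (- J)) = 1 + infsum (\<lambda>D. norm (?f D)) (?E (- J) - {{}})"
      by (subst un, subst infsum_Un_disjoint) (use sn in \<open>auto intro: summable_on_subset_banach\<close>)
    moreover have "norm (infsum ?f (?E (- J) - {{}})) \<le> infsum (\<lambda>D. norm (?f D)) (?E (- J) - {{}})"
      by (rule norm_infsum_bound, rule summable_on_subset_banach[OF sn]) auto
    moreover have "infsum (\<lambda>D. norm (?f D)) (?E (- J)) \<le> exp (infsum (\<lambda>i. norm (a i)) (- J))"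
      using prod_summable_on_finite_sets(2)[where I = "- J", OF _ sI] by (simp add: prod_norm)
    moreover have "exp (infsum (\<lambda>i. norm (a i)) (- J)) < 2"
      using tail by (metis exp_less_mono exp_ln zero_less_numeral)
    ultimately show ?thesis by simp
  qed
  hence "infsum ?f (?E (- J)) \<noteq> 0" by auto
  moreover have "(\<Prod>i\<in>J. 1 + a i) \<noteq> 0" using nz J(1) by auto
  moreover have "?E (J \<union> - J) = {D. finite D}" by auto
  ultimately show ?thesis using step[OF J(1) order_refl] by (metis (no_types, lifting) mult_eq_0_iff)
qed

section \<open>Charged partitions and Maya diagrams\<close>

text \<open>
  A Maya diagram is a set of integers (occupied sites) that differs from the vacuum \<open>{..0}\<close> by a
  finite set; it is encoded by that finite set. A partition of charge \<open>c\<close> corresponds to the diagram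
  with sites \<open>\<lambda> i - i + c\<close>.
\<close>

definition occ :: "int set \<Rightarrow> int set" where
  "occ D = {k. (k \<le> 0) \<noteq> (k \<in> D)}"

definition sites :: "int \<Rightarrow> (nat \<Rightarrow> nat) \<Rightarrow> nat \<Rightarrow> int" where
  "sites c lam i = int (lam i) - int i + c"

text \<open>Symmetric difference with the vacuum is an involution, so \<open>occ\<close>, which
  decodes a finite set, here encodes the diagram.\<close>

definition maya :: "int \<times> (nat \<Rightarrow> nat) \<Rightarrow> int set" where
  "maya = (\<lambda>(c, lam). occ (range (sites c lam)))"

lemma occ_occ [simp]: "occ (occ D) = D"
  by (auto simp: occ_def)

lemma occ_maya: "occ (maya (c, lam)) = range (sites c lam)"
  by (simp add: maya_def)

lemma sites_strict:
  assumes "antimono lam" "i < j"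
  shows "sites c lam j < sites c lam i"
  using antimonoD[OF assms(1), of i j] assms(2) by (simp add: sites_def)

lemma sites_less_iff:
  assumes "antimono lam"
  shows "sites c lam j < sites c lam i \<longleftrightarrow> i < j"
  using sites_strict[OF assms, of i j c] sites_strict[OF assms, of j i c]
  by (metis less_asym linorder_neqE_nat less_irrefl)

lemma inj_sites: "antimono lam \<Longrightarrow> inj (sites c lam)"
  by (metis injI less_irrefl linorder_neqE_nat sites_strict)

lemma partition_bound:
  assumes "lam \<in> partitions"
  obtains n where "\<And>i. n \<le> i \<Longrightarrow> lam i = 0"
proof -
  have "finite {i. lam i \<noteq> 0}" using assms by (auto simp: partitions_def)
  then obtain n where "\<forall>i\<in>{i. lam i \<noteq> 0}. i < n" using finite_nat_set_iff_bounded by blast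
  thus ?thesis using that by (metis (mono_tags, lifting) leD mem_Collect_eq)
qed

lemma maya_finite:
  assumes "lam \<in> partitions"
  shows "finite (maya (c, lam))"
proof -
  obtain n where n: "\<And>i. n \<le> i \<Longrightarrow> lam i = 0" using partition_bound[OF assms] by blast
  have am: "antimono lam" using assms by (auto simp: partitions_def)
  have "maya (c, lam) \<subseteq> {min 0 (c - int n)..max 0 (sites c lam 0)}"
  proof
    fix k assume k: "k \<in> maya (c, lam)"
    show "k \<in> {min 0 (c - int n)..max 0 (sites c lam 0)}"
    proof (cases "k \<le> 0")
      case True
      hence "k \<notin> range (sites c lam)" using k by (auto simp: maya_def occ_def)
      moreover have "k \<in> range (sites c lam)" if "k < c - int n"
      proof
        show "k = sites c lam (nat (c - k))"
          using that n[of "nat (c - k)"] by (simp add: sites_def)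
      qed simp
      ultimately show ?thesis using True by fastforce
    next
      case False
      then obtain i where "k = sites c lam i" using k by (auto simp: maya_def occ_def)
      hence "k \<le> sites c lam 0" using sites_strict[OF am, of 0 i c] by (cases "i = 0") auto
      thus ?thesis using False by auto
    qed
  qed
  thus ?thesis by (rule finite_subset) simp
qed

text \<open>The position \<open>i\<close> is the number of occupied sites above
  \<open>sites c lam i\<close>, so the set of occupied sites determines its own enumeration.\<close>

lemma sites_determined:
  assumes "antimono lam" "antimono lam'" "range (sites c lam) = range (sites c' lam')"
  shows "sites c lam i = sites c' lam' i"
proof -
  have card: "card {k \<in> range (sites c lam). sites c lam i < k} = i" if "antimono lam" for lam c i
  proof -
    have "{k \<in> range (sites c lam). sites c lam i < k} = sites c lam ` {..<i}"
      using sites_less_iff[OF that] by auto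
    thus ?thesis using card_image[OF inj_on_subset[OF inj_sites[OF that, of c], of "{..<i}"]] by simp
  qed
  obtain j where j: "sites c lam i = sites c' lam' j" using assms(3) by blast
  have "i = j" using card[OF assms(1), of c i] card[OF assms(2), of c' j] j assms(3) by simp
  thus ?thesis using j by simp
qed

lemma inj_on_maya: "inj_on maya (UNIV \<times> partitions)"
proof (rule inj_onI, clarify)
  fix c c' lam lam' assume lam: "lam \<in> partitions" "lam' \<in> partitions" and eq: "maya (c, lam) = maya (c', lam')"
  have am: "antimono lam" "antimono lam'" using lam by (auto simp: partitions_def)
  have "range (sites c lam) = range (sites c' lam')" using eq occ_maya by metis
  hence s: "sites c lam i = sites c' lam' i" for i using sites_determined am by blast
  obtain n n' where n: "\<And>i. n \<le> i \<Longrightarrow> lam i = 0" "\<And>i. n' \<le> i \<Longrightarrow> lam' i = 0"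
    using partition_bound lam by metis
  \<comment> \<open>Beyond both partitions the sites are \<open>c - i\<close> and
    \<open>c' - i\<close>.\<close>
  have "c = c'" using s[of "max n n'"] n by (simp add: sites_def)
  moreover have "lam = lam'" using s \<open>c = c'\<close> by (auto simp: sites_def)
  ultimately show "c = c' \<and> lam = lam'" by simp
qed

text \<open>The occupied sites are enumerated downwards from the bound \<open>M\<close>. The site at
  position \<open>i\<close> plus \<open>i\<close> decreases weakly and becomes constant once all
  sites are occupied; the limit is the charge and the excess over it is the partition.\<close>

lemma maya_onto:
  assumes D: "finite D"
  obtains c lam where "lam \<in> partitions" "maya (c, lam) = D"
proof -
  obtain m where m: "\<And>k. k \<in> D \<Longrightarrow> \<bar>k\<bar> \<le> int m"
  proof -
    have "finite ((\<lambda>k. nat \<bar>k\<bar>) ` D)" using D by simp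
    then obtain m where "\<forall>k\<in>(\<lambda>k. nat \<bar>k\<bar>) ` D. k \<le> m" using finite_nat_set_iff_bounded_le by blast
    thus ?thesis by (intro that[of m]) force
  qed
  define M where "M = int m"
  define N where "N = {n. M - int n \<in> occ D}"
  have SM: "k \<le> M" if "k \<in> occ D" for k using that m[of k] by (auto simp: occ_def M_def)
  have NM: "n \<in> N" if "2 * m < n" for n
    using that m[of "M - int n"] by (auto simp: N_def occ_def M_def)
  have inf: "infinite N"
  proof
    assume "finite N"
    then obtain b where "\<forall>n\<in>N. n < b" using finite_nat_set_iff_bounded by blast
    thus False using NM[of "max b (2 * m + 1)"] by fastforce
  qed
  define e where "e = enumerate N"
  have e_less: "e i < e (Suc i)" for i unfolding e_def using inf by (rule enumerate_step)
  \<comment> \<open>Past \<open>2 * m\<close> the set \<open>N\<close> has no gaps, as all sites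
    below \<open>- m\<close> are occupied.\<close>
  have e_Suc: "e (Suc i) = Suc (e i)" if "2 * m < i" for i
  proof -
    have "i \<le> e i" unfolding e_def using inf by (rule le_enumerate)
    hence "Suc (e i) \<in> N" using that by (intro NM) simp
    moreover have "e (Suc i) = (LEAST s. s \<in> N \<and> e i < s)"
      unfolding e_def using inf by (rule enumerate_Suc'')
    ultimately have "e (Suc i) \<le> Suc (e i)" by (simp add: Least_le)
    thus ?thesis using e_less[of i] by simp
  qed
  define f where "f = (\<lambda>i. M - int (e i) + int i)"
  have f_dec: "f (Suc i) \<le> f i" for i using e_less[of i] by (simp add: f_def)
  have f_anti: "f j \<le> f i" if "i \<le> j" for i j using that f_dec by (metis lift_Suc_antimono_le)
  define c where "c = f (2 * m + 1)"
  have f_const: "f i = c" if "2 * m < i" for i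
    using that
  proof (induction i)
    case (Suc i)
    show ?case
    proof (cases "2 * m < i")
      case True
      thus ?thesis using Suc e_Suc[of i] by (simp add: f_def)
    next
      case False
      hence "i = 2 * m" using Suc by simp
      thus ?thesis by (simp add: c_def)
    qed
  qed simp
  have f_ge: "c \<le> f i" for i using f_anti[of i "max i (2 * m + 1)"] f_const[of "max i (2 * m + 1)"] by simp
  define lam where "lam = (\<lambda>i. nat (f i - c))"
  have "lam \<in> partitions"
    unfolding partitions_def
  proof (intro CollectI conjI)
    show "antimono lam" unfolding lam_def antimono_def using f_anti by (auto intro: nat_mono)
    have "{i. lam i \<noteq> 0} \<subseteq> {..2 * m}"
      using f_const by (fastforce simp: lam_def not_le[symmetric])
    thus "finite {i. lam i \<noteq> 0}" by (rule finite_subset) simp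
  qed
  moreover have "range (sites c lam) = occ D"
  proof -
    have s: "sites c lam i = M - int (e i)" for i
      using f_ge[of i] by (simp add: sites_def lam_def f_def)
    have "range e = N" unfolding e_def using inf by (rule range_enumerate)
    hence "range (sites c lam) = (\<lambda>n. M - int n) ` N" using s by (auto simp: image_iff)
    also have "\<dots> = occ D"
    proof
      show "occ D \<subseteq> (\<lambda>n. M - int n) ` N"
      proof
        fix k assume "k \<in> occ D"
        thus "k \<in> (\<lambda>n. M - int n) ` N"
          using SM[of k] by (intro image_eqI[of _ _ "nat (M - k)"]) (auto simp: N_def)
      qed
    qed (auto simp: N_def)
    finally show ?thesis .
  qed
  ultimately show ?thesis using that[of lam c] by (simp add: maya_def)
qed

lemma bij_betw_maya: "bij_betw maya (UNIV \<times> partitions) {D. finite D}"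
  unfolding bij_betw_def
proof
  show "maya ` (UNIV \<times> partitions) = {D. finite D}"
  proof
    show "{D. finite D} \<subseteq> maya ` (UNIV \<times> partitions)"
    proof
      fix D :: "int set" assume "D \<in> {D. finite D}"
      then obtain c lam where "lam \<in> partitions" "maya (c, lam) = D" using maya_onto[of D] by blast
      thus "D \<in> maya ` (UNIV \<times> partitions)" by force
    qed
  qed (auto simp: maya_finite)
qed (rule inj_on_maya)

text \<open>The variable \<open>w\<close> is the logarithm of the fugacity of the charge.\<close>

definition site_weight :: "complex \<Rightarrow> complex \<Rightarrow> int \<Rightarrow> complex" where
  "site_weight q w k = - (exp w * q powi k)"

text \<open>Relative to the vacuum, filling a site above 0 multiplies by the site weight and
  emptying one of the others divides by it. Either way a flip at \<open>k\<close> costs the power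
  \<open>nat \<bar>k\<bar>\<close> of \<open>q\<close>.\<close>

definition flip_weight :: "complex \<Rightarrow> complex \<Rightarrow> int \<Rightarrow> complex" where
  "flip_weight q w k = (if 0 < k then site_weight q w k else inverse (site_weight q w k))"

definition weight :: "complex \<Rightarrow> complex \<Rightarrow> int set \<Rightarrow> complex" where
  "weight q w D = (\<Prod>k\<in>D. flip_weight q w k)"

text \<open>Energy, relative to the vacuum, of the empty partition in charge
  \<open>c\<close>.\<close>

definition tri :: "int \<Rightarrow> int" where
  "tri c = c * (c + 1) div 2"

section \<open>The weight of a charged partition\<close>

lemma two_tri: "2 * tri c = c * (c + 1)"
  unfolding tri_def by (simp add: algebra_simps)

lemma site_weight_nonzero: "q \<noteq> 0 \<Longrightarrow> site_weight q w k \<noteq> 0"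
  by (simp add: site_weight_def)

lemma prod_site_weight:
  assumes "q \<noteq> 0" "finite A"
  shows "(\<Prod>k\<in>A. site_weight q w (f k)) = (- exp w) ^ card A * q powi (\<Sum>k\<in>A. f k)"
  using assms(2)
proof (induction A rule: finite_induct)
  case (insert a A)
  thus ?case using assms(1) by (simp add: site_weight_def power_int_add)
qed simp

lemma psize_eq_sum:
  assumes "lam \<in> partitions" "\<And>i. n \<le> i \<Longrightarrow> lam i = 0"
  shows "psize lam = (\<Sum>i<n. lam i)"
  unfolding psize_def
proof (rule sum.mono_neutral_left)
  show "{i. lam i \<noteq> 0} \<subseteq> {..<n}"
  proof
    fix i assume "i \<in> {i. lam i \<noteq> 0}"
    thus "i \<in> {..<n}" using assms(2)[of i] by (cases "n \<le> i") auto
  qed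
qed auto

text \<open>The weight sees only the change of the number of particles and of the sum of their
  sites. Both are found by cutting off at \<open>- M\<close>, below which diagram and vacuum agree:
  above it the diagram has \<open>L = M + c\<close> sites, the vacuum \<open>M\<close>.\<close>

lemma weight_maya:
  assumes q: "q \<noteq> 0" and lam: "lam \<in> partitions"
  shows "weight q w (maya (c, lam)) = (- exp w) powi c * q powi tri c * q ^ psize lam"
proof -
  obtain n where n: "\<And>i. n \<le> i \<Longrightarrow> lam i = 0" using partition_bound[OF lam] by blast
  define D where "D = maya (c, lam)"
  have D: "finite D" unfolding D_def by (rule maya_finite[OF lam])
  have am: "antimono lam" using lam by (auto simp: partitions_def)
  obtain m where m: "\<And>k. k \<in> D \<Longrightarrow> \<bar>k\<bar> < int m"
  proof -
    have "finite ((\<lambda>k. nat \<bar>k\<bar>) ` D)" using D by simp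
    then obtain m where "\<forall>k\<in>(\<lambda>k. nat \<bar>k\<bar>) ` D. k < m" using finite_nat_set_iff_bounded by blast
    thus ?thesis by (intro that[of m]) force
  qed
  \<comment> \<open>Large enough for the cutoff to lie below all of \<open>D\<close> and for
    \<open>L\<close> to reach past the last nonzero part.\<close>
  define M where "M = m + n + nat \<bar>c\<bar>"
  define L where "L = nat (int M + c)"
  have L: "int L = int M + c" "n \<le> L" by (auto simp: L_def M_def)
  let ?t = "site_weight q w" and ?V = "{- int M<..0}"
  have t0: "?t k \<noteq> 0" for k using q by (rule site_weight_nonzero)
  have occV: "occ D \<inter> {- int M<..} = {k\<in>D. 0 < k} \<union> (?V - D)"
    using m by (auto simp: occ_def M_def)
  have occL: "occ D \<inter> {- int M<..} = sites c lam ` {..<L}"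
  proof -
    have "sites c lam i > - int M \<longleftrightarrow> i < L" for i
      using L n[of i] by (cases "i < L") (auto simp: sites_def)
    thus ?thesis unfolding D_def occ_maya by auto
  qed
  have finP: "finite {k\<in>D. 0 < k}" using D by simp
  have "(\<Prod>k\<in>sites c lam ` {..<L}. ?t k) = (\<Prod>k\<in>{k\<in>D. 0 < k}. ?t k) * (\<Prod>k\<in>?V - D. ?t k)"
    unfolding occL[symmetric] occV by (rule prod.union_disjoint) (use finP in auto)
  moreover have "(\<Prod>k\<in>?V. ?t k) = (\<Prod>k\<in>?V - D. ?t k) * (\<Prod>k\<in>{k\<in>D. k \<le> 0}. ?t k)"
  proof -
    have "?V \<inter> D = {k\<in>D. k \<le> 0}" using m by (fastforce simp: M_def)
    thus ?thesis using prod.Int_Diff[of ?V ?t D] by (simp add: mult.commute)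
  qed
  moreover have "weight q w D = (\<Prod>k\<in>{k\<in>D. 0 < k}. ?t k) * inverse (\<Prod>k\<in>{k\<in>D. k \<le> 0}. ?t k)"
  proof -
    have "weight q w D = (\<Prod>k\<in>{k\<in>D. 0 < k} \<union> {k\<in>D. k \<le> 0}. flip_weight q w k)"
      unfolding weight_def by (rule prod.cong) auto
    also have "\<dots> = (\<Prod>k\<in>{k\<in>D. 0 < k}. flip_weight q w k) * (\<Prod>k\<in>{k\<in>D. k \<le> 0}. flip_weight q w k)"
      by (rule prod.union_disjoint) (use D in auto)
    also have "(\<Prod>k\<in>{k\<in>D. 0 < k}. flip_weight q w k) = (\<Prod>k\<in>{k\<in>D. 0 < k}. ?t k)"
      by (rule prod.cong) (auto simp: flip_weight_def)
    also have "(\<Prod>k\<in>{k\<in>D. k \<le> 0}. flip_weight q w k) = (\<Prod>k\<in>{k\<in>D. k \<le> 0}. inverse (?t k))"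
      by (rule prod.cong) (auto simp: flip_weight_def)
    finally show ?thesis by (simp only: prod_inversef[symmetric] o_def)
  qed
  ultimately have "weight q w D * (\<Prod>k\<in>?V. ?t k) = (\<Prod>k\<in>sites c lam ` {..<L}. ?t k)"
    using t0 D by (simp add: field_simps)
  moreover have "(\<Prod>k\<in>sites c lam ` {..<L}. ?t k) = (- exp w) ^ L * q powi (\<Sum>i<L. sites c lam i)"
    using prod_site_weight[OF q, of "{..<L}" w "sites c lam"]
      prod.reindex[OF inj_on_subset[OF inj_sites[OF am, of c], of "{..<L}"], of ?t] by simp
  moreover have "(\<Prod>k\<in>?V. ?t k) = (- exp w) ^ M * q powi (\<Sum>i<M. - int i)"
  proof -
    have V: "?V = (\<lambda>i. - int i) ` {..<M}"
    proof
      show "?V \<subseteq> (\<lambda>i. - int i) ` {..<M}"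
      proof
        fix k assume "k \<in> ?V"
        thus "k \<in> (\<lambda>i. - int i) ` {..<M}" by (intro image_eqI[of _ _ "nat (- k)"]) auto
      qed
    qed auto
    have "inj_on (\<lambda>i. - int i) {..<M}" by (auto simp: inj_on_def)
    thus ?thesis using prod_site_weight[OF q, of "{..<M}" w "\<lambda>i. - int i"]
      unfolding V by (simp add: prod.reindex o_def)
  qed
  ultimately have eq: "weight q w D * ((- exp w) ^ M * q powi (\<Sum>i<M. - int i)) =
      (- exp w) ^ L * q powi (\<Sum>i<L. sites c lam i)" by simp
  have gauss: "2 * (\<Sum>i<N. int i) = int N * (int N - 1)" for N
    by (induction N) (auto simp: algebra_simps)
  have "(\<Sum>i<L. sites c lam i) = int (psize lam) - (\<Sum>i<L. int i) + int L * c"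
    using psize_eq_sum[OF lam, of L] n L(2) by (simp add: sites_def sum.distrib sum_subtractf)
  hence "2 * (\<Sum>i<L. sites c lam i) = 2 * (tri c + int (psize lam) + (\<Sum>i<M. - int i))"
    using gauss[of L] gauss[of M] two_tri[of c] L(1) by (simp add: sum_negf algebra_simps)
  hence e: "(\<Sum>i<L. sites c lam i) = tri c + int (psize lam) + (\<Sum>i<M. - int i)" by simp
  have "(- exp w) ^ L = (- exp w) powi (int M + c)" using L(1) by (metis power_int_of_nat)
  hence "(- exp w) ^ L = (- exp w) ^ M * (- exp w) powi c" by (simp add: power_int_add)
  hence "weight q w D * ((- exp w) ^ M * q powi (\<Sum>i<M. - int i)) =
     ((- exp w) powi c * q powi tri c * q ^ psize lam) * ((- exp w) ^ M * q powi (\<Sum>i<M. - int i))"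
    unfolding eq e using q by (simp add: power_int_add algebra_simps)
  moreover have "(- exp w) ^ M * q powi (\<Sum>i<M. - int i) \<noteq> 0" using q by simp
  ultimately show ?thesis unfolding D_def[symmetric] using mult_right_cancel by blast
qed

section \<open>Convergence of the sum over all diagrams\<close>

lemma norm_site_weight: "norm (site_weight q w k) = exp (Re w) * norm q powi k"
  by (simp add: site_weight_def norm_mult norm_power_int)

lemma flip_weight_summable:
  assumes "0 < norm q" "norm q < 1"
  shows "(\<lambda>k. norm (flip_weight q w k)) summable_on UNIV"
proof (rule summable_on_comparison_test)
  let ?C = "exp (Re w) + exp (- Re w)"
  show "(\<lambda>k. ?C * norm q ^ nat \<bar>k\<bar>) summable_on UNIV"
    by (intro summable_on_cmult_right summable_on_int_geometric) (use assms in auto)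
  fix k :: int
  have "norm (flip_weight q w k) \<le> (if 0 < k then exp (Re w) else exp (- Re w)) * norm q ^ nat \<bar>k\<bar>"
    by (auto simp: flip_weight_def norm_inverse norm_site_weight power_int_def exp_minus power_inverse)
  also have "\<dots> \<le> ?C * norm q ^ nat \<bar>k\<bar>" by (intro mult_right_mono) auto
  finally show "norm (flip_weight q w k) \<le> ?C * norm q ^ nat \<bar>k\<bar>" .
qed auto

lemma weight_summable:
  assumes "0 < norm q" "norm q < 1"
  shows "(\<lambda>D. norm (weight q w D)) summable_on {D. finite D}"
  using prod_summable_on_finite_sets(1)[OF _ flip_weight_summable[OF assms, of w]]
  by (simp add: weight_def prod_norm)

lemma norm_weight_maya:
  assumes "q \<noteq> 0" "lam \<in> partitions"
  shows "norm (weight q w (maya (c, lam))) = exp (Re w) powi c * norm q powi tri c * norm q ^ psize lam"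
  using assms by (simp add: weight_maya norm_mult norm_power norm_power_int)

lemma charged_weight_summable:
  assumes "0 < norm q" "norm q < 1"
  shows "(\<lambda>(c, lam). norm (weight q w (maya (c, lam)))) summable_on (UNIV \<times> partitions)"
  using summable_on_reindex_bij_betw[OF bij_betw_maya, of "\<lambda>D. norm (weight q w D)"]
    weight_summable[OF assms, of w] by (simp add: case_prod_unfold)

definition empty_partition :: "nat \<Rightarrow> nat" where "empty_partition = (\<lambda>_. 0)"

lemma empty_partition: "empty_partition \<in> partitions" "psize empty_partition = 0"
  by (auto simp: empty_partition_def partitions_def psize_def antimono_def)

text \<open>Convergence of the theta series is read off from that of the sum over all diagrams by
  keeping only empty partitions.\<close>

lemma charge_summable:
  fixes r :: real
  assumes "0 < r" "r < 1"
  shows "(\<lambda>c. exp u powi c * r powi tri c) summable_on UNIV"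
proof -
  let ?q = "complex_of_real r" and ?w = "complex_of_real u"
  have "(\<lambda>(c, lam). norm (weight ?q ?w (maya (c, lam)))) summable_on ((\<lambda>c. (c, empty_partition)) ` UNIV)"
    by (rule summable_on_subset_banach[OF charged_weight_summable]) (use assms empty_partition in auto)
  hence "(\<lambda>c. norm (weight ?q ?w (maya (c, empty_partition)))) summable_on UNIV"
    by (subst (asm) summable_on_reindex) (auto simp: inj_on_def o_def)
  thus ?thesis using assms empty_partition by (simp add: norm_weight_maya)
qed

text \<open>The same sum over diagrams, now restricted to charge 0.\<close>

lemma psize_summable:
  fixes r :: real
  assumes "0 < r" "r < 1"
  shows "(\<lambda>lam. r ^ psize lam) summable_on partitions"
proof -
  let ?q = "complex_of_real r"
  have "(\<lambda>(c, lam). norm (weight ?q 0 (maya (c, lam)))) summable_on (Pair 0 ` partitions)"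
    by (rule summable_on_subset_banach[OF charged_weight_summable]) (use assms in auto)
  hence "(\<lambda>lam. norm (weight ?q 0 (maya (0, lam)))) summable_on partitions"
    by (subst (asm) summable_on_reindex) (auto simp: inj_on_def o_def)
  moreover have "norm (weight ?q 0 (maya (0, lam))) = r ^ psize lam" if "lam \<in> partitions" for lam
    using that assms by (simp add: norm_weight_maya tri_def)
  ultimately show ?thesis by (simp cong: summable_on_cong)
qed

lemma summable_on_product:
  fixes f :: "'a \<Rightarrow> real" and g :: "'b \<Rightarrow> real"
  assumes "f summable_on A" "g summable_on B" "\<And>x. x \<in> A \<Longrightarrow> 0 \<le> f x" "\<And>y. y \<in> B \<Longrightarrow> 0 \<le> g y"
  shows "(\<lambda>(x, y). f x * g y) summable_on (A \<times> B)"
proof (rule summable_on_SigmaI)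
  show "((\<lambda>y. (\<lambda>(x, y). f x * g y) (x, y)) has_sum (f x * infsum g B)) B" for x
    using has_sum_cmult_right[OF has_sum_infsum[OF assms(2)], of "f x"] by simp
  show "(\<lambda>x. f x * infsum g B) summable_on A" using assms(1) by (rule summable_on_cmult_left)
qed (use assms in auto)

lemma infsum_product:
  fixes f :: "'a \<Rightarrow> complex" and g :: "'b \<Rightarrow> complex"
  assumes "f summable_on A" "g summable_on B"
  shows "infsum (\<lambda>(x, y). f x * g y) (A \<times> B) = infsum f A * infsum g B"
proof -
  have "(\<lambda>z. norm ((\<lambda>(x, y). f x * g y) z)) summable_on (A \<times> B)"
    using summable_on_product[of "\<lambda>x. norm (f x)" A "\<lambda>y. norm (g y)" B] assms
    by (simp add: summable_on_iff_abs_summable_on_complex case_prod_unfold norm_mult)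
  hence "(\<lambda>(x, y). f x * g y) summable_on (A \<times> B)" by (rule abs_summable_summable)
  from infsum_Sigma_banach[OF this] show ?thesis
    by (simp add: infsum_cmult_right' infsum_cmult_left')
qed

section \<open>Site sums\<close>

definition site_sum :: "complex \<Rightarrow> int set \<Rightarrow> complex" where
  "site_sum x D = (\<Sum>\<^sub>\<infinity>k\<in>occ D. exp (of_int k * x))"

text \<open>The site sum in charge 0. Its exponents are integers, whereas \<open>Q\<close> uses the
  half-integers \<open>lam i - i - 1/2\<close>; the factor \<open>exp (- (x / 2))\<close> in the
  lemma \<open>Qser\<close> makes up for the difference.\<close>

definition part_sum :: "complex \<Rightarrow> (nat \<Rightarrow> nat) \<Rightarrow> complex" where
  "part_sum x lam = (\<Sum>\<^sub>\<infinity>i. exp (of_int (int (lam i) - int i) * x))"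

lemma exp_summable_occ:
  assumes "0 < Re x" "finite D"
  shows "(\<lambda>k. norm (exp (of_int k * x))) summable_on occ D"
proof -
  have geo: "(\<lambda>n::nat. exp (- Re x) ^ n) summable_on UNIV"
    using assms by (intro norm_summable_imp_summable_on) (auto simp: norm_power intro!: summable_geometric)
  have "(\<lambda>k. norm (exp (of_int k * x))) summable_on {..0}"
    by (rule summable_on_reindex_bij_witness[of _ "\<lambda>n. - int n" "\<lambda>k. nat (- k)" UNIV
        "\<lambda>n. exp (- Re x) ^ n", THEN iffD2])
       (use geo in \<open>auto simp: exp_of_nat_mult[symmetric]\<close>)
  hence "(\<lambda>k. norm (exp (of_int k * x))) summable_on ({..0} \<union> D)"
    by (rule summable_on_union) (use assms in auto)
  thus ?thesis by (rule summable_on_subset_banach) (auto simp: occ_def)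
qed

lemma site_sum_maya:
  assumes "lam \<in> partitions"
  shows "site_sum x (maya (c, lam)) = exp (of_int c * x) * part_sum x lam"
proof -
  have "inj (sites c lam)" using assms by (auto simp: partitions_def intro: inj_sites)
  hence "site_sum x (maya (c, lam)) = (\<Sum>\<^sub>\<infinity>i. exp (of_int (sites c lam i) * x))"
    unfolding site_sum_def occ_maya by (simp add: infsum_reindex o_def)
  also have "\<dots> = (\<Sum>\<^sub>\<infinity>i. exp (of_int c * x) * exp (of_int (int (lam i) - int i) * x))"
    by (rule infsum_cong) (simp add: sites_def exp_add[symmetric] algebra_simps)
  finally show ?thesis by (simp add: part_sum_def infsum_cmult_right')
qed

lemma site_sum_norm_le:
  assumes "0 < Re x" "finite D"
  shows "norm (site_sum x D) \<le> (\<Sum>\<^sub>\<infinity>k\<in>occ D. exp (real_of_int k * Re x))"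
    and "0 \<le> (\<Sum>\<^sub>\<infinity>k\<in>occ D. exp (real_of_int k * Re x))"
proof -
  have "norm (site_sum x D) \<le> (\<Sum>\<^sub>\<infinity>k\<in>occ D. norm (exp (of_int k * x)))"
    unfolding site_sum_def by (rule norm_infsum_bound[OF exp_summable_occ[OF assms]])
  thus "norm (site_sum x D) \<le> (\<Sum>\<^sub>\<infinity>k\<in>occ D. exp (real_of_int k * Re x))" by simp
qed (simp add: infsum_nonneg)

lemma psize_ge_part:
  assumes "lam \<in> partitions"
  shows "lam i \<le> psize lam"
proof -
  have "finite {i. lam i \<noteq> 0}" using assms by (simp add: partitions_def)
  thus ?thesis unfolding psize_def by (cases "lam i = 0") (auto intro: member_le_sum)
qed

text \<open>The crude bound \<open>lam i \<le> psize lam\<close> leaves a geometric series in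
  \<open>i\<close>. It costs a factor \<open>exp e\<close> per box, which \<open>q\<close> has to
  compensate; this is the origin of the last condition in \<open>admissible\<close>.\<close>

lemma site_norm_sum_maya:
  fixes e :: real
  assumes "lam \<in> partitions" "0 < e"
  shows "(\<Sum>\<^sub>\<infinity>k\<in>occ (maya (c, lam)). exp (real_of_int k * e))
    \<le> 1 / (1 - exp (- e)) * (exp e powi c * exp e ^ psize lam)"
proof -
  have inj: "inj (sites c lam)" using assms by (auto simp: partitions_def intro: inj_sites)
  have s: "(\<lambda>k. exp (real_of_int k * e)) summable_on occ (maya (c, lam))"
    using exp_summable_occ[of "complex_of_real e" "maya (c, lam)"] assms maya_finite by simp
  have g: "((\<lambda>n::nat. exp (- e) ^ n) has_sum (1 / (1 - exp (- e)))) UNIV"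
    using geometric_sums[of "exp (- e)"] assms(2) by (intro norm_summable_imp_has_sum) (auto simp: norm_power)
  have "(\<Sum>\<^sub>\<infinity>k\<in>occ (maya (c, lam)). exp (real_of_int k * e)) = (\<Sum>\<^sub>\<infinity>i. exp (real_of_int (sites c lam i) * e))"
    unfolding occ_maya using inj by (simp add: infsum_reindex o_def)
  also have "\<dots> \<le> (\<Sum>\<^sub>\<infinity>i. exp (- e) ^ i * (exp e powi c * exp e ^ psize lam))"
  proof (rule infsum_mono)
    show "(\<lambda>i. exp (real_of_int (sites c lam i) * e)) summable_on UNIV"
      using s inj unfolding occ_maya by (simp add: summable_on_reindex o_def)
    show "(\<lambda>i. exp (- e) ^ i * (exp e powi c * exp e ^ psize lam)) summable_on UNIV"
      using g by (intro summable_on_cmult_left) (auto simp: summable_on_def)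
    fix i
    have "real_of_int (sites c lam i) * e \<le> real i * (- e) + (real_of_int c * e + real (psize lam) * e)"
      using psize_ge_part[OF assms(1), of i] assms(2) by (simp add: sites_def algebra_simps)
    hence "exp (real_of_int (sites c lam i) * e) \<le> exp (real i * (- e)) * (exp (real_of_int c * e) * exp (real (psize lam) * e))"
      by (simp add: exp_add[symmetric])
    thus "exp (real_of_int (sites c lam i) * e) \<le> exp (- e) ^ i * (exp e powi c * exp e ^ psize lam)"
      by (simp only: exp_of_nat_mult exp_power_int)
  qed
  also have "\<dots> = 1 / (1 - exp (- e)) * (exp e powi c * exp e ^ psize lam)"
    using has_sum_cmult_left[OF g] by (rule infsumI)
  finally show ?thesis .
qed

text \<open>In the majorant the variables shift the logarithm of the fugacity by their total
  \<open>?E\<close> and replace \<open>norm q\<close> by \<open>norm q * exp ?E\<close> for the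
  boxes, so it is a product of a theta series and a partition series.\<close>

lemma weighted_site_sums_summable:
  assumes q: "0 < norm q" and N: "finite N" "\<And>i. i \<in> N \<Longrightarrow> 0 < e i" "norm q * exp (\<Sum>i\<in>N. e i) < 1"
  shows "(\<lambda>D. norm (weight q w D) * (\<Prod>i\<in>N. \<Sum>\<^sub>\<infinity>k\<in>occ D. exp (real_of_int k * e i)))
    summable_on {D. finite D}"
proof -
  let ?E = "\<Sum>i\<in>N. e i"
  define C where "C = (\<Prod>i\<in>N. 1 / (1 - exp (- e i)))"
  have E0: "0 \<le> ?E" using N(2) by (auto intro: sum_nonneg less_imp_le)
  have q1: "norm q < 1"
  proof -
    have "norm q * 1 \<le> norm q * exp ?E" using E0 by (intro mult_left_mono) auto
    thus ?thesis using N(3) by simp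
  qed
  let ?f = "\<lambda>c. exp (Re w + ?E) powi c * norm q powi tri c"
  let ?g = "\<lambda>lam. (norm q * exp ?E) ^ psize lam"
  have fg: "(\<lambda>(c, lam). ?f c * ?g lam) summable_on (UNIV \<times> partitions)"
    by (rule summable_on_product) (use q q1 N(3) in \<open>auto intro!: charge_summable psize_summable\<close>)
  have "(\<lambda>z. norm (weight q w (maya z)) * (\<Prod>i\<in>N. \<Sum>\<^sub>\<infinity>k\<in>occ (maya z). exp (real_of_int k * e i)))
      summable_on (UNIV \<times> partitions)"
  proof (rule summable_on_comparison_test)
    show "(\<lambda>z. C * (\<lambda>(c, lam). ?f c * ?g lam) z) summable_on (UNIV \<times> partitions)"
      by (rule summable_on_cmult_right[OF fg])
    fix z assume "z \<in> (UNIV :: int set) \<times> partitions"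
    then obtain c lam where z: "z = (c, lam)" "lam \<in> partitions" by auto
    have "(\<Prod>i\<in>N. \<Sum>\<^sub>\<infinity>k\<in>occ (maya z). exp (real_of_int k * e i)) \<le>
        (\<Prod>i\<in>N. 1 / (1 - exp (- e i)) * (exp (e i) powi c * exp (e i) ^ psize lam))"
      by (rule prod_mono) (use N(2) z site_norm_sum_maya in \<open>auto intro: infsum_nonneg\<close>)
    also have "\<dots> = C * (exp ?E powi c * exp ?E ^ psize lam)"
    proof -
      have "(\<Prod>i\<in>N. exp (e i) powi c) = exp ?E powi c"
        using N(1) by (simp add: exp_power_int exp_sum[symmetric] sum_distrib_left)
      moreover have "(\<Prod>i\<in>N. exp (e i) ^ psize lam) = exp ?E ^ psize lam"
        using N(1) by (simp add: exp_sum prod_power_distrib)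
      ultimately show ?thesis by (simp only: prod.distrib C_def)
    qed
    finally have "norm (weight q w (maya z)) * (\<Prod>i\<in>N. \<Sum>\<^sub>\<infinity>k\<in>occ (maya z). exp (real_of_int k * e i)) \<le>
        norm (weight q w (maya z)) * (C * (exp ?E powi c * exp ?E ^ psize lam))"
      by (rule mult_left_mono) simp
    also have "\<dots> = C * (\<lambda>(c, lam). ?f c * ?g lam) z"
      using q z by (simp add: norm_weight_maya exp_add power_int_mult_distrib power_mult_distrib)
    finally show "norm (weight q w (maya z)) * (\<Prod>i\<in>N. \<Sum>\<^sub>\<infinity>k\<in>occ (maya z). exp (real_of_int k * e i))
        \<le> C * (\<lambda>(c, lam). ?f c * ?g lam) z" .
  qed (auto intro!: mult_nonneg_nonneg prod_nonneg infsum_nonneg)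
  thus ?thesis using summable_on_reindex_bij_betw[OF bij_betw_maya] by fastforce
qed

section \<open>Cumulants of a site\<close>

text \<open>This is \<open>t / (1 + t)\<close> for the site weight \<open>t\<close>, the mean
  occupation of an independent site.\<close>

definition occupation :: "complex \<Rightarrow> int \<Rightarrow> complex \<Rightarrow> complex" where
  "occupation q k w = exp w * q powi k / (exp w * q powi k - 1)"

text \<open>As \<open>w\<close> is the logarithm of the fugacity, derivatives in \<open>w\<close>
  produce cumulants; the index is one less than the order, index 0 being the mean.\<close>

definition cumulant :: "complex \<Rightarrow> nat \<Rightarrow> int \<Rightarrow> complex \<Rightarrow> complex" where
  "cumulant q n k w = (deriv ^^ n) (occupation q k) w"

definition regular_set :: "complex \<Rightarrow> int \<Rightarrow> complex set" where
  "regular_set q k = {w. exp w * q powi k \<noteq> 1}"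

lemma open_regular_set: "open (regular_set q k)"
proof -
  have "open ((\<lambda>w. exp w * q powi k) -` (- {1}))"
    by (intro open_vimage continuous_intros)
  moreover have "(\<lambda>w. exp w * q powi k) -` (- {1}) = regular_set q k" by (auto simp: regular_set_def)
  ultimately show ?thesis by simp
qed

lemma occupation_holomorphic: "occupation q k holomorphic_on regular_set q k"
  unfolding occupation_def by (intro holomorphic_intros) (auto simp: regular_set_def)

text \<open>The derivative of the mean is the variance, which is p - p^2 for a variable with values
  0 and 1.\<close>

lemma deriv_occupation:
  assumes "w \<in> regular_set q k"
  shows "(occupation q k has_field_derivative occupation q k w - (occupation q k w)\<^sup>2) (at w)"
proof -
  have nz: "exp w * q powi k - 1 \<noteq> 0" using assms by (simp add: regular_set_def)
  have "((\<lambda>w. exp w * q powi k / (exp w * q powi k - 1)) has_field_derivative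
      (exp w * q powi k * (exp w * q powi k - 1) - exp w * q powi k * (exp w * q powi k)) /
      ((exp w * q powi k - 1) * (exp w * q powi k - 1))) (at w)"
    by (rule derivative_eq_intros refl nz | simp)+
  moreover have "(exp w * q powi k * (exp w * q powi k - 1) - exp w * q powi k * (exp w * q powi k)) /
      ((exp w * q powi k - 1) * (exp w * q powi k - 1)) = occupation q k w - (occupation q k w)\<^sup>2"
  proof -
    have "(E * (E - 1) - E * E) / ((E - 1) * (E - 1)) = E / (E - 1) - (E / (E - 1))\<^sup>2"
      if "E - 1 \<noteq> 0" for E :: complex
      using that by (simp add: power2_eq_square diff_divide_distrib)
    from this[OF nz] show ?thesis unfolding occupation_def .
  qed
  ultimately show ?thesis unfolding occupation_def[abs_def] by simp
qed

lemma occupation_site_weight: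
  assumes "w \<in> regular_set q k"
  shows "occupation q k w * (1 + site_weight q w k) = site_weight q w k"
  using assms by (simp add: occupation_def site_weight_def regular_set_def field_simps)

lemma higher_deriv_site_weight: "(deriv ^^ n) (\<lambda>w. site_weight q w k) = (\<lambda>w. site_weight q w k)"
proof (induction n)
  case (Suc n)
  have "deriv (\<lambda>w. site_weight q w k) w = site_weight q w k" for w
    unfolding site_weight_def by (rule DERIV_imp_deriv) (auto intro!: derivative_eq_intros)
  thus ?case using Suc by auto
qed simp

lemma site_weight_holomorphic: "(\<lambda>w. site_weight q w k) holomorphic_on A"
  unfolding site_weight_def by (intro holomorphic_intros)

text \<open>Leibniz's rule applied to \<open>p (1 + t) = t\<close>, where \<open>t' = t\<close>.\<close>

lemma cumulant_recursion:
  assumes "w \<in> regular_set q k"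
  shows "cumulant q n k w + site_weight q w k * (\<Sum>m\<le>n. of_nat (n choose m) * cumulant q m k w)
    = site_weight q w k"
proof -
  let ?S = "regular_set q k" and ?t = "\<lambda>w. site_weight q w k"
  have d: "(deriv ^^ j) (\<lambda>w. 1 + ?t w) w = (if j = 0 then 1 else 0) + ?t w" for j
    by (subst higher_deriv_add[of _ UNIV])
       (auto intro!: holomorphic_intros site_weight_holomorphic simp: higher_deriv_site_weight)
  have "?t w = (deriv ^^ n) (\<lambda>w. occupation q k w * (1 + ?t w)) w"
    by (subst higher_deriv_transform_within_open[of _ ?S "?t"])
       (use assms in \<open>auto intro!: holomorphic_intros site_weight_holomorphic occupation_holomorphic
         simp: open_regular_set occupation_site_weight higher_deriv_site_weight\<close>)
  also have "\<dots> = (\<Sum>i = 0..n. of_nat (n choose i) * cumulant q i k w *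
      (deriv ^^ (n - i)) (\<lambda>w. 1 + ?t w) w)"
    unfolding cumulant_def
    by (rule higher_deriv_mult[of _ ?S])
       (use assms in \<open>auto intro!: holomorphic_intros site_weight_holomorphic occupation_holomorphic
         simp: open_regular_set\<close>)
  also have "\<dots> = (\<Sum>i\<in>{..n}. (if i = n then cumulant q n k w else 0) +
      ?t w * (of_nat (n choose i) * cumulant q i k w))"
    unfolding d by (intro sum.cong) (auto simp: algebra_simps)
  also have "\<dots> = cumulant q n k w + ?t w * (\<Sum>m\<le>n. of_nat (n choose m) * cumulant q m k w)"
    by (simp add: sum.distrib sum_distrib_left)
  finally show ?thesis by simp
qed

text \<open>Iterates p' = p - p^2, which is the factor \<open>[:0, 1, -1:]\<close>. As polynomials
  in p without constant term, all cumulants inherit the decay of p along the sites.\<close>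

fun cumulant_poly :: "nat \<Rightarrow> complex poly" where
  "cumulant_poly 0 = [:0, 1:]"
| "cumulant_poly (Suc n) = pderiv (cumulant_poly n) * [:0, 1, -1:]"

lemma cumulant_poly:
  assumes "w \<in> regular_set q k"
  shows "cumulant q n k w = poly (cumulant_poly n) (occupation q k w)"
  using assms
proof (induction n arbitrary: w)
  case (Suc n)
  have "((\<lambda>w. poly (cumulant_poly n) (occupation q k w)) has_field_derivative
      poly (pderiv (cumulant_poly n)) (occupation q k w) * (occupation q k w - (occupation q k w)\<^sup>2)) (at w)"
    by (rule DERIV_chain2[OF poly_DERIV deriv_occupation[OF Suc.prems]])
  hence "((deriv ^^ n) (occupation q k) has_field_derivative
      poly (pderiv (cumulant_poly n)) (occupation q k w) * (occupation q k w - (occupation q k w)\<^sup>2)) (at w)"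
    by (rule has_field_derivative_transform_within_open[OF _ open_regular_set Suc.prems])
       (use Suc.IH in \<open>simp add: cumulant_def\<close>)
  hence "deriv ((deriv ^^ n) (occupation q k)) w =
      poly (pderiv (cumulant_poly n)) (occupation q k w) * (occupation q k w - (occupation q k w)\<^sup>2)"
    by (rule DERIV_imp_deriv)
  thus ?case by (simp add: cumulant_def algebra_simps power2_eq_square)
qed (simp add: cumulant_def)

lemma cumulant_poly_at_0: "poly (cumulant_poly n) 0 = 0"
  by (cases n) auto

lemma cumulant_0: "cumulant q 0 k w = occupation q k w"
  by (simp add: cumulant_def)

section \<open>Sums over pairs of disjoint subsets\<close>

lemma sum_Pow_Pow_Diff:
  assumes "finite N"
  shows "(\<Sum>J\<in>Pow N. \<Sum>I\<in>Pow (N - J). f J I) = (\<Sum>M\<in>Pow N. \<Sum>J\<in>Pow M. f J (M - J))"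
proof -
  have fin: "finite J" if "J \<in> Pow N" for J using that assms finite_subset by blast
  have "(\<Sum>J\<in>Pow N. \<Sum>I\<in>Pow (N - J). f J I) = (\<Sum>(J, I)\<in>(SIGMA J:Pow N. Pow (N - J)). f J I)"
    by (rule sum.Sigma) (use assms in auto)
  also have "\<dots> = (\<Sum>(M, J)\<in>(SIGMA M:Pow N. Pow M). f J (M - J))"
    by (rule sum.reindex_bij_witness[where i = "\<lambda>(M, J). (J, M - J)" and j = "\<lambda>(J, I). (J \<union> I, J)"])
       (auto intro!: arg_cong2[where f = f])
  also have "\<dots> = (\<Sum>M\<in>Pow N. \<Sum>J\<in>Pow M. f J (M - J))"
    by (rule sum.Sigma[symmetric]) (use assms fin in auto)
  finally show ?thesis .
qed

lemma sum_Pow_card: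
  fixes g :: "nat \<Rightarrow> 'a::comm_semiring_1"
  assumes "finite M"
  shows "(\<Sum>J\<in>Pow M. g (card J)) = (\<Sum>m\<le>card M. of_nat (card M choose m) * g m)"
proof -
  have "(\<Sum>J\<in>Pow M. g (card J)) = (\<Sum>m\<le>card M. \<Sum>J\<in>{J\<in>Pow M. card J = m}. g (card J))"
    by (rule sum.group[symmetric]) (use assms in \<open>auto intro: card_mono\<close>)
  also have "\<dots> = (\<Sum>m\<le>card M. of_nat (card M choose m) * g m)"
  proof (rule sum.cong[OF refl])
    fix m
    have "(\<Sum>J\<in>{J\<in>Pow M. card J = m}. g (card J)) = (\<Sum>J\<in>{J\<in>Pow M. card J = m}. g m)"
      by (rule sum.cong) auto
    also have "\<dots> = of_nat (card {J. J \<subseteq> M \<and> card J = m}) * g m" by simp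
    finally show "(\<Sum>J\<in>{J\<in>Pow M. card J = m}. g (card J)) = of_nat (card M choose m) * g m"
      by (simp only: n_subsets[OF assms])
  qed
  finally show ?thesis .
qed

lemma infsum_sum_swap:
  fixes f :: "'a \<Rightarrow> 'b \<Rightarrow> complex"
  assumes "\<And>i. i \<in> I \<Longrightarrow> f i summable_on B"
  shows "infsum (\<lambda>y. \<Sum>i\<in>I. f i y) B = (\<Sum>i\<in>I. infsum (f i) B)"
    and "(\<lambda>y. \<Sum>i\<in>I. f i y) summable_on B"
proof -
  have "((\<lambda>y. \<Sum>i\<in>I. f i y) has_sum (\<Sum>i\<in>I. infsum (f i) B)) B"
    using assms by (induction I rule: infinite_finite_induct) (auto intro!: has_sum_add has_sum_infsum)
  thus "infsum (\<lambda>y. \<Sum>i\<in>I. f i y) B = (\<Sum>i\<in>I. infsum (f i) B)"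
    "(\<lambda>y. \<Sum>i\<in>I. f i y) summable_on B"
    by (auto simp: has_sum_iff)
qed

section \<open>Correlation sums over Maya diagrams\<close>

text \<open>Positive real parts make the sums over occupied sites converge at their infinite lower
  end; by the last condition the powers \<open>q ^ psize lam\<close> absorb the growth of all site
  sums together.\<close>

definition admissible :: "complex \<Rightarrow> 'i set \<Rightarrow> ('i \<Rightarrow> complex) \<Rightarrow> bool" where
  "admissible q N x \<longleftrightarrow> 0 < norm q \<and> finite N \<and> (\<forall>i\<in>N. 0 < Re (x i)) \<and>
     norm q * exp (\<Sum>i\<in>N. Re (x i)) < 1"

text \<open>Not normalized: for empty \<open>N\<close> it is the grand partition function.\<close>

definition corr :: "complex \<Rightarrow> complex \<Rightarrow> 'i set \<Rightarrow> ('i \<Rightarrow> complex) \<Rightarrow> complex" where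
  "corr q w N x = (\<Sum>\<^sub>\<infinity>D\<in>{D. finite D}. weight q w D * (\<Prod>i\<in>N. site_sum (x i) D))"

definition corr_at :: "complex \<Rightarrow> complex \<Rightarrow> int \<Rightarrow> 'i set \<Rightarrow> ('i \<Rightarrow> complex) \<Rightarrow> complex" where
  "corr_at q w k N x = (\<Sum>\<^sub>\<infinity>D\<in>{D. finite D \<and> k \<in> occ D}. weight q w D * (\<Prod>i\<in>N. site_sum (x i) D))"

lemma admissible_subset:
  assumes "admissible q N x" "M \<subseteq> N"
  shows "admissible q M x"
proof -
  have "(\<Sum>i\<in>M. Re (x i)) \<le> (\<Sum>i\<in>N. Re (x i))"
    by (rule sum_mono2) (use assms in \<open>auto simp: admissible_def intro: less_imp_le\<close>)
  hence "norm q * exp (\<Sum>i\<in>M. Re (x i)) \<le> norm q * exp (\<Sum>i\<in>N. Re (x i))"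
    by (intro mult_left_mono) auto
  moreover have "norm q * exp (\<Sum>i\<in>N. Re (x i)) < 1" using assms by (simp add: admissible_def)
  ultimately have "norm q * exp (\<Sum>i\<in>M. Re (x i)) < 1" by (rule le_less_trans)
  thus ?thesis using assms by (auto simp: admissible_def intro: finite_subset)
qed

lemma admissible_norm_less_1:
  assumes "admissible q N x"
  shows "0 < norm q" "norm q < 1"
  using admissible_subset[OF assms, of "{}"] by (auto simp: admissible_def)

lemma corr_norm_summable:
  assumes "admissible q N x"
  shows "(\<lambda>D. norm (weight q w D) * (\<Prod>i\<in>N. \<Sum>\<^sub>\<infinity>k\<in>occ D. exp (real_of_int k * Re (x i))))
    summable_on {D. finite D}"
  by (rule weighted_site_sums_summable) (use assms in \<open>auto simp: admissible_def\<close>)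

lemma corr_abs_summable:
  assumes "admissible q N x"
  shows "(\<lambda>D. norm (weight q w D * (\<Prod>i\<in>N. site_sum (x i) D))) summable_on {D. finite D}"
proof (rule summable_on_comparison_test[OF corr_norm_summable[OF assms, of w]])
  fix D :: "int set" assume D: "D \<in> {D. finite D}"
  have "norm (\<Prod>i\<in>N. site_sum (x i) D) \<le> (\<Prod>i\<in>N. \<Sum>\<^sub>\<infinity>k\<in>occ D. exp (real_of_int k * Re (x i)))"
    unfolding prod_norm[symmetric]
    by (rule prod_mono) (use D assms site_sum_norm_le in \<open>auto simp: admissible_def\<close>)
  thus "norm (weight q w D * (\<Prod>i\<in>N. site_sum (x i) D)) \<le>
      norm (weight q w D) * (\<Prod>i\<in>N. \<Sum>\<^sub>\<infinity>k\<in>occ D. exp (real_of_int k * Re (x i)))"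
    by (simp add: norm_mult mult_left_mono)
qed simp

lemma corr_summable:
  assumes "admissible q N x"
  shows "(\<lambda>D. weight q w D * (\<Prod>i\<in>N. site_sum (x i) D)) summable_on {D. finite D}"
  using corr_abs_summable[OF assms] by (rule abs_summable_summable)

definition toggle :: "int \<Rightarrow> int set \<Rightarrow> int set" where
  "toggle k D = (if k \<in> D then D - {k} else insert k D)"

lemma toggle_toggle [simp]: "toggle k (toggle k D) = D"
  by (auto simp: toggle_def)

lemma finite_toggle [simp]: "finite (toggle k D) \<longleftrightarrow> finite D"
  by (auto simp: toggle_def)

lemma occ_toggle: "k \<notin> occ D \<Longrightarrow> occ (toggle k D) = insert k (occ D)"
  by (auto simp: toggle_def occ_def)

lemma in_occ_toggle: "k \<in> occ (toggle k D) \<longleftrightarrow> k \<notin> occ D"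
  by (auto simp: toggle_def occ_def)

lemma weight_toggle:
  assumes "finite D" "k \<notin> occ D" "q \<noteq> 0"
  shows "weight q w (toggle k D) = site_weight q w k * weight q w D"
proof (cases "0 < k")
  case True
  hence "k \<notin> D" using assms(2) by (auto simp: occ_def)
  thus ?thesis using True assms(1) by (simp add: weight_def toggle_def flip_weight_def)
next
  case False
  hence "k \<in> D" using assms(2) by (auto simp: occ_def)
  moreover from this have "weight q w D = inverse (site_weight q w k) * weight q w (D - {k})"
    using False assms(1) by (simp add: weight_def flip_weight_def prod.remove)
  ultimately show ?thesis using site_weight_nonzero[OF assms(3), of w k] by (simp add: toggle_def)
qed

lemma site_sum_toggle:
  assumes "finite D" "k \<notin> occ D" "0 < Re x"
  shows "site_sum x (toggle k D) = exp (of_int k * x) + site_sum x D"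
  unfolding site_sum_def occ_toggle[OF assms(2)]
  by (rule infsum_insert) (use assms abs_summable_summable[OF exp_summable_occ[OF assms(3,1)]] in auto)

text \<open>Emptying the site \<open>k\<close> is a bijection that divides the weight by the site weight.\<close>

lemma corr_at_toggle:
  assumes adm: "admissible q N x"
  shows "corr_at q w k N x = site_weight q w k *
    (\<Sum>J\<in>Pow N. exp (of_int k * (\<Sum>j\<in>J. x j)) * (corr q w (N - J) x - corr_at q w k (N - J) x))"
proof -
  let ?A = "{D. finite D \<and> k \<in> occ D}" and ?B = "{D. finite D \<and> k \<notin> occ D}"
  let ?f = "\<lambda>N D. weight q w D * (\<Prod>i\<in>N. site_sum (x i) D)"
  have q0: "q \<noteq> 0" and fin: "finite N" using adm by (auto simp: admissible_def)
  have s: "?f M summable_on {D. finite D}" if "M \<subseteq> N" for M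
    using corr_summable[OF admissible_subset[OF adm that]] .
  have sB: "?f M summable_on ?B" if "M \<subseteq> N" for M
    by (rule summable_on_subset_banach[OF s[OF that]]) auto
  have B: "infsum (?f M) ?B = corr q w M x - corr_at q w k M x" if "M \<subseteq> N" for M
  proof -
    have "corr q w M x = infsum (?f M) (?A \<union> ?B)"
      unfolding corr_def by (rule arg_cong[where f = "infsum (?f M)"]) auto
    also have "\<dots> = infsum (?f M) ?A + infsum (?f M) ?B"
      by (rule infsum_Un_disjoint) (use s[OF that] in \<open>auto intro: summable_on_subset_banach\<close>)
    also have "infsum (?f M) ?A = corr_at q w k M x" unfolding corr_at_def ..
    finally show ?thesis by (simp only: add_diff_cancel_left')
  qed
  have "corr_at q w k N x = infsum (\<lambda>D. ?f N (toggle k D)) ?B"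
    unfolding corr_at_def
    by (rule infsum_reindex_bij_witness[where i = "toggle k" and j = "toggle k"])
       (auto simp: in_occ_toggle)
  also have "\<dots> = infsum (\<lambda>D. \<Sum>J\<in>Pow N. site_weight q w k * exp (of_int k * (\<Sum>j\<in>J. x j)) * ?f (N - J) D) ?B"
  proof (rule infsum_cong)
    fix D assume D: "D \<in> ?B"
    have "(\<Prod>i\<in>N. site_sum (x i) (toggle k D)) = (\<Prod>i\<in>N. exp (of_int k * x i) + site_sum (x i) D)"
      by (rule prod.cong) (use D adm site_sum_toggle in \<open>auto simp: admissible_def\<close>)
    also have "\<dots> = (\<Sum>J\<in>Pow N. (\<Prod>i\<in>J. exp (of_int k * x i)) * (\<Prod>i\<in>N - J. site_sum (x i) D))"
      by (rule prod_add[OF fin])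
    also have "\<dots> = (\<Sum>J\<in>Pow N. exp (of_int k * (\<Sum>j\<in>J. x j)) * (\<Prod>i\<in>N - J. site_sum (x i) D))"
      using fin by (intro sum.cong refl)
         (auto simp: exp_sum[symmetric] sum_distrib_left finite_subset)
    finally have P: "(\<Prod>i\<in>N. site_sum (x i) (toggle k D)) =
        (\<Sum>J\<in>Pow N. exp (of_int k * (\<Sum>j\<in>J. x j)) * (\<Prod>i\<in>N - J. site_sum (x i) D))" .
    have W: "weight q w (toggle k D) = site_weight q w k * weight q w D"
      using D q0 by (intro weight_toggle) auto
    show "?f N (toggle k D) = (\<Sum>J\<in>Pow N. site_weight q w k * exp (of_int k * (\<Sum>j\<in>J. x j)) * ?f (N - J) D)"
      unfolding P W by (subst sum_distrib_left, intro sum.cong refl) (simp only: mult_ac)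
  qed
  also have "\<dots> = (\<Sum>J\<in>Pow N. infsum (\<lambda>D. site_weight q w k * exp (of_int k * (\<Sum>j\<in>J. x j)) * ?f (N - J) D) ?B)"
    by (rule infsum_sum_swap) (intro summable_on_cmult_right sB Diff_subset)
  also have "\<dots> = (\<Sum>J\<in>Pow N. site_weight q w k * exp (of_int k * (\<Sum>j\<in>J. x j)) *
      (corr q w (N - J) x - corr_at q w k (N - J) x))"
    by (rule sum.cong[OF refl]) (simp only: infsum_cmult_right' B[OF Diff_subset])
  finally show ?thesis by (subst sum_distrib_left) (simp only: mult.assoc)
qed

text \<open>The toggling identity contains \<open>corr_at\<close> for \<open>N\<close> itself on
  both sides; collected, it has the factor \<open>1 + t\<close>, nonzero for regular
  \<open>w\<close>, and so determines \<open>corr_at\<close> by recursion on \<open>N\<close>. The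
  right-hand side obeys the same recursion, by \<open>cumulant_recursion\<close> summed over
  subsets.\<close>

lemma corr_at_eq:
  assumes adm: "admissible q N x" and w: "w \<in> regular_set q k"
  shows "corr_at q w k N x =
    (\<Sum>J\<in>Pow N. exp (of_int k * (\<Sum>j\<in>J. x j)) * cumulant q (card J) k w * corr q w (N - J) x)"
proof -
  let ?t = "site_weight q w k" and ?e = "\<lambda>J. exp (of_int k * (\<Sum>j\<in>J. x j))"
  define R where "R = (\<lambda>N. \<Sum>J\<in>Pow N. ?e J * cumulant q (card J) k w * corr q w (N - J) x)"
  have t1: "1 + ?t \<noteq> 0" using w by (simp add: regular_set_def site_weight_def)
  have R: "R N = ?t * (\<Sum>J\<in>Pow N. ?e J * (corr q w (N - J) x - R (N - J)))" if fin: "finite N" for N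
  proof -
    have "(\<Sum>J\<in>Pow N. ?e J * R (N - J)) =
        (\<Sum>J\<in>Pow N. \<Sum>I\<in>Pow (N - J). ?e (J \<union> I) * cumulant q (card I) k w * corr q w (N - (J \<union> I)) x)"
    proof (rule sum.cong[OF refl])
      fix J assume J: "J \<in> Pow N"
      have "?e J * (?e I * cumulant q (card I) k w * corr q w (N - J - I) x) =
          ?e (J \<union> I) * cumulant q (card I) k w * corr q w (N - (J \<union> I)) x" if "I \<in> Pow (N - J)" for I
      proof -
        have "(\<Sum>j\<in>J \<union> I. x j) = (\<Sum>j\<in>J. x j) + (\<Sum>j\<in>I. x j)"
          by (rule sum.union_disjoint) (use J that fin in \<open>auto intro: finite_subset\<close>)
        moreover have "N - J - I = N - (J \<union> I)" by auto
        ultimately show ?thesis by (simp add: exp_add algebra_simps)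
      qed
      thus "?e J * R (N - J) =
          (\<Sum>I\<in>Pow (N - J). ?e (J \<union> I) * cumulant q (card I) k w * corr q w (N - (J \<union> I)) x)"
        unfolding R_def sum_distrib_left by (intro sum.cong refl) (simp only: mult.assoc)
    qed
    also have "\<dots> = (\<Sum>M\<in>Pow N. \<Sum>J\<in>Pow M. ?e (J \<union> (M - J)) * cumulant q (card (M - J)) k w *
        corr q w (N - (J \<union> (M - J))) x)"
      by (rule sum_Pow_Pow_Diff[OF fin])
    also have "\<dots> = (\<Sum>M\<in>Pow N. ?e M * corr q w (N - M) x * (\<Sum>J\<in>Pow M. cumulant q (card J) k w))"
    proof (rule sum.cong[OF refl])
      fix M assume M: "M \<in> Pow N"
      have "J \<union> (M - J) = M" if "J \<in> Pow M" for J using that by auto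
      hence "(\<Sum>J\<in>Pow M. ?e (J \<union> (M - J)) * cumulant q (card (M - J)) k w * corr q w (N - (J \<union> (M - J))) x)
          = ?e M * corr q w (N - M) x * (\<Sum>J\<in>Pow M. cumulant q (card (M - J)) k w)"
        by (simp add: sum_distrib_left mult_ac)
      also have "(\<Sum>J\<in>Pow M. cumulant q (card (M - J)) k w) = (\<Sum>J\<in>Pow M. cumulant q (card J) k w)"
        by (rule sum.reindex_bij_witness[where i = "\<lambda>J. M - J" and j = "\<lambda>J. M - J"]) auto
      finally show "(\<Sum>J\<in>Pow M. ?e (J \<union> (M - J)) * cumulant q (card (M - J)) k w * corr q w (N - (J \<union> (M - J))) x)
          = ?e M * corr q w (N - M) x * (\<Sum>J\<in>Pow M. cumulant q (card J) k w)" .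
    qed
    finally have "?t * (\<Sum>J\<in>Pow N. ?e J * R (N - J)) =
        (\<Sum>M\<in>Pow N. ?e M * corr q w (N - M) x * (?t * (\<Sum>J\<in>Pow M. cumulant q (card J) k w)))"
      by (simp add: sum_distrib_left mult_ac)
    also have "\<dots> = (\<Sum>M\<in>Pow N. ?e M * corr q w (N - M) x * (?t - cumulant q (card M) k w))"
    proof (rule sum.cong[OF refl])
      fix M assume "M \<in> Pow N"
      hence "finite M" using fin finite_subset by blast
      hence "?t * (\<Sum>J\<in>Pow M. cumulant q (card J) k w) = ?t - cumulant q (card M) k w"
        using cumulant_recursion[OF w, of "card M"] sum_Pow_card[of M "\<lambda>m. cumulant q m k w"]
        by (simp add: algebra_simps)
      thus "?e M * corr q w (N - M) x * (?t * (\<Sum>J\<in>Pow M. cumulant q (card J) k w)) =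
          ?e M * corr q w (N - M) x * (?t - cumulant q (card M) k w)" by simp
    qed
    also have "\<dots> = ?t * (\<Sum>M\<in>Pow N. ?e M * corr q w (N - M) x) - R N"
      by (simp add: R_def sum_distrib_left sum_subtractf[symmetric] algebra_simps)
    finally show ?thesis by (simp add: right_diff_distrib sum_subtractf)
  qed
  have "corr_at q w k M x = R M" if "M \<subseteq> N" for M
  proof -
    have "finite M" using that adm by (auto simp: admissible_def intro: finite_subset)
    thus ?thesis using that
    proof (induction M rule: finite_psubset_induct)
      case (psubset M)
      have zero: "corr_at q w k (M - J) x - R (M - J) = 0" if "J \<in> Pow M - {{}}" for J
        using psubset.IH[of "M - J"] psubset.prems that by auto
      \<comment> \<open>The difference satisfies the homogeneous recursion, in which by induction
        only the term of empty \<open>J\<close> survives.\<close>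
      have "corr_at q w k M x - R M =
          - ?t * (\<Sum>J\<in>Pow M. ?e J * (corr_at q w k (M - J) x - R (M - J)))"
        using corr_at_toggle[OF admissible_subset[OF adm psubset.prems], of w k] R[OF psubset.hyps]
        by (simp add: right_diff_distrib sum_subtractf algebra_simps)
      also have "(\<Sum>J\<in>Pow M. ?e J * (corr_at q w k (M - J) x - R (M - J))) =
          corr_at q w k M x - R M + (\<Sum>J\<in>Pow M - {{}}. ?e J * (corr_at q w k (M - J) x - R (M - J)))"
        using psubset.hyps by (subst sum.remove[of _ "{}"]) auto
      also have "(\<Sum>J\<in>Pow M - {{}}. ?e J * (corr_at q w k (M - J) x - R (M - J))) = 0"
        using zero by (intro sum.neutral) auto
      finally have "(1 + ?t) * (corr_at q w k M x - R M) = 0" by (simp add: algebra_simps)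
      thus ?case using t1 by simp
    qed
  qed
  thus ?thesis by (simp add: R_def)
qed

section \<open>The Kronecker sums\<close>

text \<open>For \<open>n = 0\<close> this is the quotient of theta functions that generates the
  functions Z, see \<open>theta_quotient\<close>; \<open>n\<close> counts termwise derivatives in
  \<open>w\<close>.\<close>

definition kron :: "complex \<Rightarrow> nat \<Rightarrow> complex \<Rightarrow> complex \<Rightarrow> complex" where
  "kron q n w x = (\<Sum>\<^sub>\<infinity>k. exp (of_int k * x) * cumulant q n k w)"

definition regular :: "complex \<Rightarrow> complex \<Rightarrow> bool" where
  "regular q w \<longleftrightarrow> (\<forall>k. w \<in> regular_set q k)"

text \<open>The strip of convergence of site series: their left tail has ratio
  \<open>exp (- Re x)\<close>, their right tail \<open>norm q * exp (Re x)\<close>.\<close>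

definition in_strip :: "complex \<Rightarrow> complex \<Rightarrow> bool" where
  "in_strip q x \<longleftrightarrow> 0 < Re x \<and> norm q * exp (Re x) < 1"

text \<open>As \<open>nat k\<close> is 0 for negative \<open>k\<close>, one bound covers the decay
  on the right and the limit 1 on the left. Regularity is asked at negative sites only, so that the
  bound also serves at \<open>w = 0\<close>, where the site 0 is singular.\<close>

lemma occupation_bound:
  assumes q: "0 < norm q" "norm q < 1" and w: "\<And>k. k < 0 \<Longrightarrow> w \<in> regular_set q k"
  obtains C where "0 < C" "\<And>k. norm (occupation q k w) \<le> C * norm q ^ nat k"
proof -
  have q0: "q \<noteq> 0" using q by auto
  have qn: "(\<lambda>n. q ^ n) \<longlonglongrightarrow> 0" using q(2) by (rule LIMSEQ_power_zero)
  have "(\<lambda>n. exp w / (exp w * q ^ n - 1)) \<longlonglongrightarrow> exp w / (exp w * 0 - 1)"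
    by (intro tendsto_intros qn) auto
  hence "Bseq (\<lambda>n. exp w / (exp w * q ^ n - 1))" by (intro convergent_imp_Bseq convergentI)
  then obtain C1 where C1: "\<And>n. norm (exp w / (exp w * q ^ n - 1)) \<le> C1" "0 < C1" by (auto simp: Bseq_def)
  have "(\<lambda>n. 1 / (1 - exp (- w) * q ^ n)) \<longlonglongrightarrow> 1 / (1 - exp (- w) * 0)"
    by (intro tendsto_intros qn) auto
  hence "Bseq (\<lambda>n. 1 / (1 - exp (- w) * q ^ n))" by (intro convergent_imp_Bseq convergentI)
  then obtain C2 where C2: "\<And>n. norm (1 / (1 - exp (- w) * q ^ n)) \<le> C2" "0 < C2" by (auto simp: Bseq_def)
  have "norm (occupation q k w) \<le> max C1 C2 * norm q ^ nat k" for k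
  proof (cases "0 \<le> k")
    case True
    have "norm (occupation q k w) = norm (exp w / (exp w * q ^ nat k - 1)) * norm q ^ nat k"
      using True by (simp add: occupation_def power_int_def norm_mult norm_divide norm_power)
    also have "\<dots> \<le> max C1 C2 * norm q ^ nat k"
      by (intro mult_right_mono) (use C1(1)[of "nat k"] in auto)
    finally show ?thesis .
  next
    case False
    define m where "m = nat (- k)"
    have k: "q powi k = inverse (q ^ m)" using False by (simp add: m_def power_int_def power_inverse)
    have ne: "exp w * q powi k \<noteq> 1" using w[of k] False by (auto simp: regular_set_def)
    have "occupation q k w = 1 / (1 - exp (- w) * q ^ m)"
      using ne q0 by (simp add: occupation_def k exp_minus divide_simps)
    thus ?thesis using C2(1)[of m] False by simp
  qed
  thus ?thesis using C1(2) by (intro that[of "max C1 C2"]) auto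
qed

lemma exp_site_bound:
  fixes e :: real
  assumes "0 < r" "0 < e" "r * exp e < 1"
  shows "exp (real_of_int k * e) * r ^ nat k \<le> max (r * exp e) (exp (- e)) ^ nat \<bar>k\<bar>"
proof (cases "0 \<le> k")
  case True
  have "real_of_int k * e = real (nat k) * e" using True by simp
  hence "exp (real_of_int k * e) = exp e ^ nat k" by (simp only: exp_of_nat_mult)
  hence "exp (real_of_int k * e) * r ^ nat k = (r * exp e) ^ nat k"
    by (simp add: power_mult_distrib)
  also have "\<dots> \<le> max (r * exp e) (exp (- e)) ^ nat k"
    by (rule power_mono) (use assms in auto)
  finally show ?thesis using True by simp
next
  case False
  have "real_of_int k * e = real (nat (- k)) * (- e)" using False by simp
  hence "exp (real_of_int k * e) = exp (- e) ^ nat (- k)" by (simp only: exp_of_nat_mult)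
  also have "\<dots> \<le> max (r * exp e) (exp (- e)) ^ nat (- k)"
    by (rule power_mono) auto
  finally show ?thesis using False by simp
qed

lemma poly_bound:
  fixes p :: "complex poly"
  assumes "poly p 0 = 0"
  obtains B where "0 < B" "\<And>z. norm z \<le> C \<Longrightarrow> norm (poly p z) \<le> B * norm z"
proof -
  obtain r where r: "p = [:0, 1:] * r"
    using assms by (metis dvdE minus_zero poly_eq_0_iff_dvd)
  have "bounded (poly r ` cball 0 C)"
    by (intro compact_imp_bounded compact_continuous_image continuous_intros compact_cball)
  then obtain B where B: "\<And>z. z \<in> cball 0 C \<Longrightarrow> norm (poly r z) \<le> B"
    by (metis (no_types, lifting) bounded_iff image_eqI)
  have "norm (poly p z) \<le> max B 1 * norm z" if "norm z \<le> C" for z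
  proof -
    have "norm (poly p z) = norm (poly r z) * norm z" by (simp add: r norm_mult)
    also have "\<dots> \<le> max B 1 * norm z"
      by (intro mult_right_mono) (use B[of z] that in auto)
    finally show ?thesis .
  qed
  thus ?thesis by (intro that[of "max B 1"]) auto
qed

lemma cumulant_bound:
  assumes q: "0 < norm q" "norm q < 1" and w: "\<And>k. k < 0 \<Longrightarrow> w \<in> regular_set q k"
  obtains C where "0 < C"
    "\<And>k. w \<in> regular_set q k \<Longrightarrow> norm (cumulant q n k w) \<le> C * norm q ^ nat k"
proof -
  obtain C where C: "0 < C" "\<And>k. norm (occupation q k w) \<le> C * norm q ^ nat k"
    using occupation_bound[OF q w] by blast
  obtain B where B: "0 < B" "\<And>z. norm z \<le> C \<Longrightarrow> norm (poly (cumulant_poly n) z) \<le> B * norm z"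
    using poly_bound[OF cumulant_poly_at_0] by blast
  have "norm (cumulant q n k w) \<le> B * C * norm q ^ nat k" if w: "w \<in> regular_set q k" for k
  proof -
    have "C * norm q ^ nat k \<le> C * 1" using q C(1) by (intro mult_left_mono power_le_one) auto
    hence "norm (occupation q k w) \<le> C" using C(2)[of k] by simp
    hence "norm (cumulant q n k w) \<le> B * norm (occupation q k w)"
      using B(2) w by (simp add: cumulant_poly)
    also have "\<dots> \<le> B * (C * norm q ^ nat k)" using B(1) C(2) by (intro mult_left_mono) auto
    finally show ?thesis by simp
  qed
  thus ?thesis using B C by (intro that[of "B * C"]) auto
qed

lemma site_series_summable:
  assumes q: "0 < norm q" "norm q < 1" and x: "in_strip q x"
    and f: "\<And>k. norm (f k) \<le> C * norm q ^ nat k" and C: "0 \<le> C"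
  shows "(\<lambda>k. norm (exp (of_int k * x) * f k)) summable_on A"
proof -
  let ?r = "max (norm q * exp (Re x)) (exp (- Re x))"
  have r: "0 \<le> ?r" "?r < 1" using x q by (auto simp: in_strip_def le_max_iff_disj)
  have "(\<lambda>k. norm (exp (of_int k * x) * f k)) summable_on UNIV"
  proof (rule summable_on_comparison_test)
    show "(\<lambda>k::int. C * ?r ^ nat \<bar>k\<bar>) summable_on UNIV"
      by (intro summable_on_cmult_right summable_on_int_geometric r)
    fix k :: int
    have "norm (exp (of_int k * x) * f k) \<le> exp (real_of_int k * Re x) * (C * norm q ^ nat k)"
      by (simp add: norm_mult mult_left_mono f)
    also have "\<dots> = C * (exp (real_of_int k * Re x) * norm q ^ nat k)" by simp
    also have "\<dots> \<le> C * ?r ^ nat \<bar>k\<bar>"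
      using exp_site_bound[of "norm q" "Re x" k] x q C by (intro mult_left_mono) (auto simp: in_strip_def)
    finally show "norm (exp (of_int k * x) * f k) \<le> C * ?r ^ nat \<bar>k\<bar>" .
  qed auto
  thus ?thesis by (rule summable_on_subset_banach) auto
qed

lemma kron_summable:
  assumes "0 < norm q" "norm q < 1" "regular q w" "in_strip q x"
  shows "(\<lambda>k. norm (exp (of_int k * x) * cumulant q n k w)) summable_on A"
proof -
  have w: "w \<in> regular_set q k" for k using assms(3) by (simp add: regular_def)
  obtain C where C: "0 < C" "\<And>k. norm (cumulant q n k w) \<le> C * norm q ^ nat k"
    using cumulant_bound[OF assms(1,2) w] w by metis
  show ?thesis by (rule site_series_summable) (use assms C in auto)
qed

lemma admissible_in_strip:
  assumes adm: "admissible q N x" and J: "J \<subseteq> N" "J \<noteq> {}"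
  shows "in_strip q (\<Sum>j\<in>J. x j)"
proof -
  have "admissible q J x" using admissible_subset[OF adm J(1)] .
  moreover have "0 < (\<Sum>j\<in>J. Re (x j))"
    by (rule sum_pos) (use calculation J in \<open>auto simp: admissible_def\<close>)
  ultimately show ?thesis by (simp add: in_strip_def admissible_def)
qed

section \<open>The recursion\<close>

text \<open>One site sum is written out and the sums over diagrams and over sites are exchanged,
  which the majorant from \<open>corr_norm_summable\<close> permits.\<close>

lemma corr_insert_sites:
  assumes adm: "admissible q (insert a N) x" and a: "a \<notin> N"
  shows "corr q w (insert a N) x = (\<Sum>\<^sub>\<infinity>k. exp (of_int k * x a) * corr_at q w k N x)"
proof -
  let ?A = "{D :: int set. finite D}" and ?f = "\<lambda>D. weight q w D * (\<Prod>i\<in>N. site_sum (x i) D)"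
  let ?F = "\<lambda>(D, k). exp (of_int k * x a) * ?f D"
  have fin: "finite N" and xa: "0 < Re (x a)" using adm by (auto simp: admissible_def)
  have inner: "(\<lambda>k. norm (exp (of_int k * x a) * ?f D)) summable_on occ D" if "finite D" for D
    unfolding norm_mult[of "exp _"]
    by (intro summable_on_cmult_left exp_summable_occ[OF xa that])
  have "(\<lambda>z. norm (?F z)) summable_on (Sigma ?A occ)"
  proof (subst Infinite_Sum.abs_summable_on_Sigma_iff, intro conjI ballI)
    fix D assume "D \<in> ?A"
    thus "(\<lambda>k. norm (?F (D, k))) summable_on occ D" using inner[of D] by simp
  next
    show "(\<lambda>D. norm (\<Sum>\<^sub>\<infinity>k\<in>occ D. norm (?F (D, k)))) summable_on ?A"
    proof (rule summable_on_comparison_test[OF corr_norm_summable[OF adm, of w]])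
      fix D assume "D \<in> ?A"
      hence D: "finite D" by simp
      have "(\<Sum>\<^sub>\<infinity>k\<in>occ D. norm (?F (D, k))) = (\<Sum>\<^sub>\<infinity>k\<in>occ D. exp (real_of_int k * Re (x a)) * norm (?f D))"
        by (simp add: norm_mult)
      also have "\<dots> = (\<Sum>\<^sub>\<infinity>k\<in>occ D. exp (real_of_int k * Re (x a))) * norm (?f D)"
        by (rule infsum_cmult_left')
      also have "\<dots> \<le> (\<Sum>\<^sub>\<infinity>k\<in>occ D. exp (real_of_int k * Re (x a))) *
          (norm (weight q w D) * (\<Prod>i\<in>N. \<Sum>\<^sub>\<infinity>k\<in>occ D. exp (real_of_int k * Re (x i))))"
      proof (rule mult_left_mono)
        have "norm (\<Prod>i\<in>N. site_sum (x i) D) \<le> (\<Prod>i\<in>N. \<Sum>\<^sub>\<infinity>k\<in>occ D. exp (real_of_int k * Re (x i)))"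
          unfolding prod_norm[symmetric]
          by (rule prod_mono) (use D adm site_sum_norm_le in \<open>auto simp: admissible_def\<close>)
        thus "norm (?f D) \<le> norm (weight q w D) * (\<Prod>i\<in>N. \<Sum>\<^sub>\<infinity>k\<in>occ D. exp (real_of_int k * Re (x i)))"
          by (simp add: norm_mult mult_left_mono)
      qed (simp add: infsum_nonneg)
      also have "\<dots> = norm (weight q w D) * (\<Prod>i\<in>insert a N. \<Sum>\<^sub>\<infinity>k\<in>occ D. exp (real_of_int k * Re (x i)))"
        using fin a by simp
      finally show "norm (\<Sum>\<^sub>\<infinity>k\<in>occ D. norm (?F (D, k))) \<le>
          norm (weight q w D) * (\<Prod>i\<in>insert a N. \<Sum>\<^sub>\<infinity>k\<in>occ D. exp (real_of_int k * Re (x i)))"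
        by (simp add: infsum_nonneg)
    qed simp
  qed
  hence s: "?F summable_on (Sigma ?A occ)" by (rule abs_summable_summable)
  let ?G = "\<lambda>(k, D). ?F (D, k)" and ?B = "\<lambda>k. {D. finite D \<and> k \<in> occ D}"
  have s': "?G summable_on (Sigma UNIV ?B)"
    using s by (subst summable_on_reindex_bij_witness[where i = "\<lambda>(D, k). (k, D)" and j = "\<lambda>(k, D). (D, k)"
        and T = "Sigma ?A occ" and h = ?F]) auto
  have "corr q w (insert a N) x = (\<Sum>\<^sub>\<infinity>D\<in>?A. \<Sum>\<^sub>\<infinity>k\<in>occ D. ?F (D, k))"
    unfolding corr_def
  proof (rule infsum_cong)
    fix D
    have "(\<Sum>\<^sub>\<infinity>k\<in>occ D. ?F (D, k)) = site_sum (x a) D * ?f D"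
      by (simp add: infsum_cmult_left' site_sum_def)
    thus "weight q w D * (\<Prod>i\<in>insert a N. site_sum (x i) D) = (\<Sum>\<^sub>\<infinity>k\<in>occ D. ?F (D, k))"
      using fin a by simp
  qed
  also have "\<dots> = infsum ?F (Sigma ?A occ)" by (rule infsum_Sigma_banach[OF s])
  also have "\<dots> = infsum ?G (Sigma UNIV ?B)"
    by (rule infsum_reindex_bij_witness[where j = "\<lambda>(D, k). (k, D)" and i = "\<lambda>(k, D). (D, k)"]) auto
  also have "\<dots> = (\<Sum>\<^sub>\<infinity>k. \<Sum>\<^sub>\<infinity>D\<in>?B k. ?G (k, D))"
    by (rule infsum_Sigma_banach[OF s', symmetric])
  also have "\<dots> = (\<Sum>\<^sub>\<infinity>k. exp (of_int k * x a) * corr_at q w k N x)"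
    by (rule infsum_cong) (simp only: prod.case infsum_cmult_right' corr_at_def)
  finally show ?thesis .
qed

text \<open>At a site \<open>k\<close> the variable \<open>x a\<close> joins the variables of
  \<open>J\<close> in the exponent, and summing over \<open>k\<close> gives a Kronecker sum; the
  remaining variables form a smaller correlation sum.\<close>

lemma corr_insert:
  assumes adm: "admissible q (insert a N) x" and a: "a \<notin> N" and w: "regular q w"
  shows "corr q w (insert a N) x =
    (\<Sum>J\<in>Pow N. kron q (card J) w (x a + (\<Sum>j\<in>J. x j)) * corr q w (N - J) x)"
proof -
  note q = admissible_norm_less_1[OF adm]
  have fin: "finite N" using adm by (simp add: admissible_def)
  have admN: "admissible q N x" using admissible_subset[OF adm] by blast
  let ?t = "\<lambda>J k. exp (of_int k * (x a + (\<Sum>j\<in>J. x j))) * cumulant q (card J) k w * corr q w (N - J) x"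
  have s: "?t J summable_on UNIV" if "J \<in> Pow N" for J
  proof -
    have "x a + (\<Sum>j\<in>J. x j) = (\<Sum>j\<in>insert a J. x j)"
      using that a fin finite_subset[of J N] by (subst sum.insert) auto
    hence "in_strip q (x a + (\<Sum>j\<in>J. x j))"
      using admissible_in_strip[OF adm, of "insert a J"] that by auto
    thus ?thesis
      by (intro summable_on_cmult_left abs_summable_summable[OF kron_summable[OF q w]])
  qed
  have "corr q w (insert a N) x = (\<Sum>\<^sub>\<infinity>k. exp (of_int k * x a) * corr_at q w k N x)"
    by (rule corr_insert_sites[OF adm a])
  also have "\<dots> = (\<Sum>\<^sub>\<infinity>k. \<Sum>J\<in>Pow N. ?t J k)"
  proof (rule infsum_cong)
    fix k :: int
    have "w \<in> regular_set q k" using w by (simp add: regular_def)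
    thus "exp (of_int k * x a) * corr_at q w k N x = (\<Sum>J\<in>Pow N. ?t J k)"
      unfolding corr_at_eq[OF admN \<open>w \<in> regular_set q k\<close>]
      by (subst sum_distrib_left, intro sum.cong refl) (simp add: exp_add distrib_left mult_ac)
  qed
  also have "\<dots> = (\<Sum>J\<in>Pow N. infsum (?t J) UNIV)"
    by (rule infsum_sum_swap) (rule s)
  also have "\<dots> = (\<Sum>J\<in>Pow N. kron q (card J) w (x a + (\<Sum>j\<in>J. x j)) * corr q w (N - J) x)"
    by (rule sum.cong[OF refl]) (simp only: infsum_cmult_left' kron_def)
  finally show ?thesis .
qed

section \<open>Factorization over the charge\<close>

text \<open>The function \<open>theta\<close> freed from \<open>exp (z / 2)\<close> and from the
  eighth root of \<open>q\<close>, see \<open>theta_jtheta\<close>, so that only integral powers of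
  \<open>q\<close> occur.\<close>

definition jtheta :: "complex \<Rightarrow> complex \<Rightarrow> complex" where
  "jtheta q w = (\<Sum>\<^sub>\<infinity>c. (-1) powi c * exp (of_int c * w) * q powi tri c)"

definition part_corr :: "complex \<Rightarrow> 'i set \<Rightarrow> ('i \<Rightarrow> complex) \<Rightarrow> complex" where
  "part_corr q N x = (\<Sum>\<^sub>\<infinity>lam\<in>partitions. q ^ psize lam * (\<Prod>i\<in>N. part_sum (x i) lam))"

lemma jtheta_summable:
  fixes q w :: complex
  assumes "0 < norm q" "norm q < 1"
  shows "(\<lambda>c. norm ((-1) powi c * exp (of_int c * w) * q powi tri c)) summable_on UNIV"
  using charge_summable[OF assms, of "Re w"]
  by (simp add: norm_mult norm_power_int exp_power_int)

lemma part_corr_summable: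
  assumes adm: "admissible q N x"
  shows "(\<lambda>lam. q ^ psize lam * (\<Prod>i\<in>N. part_sum (x i) lam)) summable_on partitions"
proof -
  let ?f = "\<lambda>D. weight q 0 D * (\<Prod>i\<in>N. site_sum (x i) D)"
  have q0: "q \<noteq> 0" using adm by (auto simp: admissible_def)
  have "(\<lambda>z. ?f (maya z)) summable_on (UNIV \<times> partitions)"
    using summable_on_reindex_bij_betw[OF bij_betw_maya, of ?f] corr_summable[OF adm, of 0] by simp
  hence "(\<lambda>z. ?f (maya z)) summable_on (Pair 0 ` partitions)"
    by (rule summable_on_subset_banach) auto
  hence "(\<lambda>lam. ?f (maya (0, lam))) summable_on partitions"
    by (subst (asm) summable_on_reindex) (auto simp: inj_on_def o_def)
  moreover have "?f (maya (0, lam)) = q ^ psize lam * (\<Prod>i\<in>N. part_sum (x i) lam)"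
    if "lam \<in> partitions" for lam
    using that q0 by (simp add: weight_maya site_sum_maya tri_def)
  ultimately show ?thesis by (simp cong: summable_on_cong)
qed

text \<open>In charge \<open>c\<close> every site sum gains the factor
  \<open>exp (of_int c * x i)\<close>, so the charge is felt only through the sum of all variables,
  which is added to \<open>w\<close>.\<close>

lemma corr_factor:
  assumes adm: "admissible q N x"
  shows "corr q w N x = jtheta q (w + (\<Sum>i\<in>N. x i)) * part_corr q N x"
proof -
  let ?f = "\<lambda>D. weight q w D * (\<Prod>i\<in>N. site_sum (x i) D)" and ?X = "\<Sum>i\<in>N. x i"
  have q0: "q \<noteq> 0" and fin: "finite N" using adm by (auto simp: admissible_def)
  have "corr q w N x = infsum (\<lambda>z. ?f (maya z)) (UNIV \<times> partitions)"
    unfolding corr_def by (rule infsum_reindex_bij_betw[OF bij_betw_maya, symmetric])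
  also have "\<dots> = infsum (\<lambda>(c, lam). ((-1) powi c * exp (of_int c * (w + ?X)) * q powi tri c) *
      (q ^ psize lam * (\<Prod>i\<in>N. part_sum (x i) lam))) (UNIV \<times> partitions)"
  proof (rule infsum_cong)
    fix z assume "z \<in> (UNIV :: int set) \<times> partitions"
    then obtain c lam where z: "z = (c, lam)" "lam \<in> partitions" by auto
    have "(\<Prod>i\<in>N. site_sum (x i) (maya (c, lam))) = exp (of_int c * ?X) * (\<Prod>i\<in>N. part_sum (x i) lam)"
      using z fin by (simp add: site_sum_maya prod.distrib exp_sum[symmetric] sum_distrib_left)
    moreover have "(- exp w) powi c = (-1) powi c * exp (of_int c * w)"
      using power_int_mult_distrib[of "-1" "exp w" c] by (simp add: exp_power_int)
    ultimately show "?f (maya z) = (\<lambda>(c, lam). ((-1) powi c * exp (of_int c * (w + ?X)) * q powi tri c) *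
      (q ^ psize lam * (\<Prod>i\<in>N. part_sum (x i) lam))) z"
      using z q0 by (simp add: weight_maya distrib_left exp_add)
  qed
  also have "\<dots> = jtheta q (w + ?X) * part_corr q N x"
    unfolding jtheta_def part_corr_def
    by (rule infsum_product)
       (use abs_summable_summable[OF jtheta_summable[OF admissible_norm_less_1[OF adm]]]
          part_corr_summable[OF adm] in auto)
  finally show ?thesis .
qed

text \<open>The sum expands the product of the factors \<open>1 + flip_weight q w k\<close>, which
  vanish only at singular \<open>w\<close>. Together with \<open>corr_empty_factor\<close> it shows
  that theta has no zeros at regular points, the role usually played by the Jacobi triple
  product.\<close>

lemma corr_empty_nonzero:
  assumes q: "0 < norm q" "norm q < 1" and w: "regular q w"
  shows "corr q w {} x \<noteq> 0"
proof -
  have "1 + flip_weight q w k \<noteq> 0" for k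
  proof -
    have "w \<in> regular_set q k" using w by (simp add: regular_def)
    hence "1 + site_weight q w k \<noteq> 0" by (simp add: regular_set_def site_weight_def)
    moreover have "site_weight q w k \<noteq> 0" using q by (intro site_weight_nonzero) auto
    ultimately show ?thesis by (auto simp: flip_weight_def field_simps add.commute)
  qed
  from infsum_finite_sets_nonzero[OF flip_weight_summable[OF q] this]
  show ?thesis by (simp add: corr_def weight_def)
qed

section \<open>The product formula for Kronecker sums\<close>

lemma higher_deriv_cumulant: "(deriv ^^ n) (cumulant q b k) = cumulant q (b + n) k"
proof -
  have "cumulant q b k = (deriv ^^ b) (occupation q k)" for b by (auto simp: cumulant_def)
  thus ?thesis by (simp add: funpow_add[symmetric] add.commute flip: comp_apply[of "deriv ^^ n"])
qed

lemma cumulant_holomorphic: "cumulant q b k holomorphic_on regular_set q k"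
proof -
  have "cumulant q b k = (deriv ^^ b) (occupation q k)" by (auto simp: cumulant_def)
  thus ?thesis
    by (simp add: holomorphic_higher_deriv occupation_holomorphic open_regular_set)
qed

lemma regular_set_0:
  assumes "norm q < 1" "q \<noteq> 0" "k \<noteq> 0"
  shows "0 \<in> regular_set q k"
proof -
  have "norm (q powi k) \<noteq> 1"
  proof (cases "0 < k")
    case True
    hence "norm q ^ nat k < 1" using assms(1) by (intro power_less_one_iff[THEN iffD2]) auto
    thus ?thesis using True by (simp add: norm_power power_int_def)
  next
    case False
    hence "norm q ^ nat (- k) < 1" using assms(1,3) by (intro power_less_one_iff[THEN iffD2]) auto
    moreover have "norm q ^ nat (- k) \<noteq> 0" using assms(2) by simp
    ultimately have "inverse (norm q ^ nat (- k)) \<noteq> 1" by (auto simp: inverse_eq_1_iff)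
    thus ?thesis using False assms(3) by (simp add: norm_power norm_inverse power_int_def power_inverse)
  qed
  thus ?thesis by (auto simp: regular_set_def)
qed

lemma cumulant_shift:
  assumes "z + c \<in> regular_set q k"
  shows "(deriv ^^ n) (\<lambda>z. cumulant q b k (z + c)) z = cumulant q (b + n) k (z + c)"
proof -
  let ?S = "(\<lambda>z. z + c) -` regular_set q k"
  have S: "open ?S" by (intro open_vimage open_regular_set continuous_intros)
  have "(deriv ^^ n) (\<lambda>z. cumulant q b k (1 * z + c)) z = 1 ^ n * (deriv ^^ n) (cumulant q b k) (1 * z + c)"
    by (rule higher_deriv_compose_linear'[OF cumulant_holomorphic S open_regular_set]) (use assms in auto)
  thus ?thesis by (simp add: higher_deriv_cumulant)
qed

text \<open>The source of the signs \<open>(-1) ^ card (J - I)\<close> in the theorem.\<close>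

lemma cumulant_reflect:
  assumes "c - z \<in> regular_set q k"
  shows "(deriv ^^ n) (\<lambda>z. cumulant q b k (c - z)) z = (-1) ^ n * cumulant q (b + n) k (c - z)"
proof -
  let ?S = "(\<lambda>z. c - z) -` regular_set q k"
  have S: "open ?S" by (intro open_vimage open_regular_set continuous_intros)
  have "(deriv ^^ n) (\<lambda>z. cumulant q b k ((-1) * z + c)) z = (-1) ^ n * (deriv ^^ n) (cumulant q b k) ((-1) * z + c)"
    by (rule higher_deriv_compose_linear'[OF cumulant_holomorphic S open_regular_set]) (use assms in auto)
  thus ?thesis by (simp add: higher_deriv_cumulant)
qed

text \<open>With \<open>a = exp z * q powi k\<close> and \<open>b = exp z' * q powi l\<close> this
  is a partial fraction identity; the factors \<open>b / (b - a)\<close> and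
  \<open>a / (a - b)\<close> are again occupation numbers, at the difference of the sites. Two
  arguments are kept apart so that each factor can be differentiated by itself.\<close>

lemma occupation_product:
  assumes "q \<noteq> 0" "z \<in> regular_set q k" "z' \<in> regular_set q l" "z' - z \<in> regular_set q (l - k)"
  shows "occupation q k z * occupation q l z' =
    occupation q k z * occupation q (l - k) (z' - z) + occupation q l z' * occupation q (k - l) (z - z')"
proof -
  define a where "a = exp z * q powi k"
  define b where "b = exp z' * q powi l"
  have a: "a \<noteq> 1" "a \<noteq> 0" and b: "b \<noteq> 1" "b \<noteq> 0"
    using assms by (auto simp: regular_set_def a_def b_def)
  have ba: "exp (z' - z) * q powi (l - k) = b / a"
    using assms(1) by (simp add: a_def b_def exp_diff power_int_diff)
  have ab: "exp (z - z') * q powi (k - l) = a / b"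
    using assms(1) by (simp add: a_def b_def exp_diff power_int_diff)
  have ne: "a \<noteq> b" using assms(4) a ba by (auto simp: regular_set_def)
  have 1: "(b / a) / (b / a - 1) = b / (b - a)" using a by (simp add: divide_simps)
  have 2: "(a / b) / (a / b - 1) = a / (a - b)" using b by (simp add: divide_simps)
  have "a / (a - 1) * (b / (b - 1)) = a / (a - 1) * (b / (b - a)) + b / (b - 1) * (a / (a - b))"
  proof -
    have "b / (b - 1) * (a / (a - b)) = - (b / (b - 1) * (a / (b - a)))"
      by (metis minus_diff_eq minus_divide_right mult_minus_right)
    moreover have "a / (a - 1) * (b / (b - 1)) = a / (a - 1) * (b / (b - a)) - b / (b - 1) * (a / (b - a))"
      using a b ne by (simp add: divide_simps) (simp add: algebra_simps)
    ultimately show ?thesis by simp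
  qed
  thus ?thesis unfolding occupation_def ba ab 1 2 by (simp add: a_def b_def)
qed

text \<open>This is \<open>occupation_product\<close> differentiated \<open>b\<close> times in the
  argument of \<open>l\<close> and \<open>a\<close> times in that of \<open>k\<close>, both then set
  to \<open>w\<close>. For \<open>k \<noteq> l\<close> the occupation number at the difference of
  the sites is regular at 0; \<open>i\<close> counts the derivatives that Leibniz's rule lets fall
  on it.\<close>

lemma cumulant_product:
  assumes q: "0 < norm q" "norm q < 1" and w: "w \<in> regular_set q k" "w \<in> regular_set q l" and kl: "k \<noteq> l"
  shows "cumulant q a k w * cumulant q b l w =
    (\<Sum>i\<le>a. of_nat (a choose i) * (-1) ^ i * cumulant q (a - i) k w * cumulant q (b + i) (l - k) 0) +
    (\<Sum>i\<le>b. of_nat (b choose i) * (-1) ^ i * cumulant q (b - i) l w * cumulant q (a + i) (k - l) 0)"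
proof -
  have q0: "q \<noteq> 0" using q by auto
  define U where "U = regular_set q k \<inter> regular_set q l"
  define V where "V = regular_set q (l - k) \<inter> regular_set q (k - l)"
  have "open U" "w \<in> U" "open V" "0 \<in> V"
    using w kl q q0 by (auto simp: U_def V_def open_regular_set regular_set_0)
  then obtain e1 e2 where e: "0 < e1" "ball w e1 \<subseteq> U" "0 < e2" "ball 0 e2 \<subseteq> V"
    by (meson openE)
  \<comment> \<open>Half of \<open>e2\<close>, as differences of two points of the ball must stay
    within \<open>e2\<close>.\<close>
  define r where "r = min e1 (e2 / 2)"
  have r: "0 < r" using e by (simp add: r_def)
  have U: "w + s \<in> regular_set q k" "w + s \<in> regular_set q l" if "s \<in> ball 0 r" for s
  proof -
    have "w + s \<in> ball w e1" using that by (simp add: r_def dist_norm)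
    thus "w + s \<in> regular_set q k" "w + s \<in> regular_set q l" using e by (auto simp: U_def)
  qed
  have V: "t - s \<in> regular_set q (l - k)" "t - s \<in> regular_set q (k - l)"
    if "s \<in> ball 0 r" "t \<in> ball 0 r" for s t
  proof -
    have "norm (t - s) \<le> norm t + norm s" by (rule norm_triangle_ineq4)
    hence "t - s \<in> ball 0 e2" using that by (simp add: r_def)
    thus "t - s \<in> regular_set q (l - k)" "t - s \<in> regular_set q (k - l)" using e by (auto simp: V_def)
  qed
  have z: "0 \<in> ball (0::complex) r" using r by simp
  have hol: "(\<lambda>t. cumulant q n j (t + c)) holomorphic_on ball 0 r"
    if "\<And>t. t \<in> ball 0 r \<Longrightarrow> t + c \<in> regular_set q j" for n j c
    by (rule holomorphic_on_compose_gen[OF _ cumulant_holomorphic, unfolded o_def, where f = "\<lambda>t. t + c"])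
       (auto intro!: holomorphic_intros that)
  have hol': "(\<lambda>t. cumulant q n j (c - t)) holomorphic_on ball 0 r"
    if "\<And>t. t \<in> ball 0 r \<Longrightarrow> c - t \<in> regular_set q j" for n j c
    by (rule holomorphic_on_compose_gen[OF _ cumulant_holomorphic, unfolded o_def, where f = "\<lambda>t. c - t"])
       (auto intro!: holomorphic_intros that)
  have U': "s + w \<in> regular_set q k" "s + w \<in> regular_set q l" if "s \<in> ball 0 r" for s
    using U[OF that] by (simp_all add: add.commute)
  \<comment> \<open>The derivatives in the argument of \<open>l\<close> come first, at an offset
    \<open>s\<close> of the argument of \<open>k\<close> that is still free.\<close>
  have step1: "cumulant q 0 k (s + w) * cumulant q b l w = cumulant q 0 k (s + w) * cumulant q b (l - k) (0 - s) +
      (\<Sum>i\<le>b. of_nat (b choose i) * (-1) ^ i * cumulant q (b - i) l w * cumulant q i (k - l) (s + 0))"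
    if s: "s \<in> ball 0 r" for s
  proof -
    let ?c = "cumulant q 0 k (s + w)"
    have hl: "(\<lambda>t. cumulant q 0 l (t + w)) holomorphic_on ball 0 r" by (rule hol) (rule U')
    have hlk: "(\<lambda>t. cumulant q 0 (l - k) (t + (- s))) holomorphic_on ball 0 r"
      by (rule hol) (use V(1)[OF s] in simp)
    have hkl: "(\<lambda>t. cumulant q 0 (k - l) (s - t)) holomorphic_on ball 0 r"
      by (rule hol') (use V(2)[OF _ s] in simp)
    have "(deriv ^^ b) (\<lambda>t. ?c * cumulant q 0 l (t + w)) 0 =
      (deriv ^^ b) (\<lambda>t. ?c * cumulant q 0 (l - k) (t + (- s)) + cumulant q 0 (k - l) (s - t) * cumulant q 0 l (t + w)) 0"
    proof (rule higher_deriv_transform_within_open[of _ "ball 0 r"])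
      fix t :: complex assume t: "t \<in> ball 0 r"
      show "?c * cumulant q 0 l (t + w) = ?c * cumulant q 0 (l - k) (t + (- s)) +
          cumulant q 0 (k - l) (s - t) * cumulant q 0 l (t + w)"
        using occupation_product[OF q0 U'(1)[OF s] U'(2)[OF t]] V(1)[OF s t]
        by (simp add: cumulant_0 mult.commute)
    qed (intro holomorphic_intros hl hlk hkl open_ball z)+
    moreover have "(deriv ^^ b) (\<lambda>t. ?c * cumulant q 0 l (t + w)) 0 = ?c * cumulant q b l w"
      by (subst higher_deriv_cmult[OF hl z open_ball], subst cumulant_shift) (use U'(2)[OF z] in auto)
    moreover have "(deriv ^^ b) (\<lambda>t. ?c * cumulant q 0 (l - k) (t + (- s)) + cumulant q 0 (k - l) (s - t) * cumulant q 0 l (t + w)) 0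
        = ?c * cumulant q b (l - k) (0 - s) +
      (\<Sum>i\<le>b. of_nat (b choose i) * (-1) ^ i * cumulant q (b - i) l w * cumulant q i (k - l) (s + 0))"
    proof (subst higher_deriv_add[of _ "ball 0 r"])
      have "(deriv ^^ b) (\<lambda>t. ?c * cumulant q 0 (l - k) (t + (- s))) 0 = ?c * cumulant q b (l - k) (0 - s)"
        by (subst higher_deriv_cmult[OF hlk z open_ball], subst cumulant_shift) (use V(1)[OF s z] in auto)
      moreover have "(deriv ^^ b) (\<lambda>t. cumulant q 0 (k - l) (s - t) * cumulant q 0 l (t + w)) 0 =
        (\<Sum>i\<le>b. of_nat (b choose i) * (-1) ^ i * cumulant q (b - i) l w * cumulant q i (k - l) (s + 0))"
      proof (subst higher_deriv_mult[OF hkl hl open_ball z], unfold atMost_atLeast0, intro sum.cong refl)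
        fix i
        have "(deriv ^^ i) (\<lambda>t. cumulant q 0 (k - l) (s - t)) 0 = (-1) ^ i * cumulant q i (k - l) s"
          by (subst cumulant_reflect) (use V(2)[OF z s] in auto)
        moreover have "(deriv ^^ (b - i)) (\<lambda>t. cumulant q 0 l (t + w)) 0 = cumulant q (b - i) l w"
          by (subst cumulant_shift) (use U'(2)[OF z] in auto)
        ultimately show "of_nat (b choose i) * (deriv ^^ i) (\<lambda>t. cumulant q 0 (k - l) (s - t)) 0 *
            (deriv ^^ (b - i)) (\<lambda>t. cumulant q 0 l (t + w)) 0 =
          of_nat (b choose i) * (-1) ^ i * cumulant q (b - i) l w * cumulant q i (k - l) (s + 0)"
          by simp
      qed
      ultimately show "(deriv ^^ b) (\<lambda>t. ?c * cumulant q 0 (l - k) (t + (- s))) 0 +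
          (deriv ^^ b) (\<lambda>t. cumulant q 0 (k - l) (s - t) * cumulant q 0 l (t + w)) 0 =
        ?c * cumulant q b (l - k) (0 - s) +
        (\<Sum>i\<le>b. of_nat (b choose i) * (-1) ^ i * cumulant q (b - i) l w * cumulant q i (k - l) (s + 0))"
        by simp
    qed (intro holomorphic_intros hl hlk hkl open_ball z)+
    ultimately show ?thesis by simp
  qed
  have hk: "(\<lambda>s. cumulant q n k (s + w)) holomorphic_on ball 0 r" for n by (rule hol) (rule U')
  have hlk: "(\<lambda>s. cumulant q n (l - k) (0 - s)) holomorphic_on ball 0 r" for n
    by (rule hol') (use V(1)[OF _ z] in simp)
  have hkl: "(\<lambda>s. cumulant q n (k - l) (s + 0)) holomorphic_on ball 0 r" for n
    by (rule hol) (use V(2)[OF z] in simp)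
  let ?R = "\<lambda>s. (\<Sum>i\<le>b. (of_nat (b choose i) * (-1) ^ i * cumulant q (b - i) l w) * cumulant q i (k - l) (s + 0))"
  have hR: "?R holomorphic_on ball 0 r" by (intro holomorphic_intros hkl)
  \<comment> \<open>Now the derivatives in \<open>s\<close> at 0: the first term needs Leibniz's
    rule, while in \<open>?R\<close> only the last factor depends on \<open>s\<close>.\<close>
  have "cumulant q a k w * cumulant q b l w = (deriv ^^ a) (\<lambda>s. cumulant q b l w * cumulant q 0 k (s + w)) 0"
    by (subst higher_deriv_cmult[OF hk z open_ball], subst cumulant_shift) (use U'(1)[OF z] in auto)
  also have "\<dots> = (deriv ^^ a) (\<lambda>s. cumulant q b (l - k) (0 - s) * cumulant q 0 k (s + w) + ?R s) 0"
  proof (rule higher_deriv_transform_within_open[of _ "ball 0 r"])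
    fix s :: complex assume "s \<in> ball 0 r"
    from step1[OF this] show "cumulant q b l w * cumulant q 0 k (s + w) =
        cumulant q b (l - k) (0 - s) * cumulant q 0 k (s + w) + ?R s"
      by (simp only: mult.commute[of "cumulant q 0 k (s + w)"])
  qed (intro holomorphic_intros hk hlk hR open_ball z)+
  also have "\<dots> = (deriv ^^ a) (\<lambda>s. cumulant q b (l - k) (0 - s) * cumulant q 0 k (s + w)) 0 + (deriv ^^ a) ?R 0"
    by (rule higher_deriv_add[of _ "ball 0 r"]) (intro holomorphic_intros hk hlk hR open_ball z)+
  also have "(deriv ^^ a) (\<lambda>s. cumulant q b (l - k) (0 - s) * cumulant q 0 k (s + w)) 0 =
      (\<Sum>i\<le>a. of_nat (a choose i) * (-1) ^ i * cumulant q (a - i) k w * cumulant q (b + i) (l - k) 0)"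
  proof (subst higher_deriv_mult[OF hlk hk open_ball z], unfold atMost_atLeast0, intro sum.cong refl)
    fix i
    have "(deriv ^^ i) (\<lambda>s. cumulant q b (l - k) (0 - s)) 0 = (-1) ^ i * cumulant q (b + i) (l - k) 0"
      by (subst cumulant_reflect) (use V(1)[OF z z] in auto)
    moreover have "(deriv ^^ (a - i)) (\<lambda>s. cumulant q 0 k (s + w)) 0 = cumulant q (a - i) k w"
      by (subst cumulant_shift) (use U'(1)[OF z] in auto)
    ultimately show "of_nat (a choose i) * (deriv ^^ i) (\<lambda>s. cumulant q b (l - k) (0 - s)) 0 *
        (deriv ^^ (a - i)) (\<lambda>s. cumulant q 0 k (s + w)) 0 =
      of_nat (a choose i) * (-1) ^ i * cumulant q (a - i) k w * cumulant q (b + i) (l - k) 0"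
      by simp
  qed
  also have "(deriv ^^ a) ?R 0 =
      (\<Sum>i\<le>b. of_nat (b choose i) * (-1) ^ i * cumulant q (b - i) l w * cumulant q (a + i) (k - l) 0)"
  proof -
    have gen: "(deriv ^^ a) (\<lambda>s. \<Sum>i\<in>I. c i * cumulant q i (k - l) (s + 0)) 0 =
        (\<Sum>i\<in>I. c i * cumulant q (a + i) (k - l) 0)" if "finite I" for I and c :: "nat \<Rightarrow> complex"
      using that
    proof (induction I rule: finite_induct)
      case (insert i I)
      have "(deriv ^^ a) (\<lambda>s. \<Sum>i\<in>insert i I. c i * cumulant q i (k - l) (s + 0)) 0 =
          (deriv ^^ a) (\<lambda>s. c i * cumulant q i (k - l) (s + 0) + (\<Sum>i\<in>I. c i * cumulant q i (k - l) (s + 0))) 0"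
        using insert by simp
      also have "\<dots> = (deriv ^^ a) (\<lambda>s. c i * cumulant q i (k - l) (s + 0)) 0 +
          (deriv ^^ a) (\<lambda>s. \<Sum>i\<in>I. c i * cumulant q i (k - l) (s + 0)) 0"
        by (rule higher_deriv_add[of _ "ball 0 r"]) (intro holomorphic_intros hkl open_ball z)+
      also have "(deriv ^^ a) (\<lambda>s. c i * cumulant q i (k - l) (s + 0)) 0 = c i * cumulant q (a + i) (k - l) 0"
        by (subst higher_deriv_cmult[OF hkl z open_ball], subst cumulant_shift)
           (use V(2)[OF z z] in \<open>auto simp: add.commute\<close>)
      finally show ?case using insert by simp
    qed simp
    show ?thesis using gen[of "{..b}" "\<lambda>i. of_nat (b choose i) * (-1) ^ i * cumulant q (b - i) l w"] by simp
  qed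
  finally show ?thesis .
qed

text \<open>Leibniz's rule applied to \<open>p\<^sup>2 = p - p'\<close>.\<close>

lemma cumulant_square:
  assumes w: "w \<in> regular_set q k"
  shows "(\<Sum>m\<le>n. of_nat (n choose m) * (cumulant q m k w * cumulant q (n - m) k w)) =
    cumulant q n k w - cumulant q (Suc n) k w"
proof -
  let ?S = "regular_set q k"
  have d: "deriv (occupation q k) z = occupation q k z - occupation q k z * occupation q k z" if "z \<in> ?S" for z
    using DERIV_imp_deriv[OF deriv_occupation[OF that]] by (simp add: power2_eq_square)
  have hol: "occupation q k holomorphic_on ?S" "deriv (occupation q k) holomorphic_on ?S"
    by (auto intro!: occupation_holomorphic holomorphic_deriv open_regular_set)
  have "(\<Sum>m\<le>n. of_nat (n choose m) * (cumulant q m k w * cumulant q (n - m) k w)) =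
      (deriv ^^ n) (\<lambda>z. occupation q k z * occupation q k z) w"
    unfolding cumulant_def
    by (subst higher_deriv_mult[OF hol(1) hol(1) open_regular_set w]) (simp add: atMost_atLeast0 mult.assoc)
  also have "\<dots> = (deriv ^^ n) (\<lambda>z. occupation q k z - deriv (occupation q k) z) w"
    by (rule higher_deriv_transform_within_open[OF _ _ open_regular_set w])
       (use d hol in \<open>auto intro!: holomorphic_intros\<close>)
  also have "\<dots> = cumulant q n k w - (deriv ^^ n) (deriv (occupation q k)) w"
    unfolding cumulant_def by (rule higher_deriv_diff[OF hol open_regular_set w])
  also have "(deriv ^^ n) (deriv (occupation q k)) w = cumulant q (Suc n) k w"
    unfolding cumulant_def by (simp add: funpow_Suc_right del: funpow.simps)
  finally show ?thesis .
qed

text \<open>The \<open>n\<close>-th derivative at \<open>w = 0\<close> of the Kronecker sum without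
  the site 0, which is singular there; see \<open>kron_tail\<close>. Up to a constant it is
  \<open>Z q n x\<close>, see \<open>Z_in_strip\<close>.\<close>

definition zeta_sum :: "complex \<Rightarrow> nat \<Rightarrow> complex \<Rightarrow> complex" where
  "zeta_sum q n x = (\<Sum>\<^sub>\<infinity>j\<in>- {0}. exp (of_int j * x) * cumulant q n j 0)"

lemma zeta_sum_summable:
  assumes "0 < norm q" "norm q < 1" "in_strip q x"
  shows "(\<lambda>j. norm (exp (of_int j * x) * cumulant q n j 0)) summable_on - {0}"
proof -
  have w: "0 \<in> regular_set q k" if "k \<noteq> 0" for k using that assms(1,2) by (intro regular_set_0) auto
  obtain C where C: "0 < C" "\<And>k. 0 \<in> regular_set q k \<Longrightarrow> norm (cumulant q n k 0) \<le> C * norm q ^ nat k"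
    using cumulant_bound[of q 0 n] assms(1,2) w by (metis less_irrefl)
  let ?f = "\<lambda>k. if k = 0 then 0 else cumulant q n k 0"
  have "(\<lambda>k. norm (exp (of_int k * x) * ?f k)) summable_on - {0}"
    by (rule site_series_summable[where C = C]) (use assms C w in auto)
  thus ?thesis by (rule summable_on_cong[THEN iffD1, rotated]) auto
qed

text \<open>The product is a double sum over sites \<open>k\<close> and \<open>l\<close>. The
  diagonal is kept; off it \<open>cumulant_product\<close> applies, and in the indices
  \<open>k\<close>, \<open>l - k\<close> or \<open>l\<close>, \<open>k - l\<close> the sums factor,
  since k u + l v = k (u + v) + (l - k) v = l (u + v) + (k - l) u.\<close>

lemma kron_product:
  assumes q: "0 < norm q" "norm q < 1" and w: "regular q w"
    and strip: "in_strip q u" "in_strip q v" "in_strip q (u + v)"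
  shows "kron q a w u * kron q b w v =
    (\<Sum>\<^sub>\<infinity>k. exp (of_int k * (u + v)) * (cumulant q a k w * cumulant q b k w)) +
    (\<Sum>i\<le>a. of_nat (a choose i) * (-1) ^ i * kron q (a - i) w (u + v) * zeta_sum q (b + i) v) +
    (\<Sum>i\<le>b. of_nat (b choose i) * (-1) ^ i * kron q (b - i) w (u + v) * zeta_sum q (a + i) u)"
proof -
  let ?c = "\<lambda>n k. cumulant q n k w" and ?d = "\<lambda>n j. cumulant q n j 0"
  let ?e = "\<lambda>k x. exp (complex_of_int k * x)"
  let ?F = "\<lambda>(k, l). (?e k u * ?c a k) * (?e l v * ?c b l)"
  let ?O = "{(k :: int, l). k \<noteq> l}"
  have wk: "w \<in> regular_set q k" for k using w by (simp add: regular_def)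
  have ks: "(\<lambda>k. ?e k x * ?c n k) summable_on A" if "in_strip q x" for n x A
    using kron_summable[OF q w that] by (rule abs_summable_summable)
  have zs: "(\<lambda>j. ?e j x * ?d n j) summable_on - {0}" if "in_strip q x" for n x
    using zeta_sum_summable[OF q that] by (rule abs_summable_summable)
  have prods: "(\<lambda>(x, y). f x * g y) summable_on A \<times> B"
    if "f summable_on A" "g summable_on B" for f :: "int \<Rightarrow> complex" and g :: "int \<Rightarrow> complex" and A B
  proof (rule abs_summable_summable)
    show "(\<lambda>z. norm ((\<lambda>(x, y). f x * g y) z)) summable_on A \<times> B"
      using summable_on_product[of "\<lambda>x. norm (f x)" A "\<lambda>y. norm (g y)" B] that
      by (simp add: summable_on_iff_abs_summable_on_complex case_prod_unfold norm_mult)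
  qed
  have sF: "?F summable_on UNIV \<times> UNIV" by (rule prods) (intro ks strip)+
  have "kron q a w u * kron q b w v = infsum ?F (UNIV \<times> UNIV)"
    unfolding kron_def by (rule infsum_product[symmetric]) (intro ks strip)+
  also have "UNIV \<times> UNIV = range (\<lambda>k :: int. (k, k)) \<union> ?O" by auto
  also have "infsum ?F (range (\<lambda>k. (k, k)) \<union> ?O) = infsum ?F (range (\<lambda>k. (k, k))) + infsum ?F ?O"
    by (rule infsum_Un_disjoint) (auto intro: summable_on_subset_banach[OF sF])
  also have "infsum ?F (range (\<lambda>k. (k, k))) = (\<Sum>\<^sub>\<infinity>k. ?e k (u + v) * (?c a k * ?c b k))"
    by (subst infsum_reindex) (auto simp: inj_on_def o_def distrib_left exp_add mult_ac intro!: infsum_cong)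
  also have "infsum ?F ?O =
      (\<Sum>i\<le>a. of_nat (a choose i) * (-1) ^ i * kron q (a - i) w (u + v) * zeta_sum q (b + i) v) +
      (\<Sum>i\<le>b. of_nat (b choose i) * (-1) ^ i * kron q (b - i) w (u + v) * zeta_sum q (a + i) u)"
  proof -
    let ?G = "\<lambda>i (k, l). of_nat (a choose i) * (-1) ^ i * ((?e k (u + v) * ?c (a - i) k) * (?e (l - k) v * ?d (b + i) (l - k)))"
    let ?H = "\<lambda>i (k, l). of_nat (b choose i) * (-1) ^ i * ((?e l (u + v) * ?c (b - i) l) * (?e (k - l) u * ?d (a + i) (k - l)))"
    have G: "(?G i has_sum (of_nat (a choose i) * (-1) ^ i * kron q (a - i) w (u + v) * zeta_sum q (b + i) v)) ?O" for i
    proof -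
      let ?P = "\<lambda>(k, j). (?e k (u + v) * ?c (a - i) k) * (?e j v * ?d (b + i) j)"
      have "(?P has_sum (kron q (a - i) w (u + v) * zeta_sum q (b + i) v)) (UNIV \<times> - {0})"
        unfolding has_sum_iff kron_def zeta_sum_def
        by (intro conjI prods infsum_product ks zs strip)
      hence "((\<lambda>(k, l). ?P (k, l - k)) has_sum (kron q (a - i) w (u + v) * zeta_sum q (b + i) v)) ?O"
        by (subst has_sum_reindex_bij_witness[where i = "\<lambda>(k, j). (k, j + k)" and j = "\<lambda>(k, l). (k, l - k)"
            and T = "UNIV \<times> - {0}" and h = ?P, OF _ _ _ _ _ refl]) auto
      from has_sum_cmult_right[OF this, of "of_nat (a choose i) * (-1) ^ i"] show ?thesis
        by (simp add: case_prod_unfold mult.assoc)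
    qed
    have H: "(?H i has_sum (of_nat (b choose i) * (-1) ^ i * kron q (b - i) w (u + v) * zeta_sum q (a + i) u)) ?O" for i
    proof -
      let ?P = "\<lambda>(l, j). (?e l (u + v) * ?c (b - i) l) * (?e j u * ?d (a + i) j)"
      have "(?P has_sum (kron q (b - i) w (u + v) * zeta_sum q (a + i) u)) (UNIV \<times> - {0})"
        unfolding has_sum_iff kron_def zeta_sum_def
        by (intro conjI prods infsum_product ks zs strip)
      hence "((\<lambda>(k, l). ?P (l, k - l)) has_sum (kron q (b - i) w (u + v) * zeta_sum q (a + i) u)) ?O"
        by (subst has_sum_reindex_bij_witness[where i = "\<lambda>(l, j). (j + l, l)" and j = "\<lambda>(k, l). (l, k - l)"
            and T = "UNIV \<times> - {0}" and h = ?P, OF _ _ _ _ _ refl]) auto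
      from has_sum_cmult_right[OF this, of "of_nat (b choose i) * (-1) ^ i"] show ?thesis
        by (simp add: case_prod_unfold mult.assoc)
    qed
    have "infsum ?F ?O = infsum (\<lambda>z. (\<Sum>i\<le>a. ?G i z) + (\<Sum>i\<le>b. ?H i z)) ?O"
    proof (rule infsum_cong)
      fix z assume "z \<in> ?O"
      then obtain k l where z: "z = (k, l)" "k \<noteq> l" by auto
      have 1: "?e k u * ?e l v = ?e k (u + v) * ?e (l - k) v"
        by (simp add: exp_add[symmetric] algebra_simps)
      have 2: "?e k u * ?e l v = ?e l (u + v) * ?e (k - l) u"
        by (simp add: exp_add[symmetric] algebra_simps)
      have "?F z = (?e k u * ?e l v) * (?c a k * ?c b l)" by (simp add: z)
      also have "\<dots> = (?e k u * ?e l v) * (\<Sum>i\<le>a. of_nat (a choose i) * (-1) ^ i * ?c (a - i) k * ?d (b + i) (l - k)) +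
          (?e k u * ?e l v) * (\<Sum>i\<le>b. of_nat (b choose i) * (-1) ^ i * ?c (b - i) l * ?d (a + i) (k - l))"
        unfolding cumulant_product[OF q wk wk z(2)] by (rule distrib_left)
      also have "(?e k u * ?e l v) * (\<Sum>i\<le>a. of_nat (a choose i) * (-1) ^ i * ?c (a - i) k * ?d (b + i) (l - k)) =
          (\<Sum>i\<le>a. ?G i z)"
        unfolding 1 z(1) prod.case by (subst sum_distrib_left, intro sum.cong refl) (simp only: mult_ac)
      also have "(?e k u * ?e l v) * (\<Sum>i\<le>b. of_nat (b choose i) * (-1) ^ i * ?c (b - i) l * ?d (a + i) (k - l)) =
          (\<Sum>i\<le>b. ?H i z)"
        unfolding 2 z(1) prod.case by (subst sum_distrib_left, intro sum.cong refl) (simp only: mult_ac)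
      finally show "?F z = (\<Sum>i\<le>a. ?G i z) + (\<Sum>i\<le>b. ?H i z)" .
    qed
    also have "\<dots> = infsum (\<lambda>z. \<Sum>i\<le>a. ?G i z) ?O + infsum (\<lambda>z. \<Sum>i\<le>b. ?H i z) ?O"
      by (rule infsum_add) (intro infsum_sum_swap(2) has_sum_imp_summable[OF G] has_sum_imp_summable[OF H])+
    also have "infsum (\<lambda>z. \<Sum>i\<le>a. ?G i z) ?O =
        (\<Sum>i\<le>a. of_nat (a choose i) * (-1) ^ i * kron q (a - i) w (u + v) * zeta_sum q (b + i) v)"
      by (rule trans[OF infsum_sum_swap(1)[OF has_sum_imp_summable[OF G]] sum.cong[OF refl infsumI[OF G]]])
    also have "infsum (\<lambda>z. \<Sum>i\<le>b. ?H i z) ?O =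
        (\<Sum>i\<le>b. of_nat (b choose i) * (-1) ^ i * kron q (b - i) w (u + v) * zeta_sum q (a + i) u)"
      by (rule trans[OF infsum_sum_swap(1)[OF has_sum_imp_summable[OF H]] sum.cong[OF refl infsumI[OF H]]])
    finally show ?thesis .
  qed
  finally show ?thesis by (simp only: add.assoc)
qed

text \<open>Here \<open>kron_product\<close> is summed over all ways to distribute \<open>S\<close>
  between \<open>u\<close> and \<open>v\<close>; the total of the two arguments is always the same.
  The diagonal terms collapse by \<open>cumulant_square\<close> to the difference of the two single
  Kronecker sums, which therefore stand on opposite sides.\<close>

lemma kron_identity:
  assumes q: "0 < norm q" "norm q < 1" and w: "regular q w" and S: "finite S"
    and u: "\<And>A. A \<subseteq> S \<Longrightarrow> in_strip q (u + (\<Sum>j\<in>A. z j))"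
    and v: "\<And>A. A \<subseteq> S \<Longrightarrow> in_strip q (v + (\<Sum>j\<in>A. z j))"
    and uv: "in_strip q (u + v + (\<Sum>j\<in>S. z j))"
  shows "kron q (Suc (card S)) w (u + v + (\<Sum>j\<in>S. z j)) +
    (\<Sum>A\<in>Pow S. kron q (card A) w (u + (\<Sum>j\<in>A. z j)) * kron q (card (S - A)) w (v + (\<Sum>j\<in>S - A. z j))) =
    kron q (card S) w (u + v + (\<Sum>j\<in>S. z j)) +
    (\<Sum>J\<in>Pow S. kron q (card (S - J)) w (u + v + (\<Sum>j\<in>S. z j)) *
      (\<Sum>I\<in>Pow J. (-1) ^ card (J - I) *
        (zeta_sum q (card J) (u + (\<Sum>j\<in>I. z j)) + zeta_sum q (card J) (v + (\<Sum>j\<in>I. z j)))))"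
proof -
  let ?s = "\<lambda>A. \<Sum>j\<in>A. z j" and ?n = "card S"
  let ?X = "u + v + ?s S" and ?c = "\<lambda>n k. cumulant q n k w"
  have fin: "finite A" if "A \<subseteq> S" for A using that S by (rule finite_subset)
  have wk: "w \<in> regular_set q k" for k using w by (simp add: regular_def)
  have split: "?s S = ?s A + ?s (S - A)" if "A \<subseteq> S" for A
    using S that by (simp add: sum.subset_diff add.commute)
  have uvA: "(u + ?s A) + (v + ?s (S - A)) = ?X" if "A \<subseteq> S" for A
    using split[OF that] by (simp add: algebra_simps)
  \<comment> \<open>The off-diagonal terms with \<open>x + ?s A\<close> as the argument of
    \<open>zeta_sum\<close>. The binomial sum over \<open>i\<close> is written as a sum over sets
    \<open>I\<close> of size \<open>i\<close>, so that \<open>A\<close> and \<open>I\<close> can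
    later be regrouped by their union.\<close>
  define P where "P = (\<lambda>x A. \<Sum>I\<in>Pow (S - A). (-1) ^ card I * kron q (card (S - A - I)) w ?X *
      zeta_sum q (card A + card I) (x + ?s A))"
  have Pow_binom: "(\<Sum>i\<le>card B. of_nat (card B choose i) * (-1) ^ i * kron q (card B - i) w ?X * zeta_sum q (m + i) y) =
      (\<Sum>I\<in>Pow B. (-1) ^ card I * kron q (card (B - I)) w ?X * zeta_sum q (m + card I) y)"
    if "B \<subseteq> S" for B m y
  proof -
    have "(\<Sum>I\<in>Pow B. (-1) ^ card I * kron q (card (B - I)) w ?X * zeta_sum q (m + card I) y) =
        (\<Sum>I\<in>Pow B. (-1) ^ card I * kron q (card B - card I) w ?X * zeta_sum q (m + card I) y)"
      using fin[OF that] by (intro sum.cong refl) (auto simp: card_Diff_subset finite_subset)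
    also have "\<dots> = (\<Sum>i\<le>card B. of_nat (card B choose i) * ((-1) ^ i * kron q (card B - i) w ?X * zeta_sum q (m + i) y))"
      by (rule sum_Pow_card[OF fin[OF that]])
    finally show ?thesis by (simp add: mult.assoc)
  qed
  have piece: "kron q (card A) w (u + ?s A) * kron q (card (S - A)) w (v + ?s (S - A)) =
      (\<Sum>\<^sub>\<infinity>k. exp (of_int k * ?X) * (?c (card A) k * ?c (card (S - A)) k)) + P v (S - A) + P u A"
    if A: "A \<in> Pow S" for A
  proof -
    have A': "A \<subseteq> S" "S - (S - A) = A" using A by auto
    have X: "u + ?s A + (v + ?s (S - A)) = ?X" by (rule uvA[OF A'(1)])
    show ?thesis
      using kron_product[OF q w u[OF A'(1)] v[OF Diff_subset], of A "card A" "card (S - A)"]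
      unfolding X P_def A'(2)
      by (simp add: uv Pow_binom[OF A'(1)] Pow_binom[OF Diff_subset])
  qed
  have P_sum: "(\<Sum>A\<in>Pow S. P x A) = (\<Sum>J\<in>Pow S. kron q (card (S - J)) w ?X *
      (\<Sum>I\<in>Pow J. (-1) ^ card (J - I) * zeta_sum q (card J) (x + ?s I)))" for x
  proof -
    have "(\<Sum>A\<in>Pow S. P x A) = (\<Sum>J\<in>Pow S. \<Sum>A\<in>Pow J. (-1) ^ card (J - A) *
        kron q (card (S - A - (J - A))) w ?X * zeta_sum q (card A + card (J - A)) (x + ?s A))"
      unfolding P_def by (rule sum_Pow_Pow_Diff[OF S])
    also have "\<dots> = (\<Sum>J\<in>Pow S. \<Sum>A\<in>Pow J. kron q (card (S - J)) w ?X *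
        ((-1) ^ card (J - A) * zeta_sum q (card J) (x + ?s A)))"
    proof (intro sum.cong refl)
      fix J A assume JA: "J \<in> Pow S" "A \<in> Pow J"
      hence "S - A - (J - A) = S - J" by auto
      moreover have "card A + card (J - A) = card J"
        using JA fin[of J] by (simp add: card_Diff_subset card_mono finite_subset)
      ultimately show "(-1) ^ card (J - A) * kron q (card (S - A - (J - A))) w ?X *
          zeta_sum q (card A + card (J - A)) (x + ?s A) =
        kron q (card (S - J)) w ?X * ((-1) ^ card (J - A) * zeta_sum q (card J) (x + ?s A))"
        by simp
    qed
    finally show ?thesis by (simp only: sum_distrib_left)
  qed
  have diag: "(\<Sum>A\<in>Pow S. \<Sum>\<^sub>\<infinity>k. exp (of_int k * ?X) * (?c (card A) k * ?c (card (S - A)) k)) =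
      kron q ?n w ?X - kron q (Suc ?n) w ?X"
  proof -
    have s: "(\<lambda>k. exp (of_int k * ?X) * ?c m k) summable_on UNIV" for m
      using kron_summable[OF q w uv] by (rule abs_summable_summable)
    have sp: "(\<lambda>k. exp (of_int k * ?X) * (?c m k * ?c m' k)) summable_on UNIV" for m m'
    proof -
      obtain C where C: "0 < C" "\<And>k. norm (?c m k) \<le> C * norm q ^ nat k"
        using cumulant_bound[OF q wk] wk by metis
      obtain C' where C': "0 < C'" "\<And>k. norm (?c m' k) \<le> C' * norm q ^ nat k"
        using cumulant_bound[OF q wk] wk by metis
      have "norm (?c m k * ?c m' k) \<le> (C * C') * norm q ^ nat k" for k
      proof -
        have "norm (?c m k * ?c m' k) \<le> (C * norm q ^ nat k) * (C' * norm q ^ nat k)"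
          unfolding norm_mult by (intro mult_mono C C') (use C in auto)
        also have "\<dots> \<le> (C * norm q ^ nat k) * (C' * 1)"
          using q C(1) C'(1) by (intro mult_left_mono power_le_one) auto
        finally show ?thesis by (simp add: mult_ac)
      qed
      thus ?thesis using C C'
        by (intro abs_summable_summable[OF site_series_summable[OF q uv, where C = "C * C'"]]) auto
    qed
    define g where "g = (\<lambda>A k. exp (complex_of_int k * ?X) * (?c (card A) k * ?c (card (S - A)) k))"
    have gs: "g A summable_on UNIV" for A unfolding g_def by (rule sp)
    have "(\<Sum>A\<in>Pow S. infsum (g A) UNIV) = (\<Sum>\<^sub>\<infinity>k. \<Sum>A\<in>Pow S. g A k)"
      using infsum_sum_swap(1)[of "Pow S" g UNIV] gs by simp
    also have "\<dots> = (\<Sum>\<^sub>\<infinity>k. exp (of_int k * ?X) * ?c ?n k - exp (of_int k * ?X) * ?c (Suc ?n) k)"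
    proof (rule infsum_cong)
      fix k
      have "(\<Sum>A\<in>Pow S. ?c (card A) k * ?c (card (S - A)) k) =
          (\<Sum>A\<in>Pow S. ?c (card A) k * ?c (?n - card A) k)"
        using fin by (intro sum.cong refl) (auto simp: card_Diff_subset)
      also have "\<dots> = (\<Sum>m\<le>?n. of_nat (?n choose m) * (?c m k * ?c (?n - m) k))"
        by (rule sum_Pow_card[OF S, where g = "\<lambda>m. ?c m k * ?c (?n - m) k"])
      also have "\<dots> = ?c ?n k - ?c (Suc ?n) k" by (rule cumulant_square[OF wk])
      finally show "(\<Sum>A\<in>Pow S. g A k) =
          exp (of_int k * ?X) * ?c ?n k - exp (of_int k * ?X) * ?c (Suc ?n) k"
        unfolding g_def by (simp only: sum_distrib_left[symmetric] right_diff_distrib)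
    qed
    also have "\<dots> = kron q ?n w ?X - kron q (Suc ?n) w ?X"
      unfolding kron_def diff_conv_add_uminus
      by (subst infsum_add) (auto simp only: infsum_uminus summable_on_uminus intro!: s)
    finally show ?thesis unfolding g_def .
  qed
  have "(\<Sum>A\<in>Pow S. kron q (card A) w (u + ?s A) * kron q (card (S - A)) w (v + ?s (S - A))) =
      (\<Sum>A\<in>Pow S. \<Sum>\<^sub>\<infinity>k. exp (of_int k * ?X) * (?c (card A) k * ?c (card (S - A)) k)) +
      (\<Sum>A\<in>Pow S. P v (S - A)) + (\<Sum>A\<in>Pow S. P u A)"
    using piece by (simp add: sum.distrib)
  also have "(\<Sum>A\<in>Pow S. P v (S - A)) = (\<Sum>A\<in>Pow S. P v A)"
    by (rule sum.reindex_bij_witness[where i = "\<lambda>A. S - A" and j = "\<lambda>A. S - A"]) auto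
  finally have "kron q (Suc ?n) w ?X + (\<Sum>A\<in>Pow S. kron q (card A) w (u + ?s A) * kron q (card (S - A)) w (v + ?s (S - A))) =
      kron q ?n w ?X + ((\<Sum>A\<in>Pow S. P u A) + (\<Sum>A\<in>Pow S. P v A))"
    unfolding diag by simp
  also have "(\<Sum>A\<in>Pow S. P u A) + (\<Sum>A\<in>Pow S. P v A) = (\<Sum>J\<in>Pow S. kron q (card (S - J)) w ?X *
      (\<Sum>I\<in>Pow J. (-1) ^ card (J - I) * (zeta_sum q (card J) (u + ?s I) + zeta_sum q (card J) (v + ?s I))))"
    unfolding P_sum by (simp only: sum.distrib[symmetric] distrib_left[symmetric])
  finally show ?thesis .
qed

section \<open>The local recursion\<close>

lemma regularI:
  assumes "q \<noteq> 0" "\<And>k. Re w \<noteq> real_of_int k * ln (norm q)"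
  shows "regular q w"
  unfolding regular_def regular_set_def
proof (intro allI CollectI notI)
  fix k assume "exp w * q powi k = 1"
  hence "norm (exp w * q powi k) = 1" by simp
  hence "exp (Re w) * norm q powi k = 1" by (simp add: norm_mult norm_power_int)
  moreover have "norm q powi k = exp (real_of_int k * ln (norm q))"
    using assms(1) by (simp add: exp_power_int[symmetric])
  ultimately have "exp (Re w + real_of_int k * ln (norm q)) = 1" by (simp add: exp_add)
  hence "Re w = real_of_int (- k) * ln (norm q)" by simp
  thus False using assms(2) by blast
qed

text \<open>A real \<open>w\<close> is found outside the countable set of real parts that could be
  singular for it or for its translate. Both points are wanted: \<open>w\<close> for the recursion,
  \<open>w + c\<close> for dividing by the theta factor.\<close>

lemma regular_pair:
  assumes "q \<noteq> 0"
  obtains w where "regular q w" "regular q (w + c)"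
proof -
  let ?B = "range (\<lambda>k. real_of_int k * ln (norm q)) \<union> range (\<lambda>k. real_of_int k * ln (norm q) - Re c)"
  have "countable ?B" by auto
  hence "?B \<noteq> UNIV" using uncountable_UNIV_real by metis
  then obtain t where t: "t \<notin> ?B" by blast
  have "regular q (of_real t)" "regular q (of_real t + c)"
    by (rule regularI[OF assms]; use t in \<open>force simp: algebra_simps\<close>)+
  thus ?thesis by (rule that)
qed

lemma corr_empty_factor: "0 < norm q \<Longrightarrow> norm q < 1 \<Longrightarrow> corr q w {} x = jtheta q w * part_corr q {} x"
  using corr_factor[of q "{}" x w] by (simp add: admissible_def)

lemma jtheta_nonzero: "0 < norm q \<Longrightarrow> norm q < 1 \<Longrightarrow> regular q w \<Longrightarrow> jtheta q w \<noteq> 0"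
  using corr_empty_nonzero corr_empty_factor by (metis mult_eq_0_iff)

lemma part_corr_empty_nonzero:
  fixes x :: "'i \<Rightarrow> complex"
  assumes "0 < norm q" "norm q < 1"
  shows "part_corr q {} x \<noteq> 0"
proof -
  obtain w where "regular q w" using regular_pair[of q 0] assms by auto
  from corr_empty_nonzero[OF assms this, of x] show ?thesis
    using corr_empty_factor[OF assms, of w x] by auto
qed

lemma corr_cong: "(\<And>i. i \<in> N \<Longrightarrow> x i = y i) \<Longrightarrow> corr q w N x = corr q w N y"
  unfolding corr_def by (intro infsum_cong arg_cong2[where f = "(*)"] prod.cong refl) auto

lemma sum_Pow_sign:
  assumes "finite J" "J \<noteq> {}"
  shows "(\<Sum>I\<in>Pow J. (-1) ^ card (J - I)) = (0 :: complex)"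
proof -
  have "(\<Sum>I\<in>Pow J. (-1) ^ card (J - I)) = (\<Sum>I\<in>Pow J. (-1) ^ card I :: complex)"
    by (rule sum.reindex_bij_witness[where i = "\<lambda>A. J - A" and j = "\<lambda>A. J - A"]) (auto simp: double_diff)
  also have "\<dots> = (\<Sum>I\<in>Pow J. (\<Prod>i\<in>I. - 1) * (\<Prod>i\<in>J - I. 1))" by simp
  also have "\<dots> = (\<Prod>i\<in>J. - 1 + 1)" by (rule prod_add[OF assms(1), symmetric])
  also have "\<dots> = 0" using assms by (simp add: card_gt_0_iff)
  finally show ?thesis .
qed

text \<open>The variables \<open>a\<close> and \<open>b\<close> are taken out by two applications of
  \<open>corr_insert\<close>, the products of Kronecker sums are rewritten by
  \<open>kron_identity\<close>, and a third application, read backwards, restores a correlation sum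
  with a merged variable. The constants \<open>\<beta> n\<close> disappear from the alternating sums
  except for empty \<open>J\<close>, where \<open>2 * \<beta> 0 = 1\<close> supplies the single
  Kronecker sum on the right of \<open>kron_identity\<close>; this is why the value of
  \<open>\<beta> 0\<close> is prescribed.\<close>

lemma corr_recursion:
  fixes a b :: 'i
  assumes adm: "admissible q (insert a (insert b N)) x"
    and ab: "a \<noteq> b" "a \<notin> N" "b \<notin> N" and w: "regular q w"
    and Zf: "\<And>n u. Zf n u = \<beta> n + zeta_sum q n u" "\<beta> 0 = 1 / 2"
  shows "corr q w (insert a (insert b N)) x =
    (\<Sum>J\<in>Pow N. corr q w (insert a (N - J)) (x(a := x a + x b + (\<Sum>j\<in>J. x j))) *
      (\<Sum>I\<in>Pow J. (-1) ^ card (J - I) * (Zf (card J) (x a + (\<Sum>j\<in>I. x j)) + Zf (card J) (x b + (\<Sum>j\<in>I. x j)))))"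
proof -
  note q = admissible_norm_less_1[OF adm]
  have fin: "finite N" using adm by (simp add: admissible_def)
  have finS: "finite A" if "A \<subseteq> N" for A using that fin by (rule finite_subset)
  let ?s = "\<lambda>A. \<Sum>j\<in>A. x j"
  let ?k = "\<lambda>n. kron q n w" and ?H = "\<lambda>M. corr q w M x"
  have strip: "in_strip q (x a + ?s A)" "in_strip q (x b + ?s A)" "in_strip q (x a + x b + ?s A)"
    if "A \<subseteq> N" for A
  proof -
    have aA: "a \<notin> A" "b \<notin> A" using that ab by auto
    have "x a + ?s A = ?s (insert a A)" "x b + ?s A = ?s (insert b A)"
      "x a + x b + ?s A = ?s (insert a (insert b A))"
      using aA finS[OF that] ab(1) by (simp_all add: add.assoc)
    thus "in_strip q (x a + ?s A)" "in_strip q (x b + ?s A)" "in_strip q (x a + x b + ?s A)"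
      using admissible_in_strip[OF adm, of "insert a A"] admissible_in_strip[OF adm, of "insert b A"]
        admissible_in_strip[OF adm, of "insert a (insert b A)"] that by auto
  qed
  let ?X = "\<lambda>S. x a + x b + ?s S"
  define C where "C = (\<lambda>J. \<Sum>I\<in>Pow J. (-1) ^ card (J - I) * (Zf (card J) (x a + ?s I) + Zf (card J) (x b + ?s I)))"
  define C0 where "C0 = (\<lambda>J. \<Sum>I\<in>Pow J. (-1) ^ card (J - I) *
      (zeta_sum q (card J) (x a + ?s I) + zeta_sum q (card J) (x b + ?s I)))"
  have C: "C J = (if J = {} then 1 else 0) + C0 J" if "J \<subseteq> N" for J
  proof -
    have "C J = (\<Sum>I\<in>Pow J. (2 * \<beta> (card J)) * (-1) ^ card (J - I) + (-1) ^ card (J - I) *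
      (zeta_sum q (card J) (x a + ?s I) + zeta_sum q (card J) (x b + ?s I)))"
      unfolding C_def Zf by (intro sum.cong refl) (simp add: algebra_simps)
    also have "\<dots> = 2 * \<beta> (card J) * (\<Sum>I\<in>Pow J. (-1) ^ card (J - I)) + C0 J"
      unfolding C0_def by (simp add: sum.distrib sum_distrib_left)
    finally show ?thesis using sum_Pow_sign[OF finS[OF that]] Zf(2) by (cases "J = {}") auto
  qed
  have "?H (insert a (insert b N)) = (\<Sum>J\<in>Pow (insert b N). ?k (card J) (x a + ?s J) * ?H (insert b N - J))"
    by (rule corr_insert[OF adm _ w]) (use ab in auto)
  \<comment> \<open>Either \<open>b\<close> is left for a second extraction, or it belongs to the
    group taken out with \<open>a\<close> and raises the index of the Kronecker sum to
    \<open>Suc (card J)\<close>.\<close>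
  also have "\<dots> = (\<Sum>J\<in>Pow N. ?k (card J) (x a + ?s J) * ?H (insert b N - J)) +
      (\<Sum>J\<in>insert b ` Pow N. ?k (card J) (x a + ?s J) * ?H (insert b N - J))"
    unfolding Pow_insert by (rule sum.union_disjoint) (use fin ab in auto)
  also have "(\<Sum>J\<in>insert b ` Pow N. ?k (card J) (x a + ?s J) * ?H (insert b N - J)) =
      (\<Sum>J\<in>Pow N. ?k (Suc (card J)) (?X J) * ?H (N - J))"
  proof (subst sum.reindex)
    show "inj_on (insert b) (Pow N)" using ab(3) by (auto simp: inj_on_def)
    show "sum ((\<lambda>J. ?k (card J) (x a + ?s J) * ?H (insert b N - J)) \<circ> insert b) (Pow N) =
        (\<Sum>J\<in>Pow N. ?k (Suc (card J)) (?X J) * ?H (N - J))"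
    proof (intro sum.cong refl)
      fix J assume J: "J \<in> Pow N"
      hence "b \<notin> J" using ab(3) by auto
      moreover have "insert b N - insert b J = N - J" using ab(3) by auto
      ultimately show "((\<lambda>J. ?k (card J) (x a + ?s J) * ?H (insert b N - J)) \<circ> insert b) J =
          ?k (Suc (card J)) (?X J) * ?H (N - J)"
        using finS[of J] J by (simp add: add.assoc)
    qed
  qed
  also have "(\<Sum>J\<in>Pow N. ?k (card J) (x a + ?s J) * ?H (insert b N - J)) =
      (\<Sum>J\<in>Pow N. \<Sum>B\<in>Pow (N - J). ?k (card J) (x a + ?s J) * (?k (card B) (x b + ?s B) * ?H (N - J - B)))"
  proof (intro sum.cong refl)
    fix J assume J: "J \<in> Pow N"
    have "insert b N - J = insert b (N - J)" using J ab(3) by auto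
    moreover have "?H (insert b (N - J)) = (\<Sum>B\<in>Pow (N - J). ?k (card B) (x b + ?s B) * ?H (N - J - B))"
      by (rule corr_insert[OF admissible_subset[OF adm] _ w]) (use ab in auto)
    ultimately show "?k (card J) (x a + ?s J) * ?H (insert b N - J) =
      (\<Sum>B\<in>Pow (N - J). ?k (card J) (x a + ?s J) * (?k (card B) (x b + ?s B) * ?H (N - J - B)))"
      by (simp only: sum_distrib_left)
  qed
  also have "\<dots> = (\<Sum>S\<in>Pow N. \<Sum>A\<in>Pow S. ?k (card A) (x a + ?s A) *
      (?k (card (S - A)) (x b + ?s (S - A)) * ?H (N - A - (S - A))))"
    by (rule sum_Pow_Pow_Diff[OF fin])
  also have "\<dots> = (\<Sum>S\<in>Pow N. (\<Sum>A\<in>Pow S. ?k (card A) (x a + ?s A) * ?k (card (S - A)) (x b + ?s (S - A))) * ?H (N - S))"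
  proof (intro sum.cong refl)
    fix S
    have "N - A - (S - A) = N - S" if "A \<in> Pow S" for A using that by auto
    thus "(\<Sum>A\<in>Pow S. ?k (card A) (x a + ?s A) * (?k (card (S - A)) (x b + ?s (S - A)) * ?H (N - A - (S - A)))) =
        (\<Sum>A\<in>Pow S. ?k (card A) (x a + ?s A) * ?k (card (S - A)) (x b + ?s (S - A))) * ?H (N - S)"
      by (simp add: sum_distrib_right mult.assoc)
  qed
  also have "\<dots> + (\<Sum>J\<in>Pow N. ?k (Suc (card J)) (?X J) * ?H (N - J)) =
      (\<Sum>S\<in>Pow N. (\<Sum>J\<in>Pow S. C J * ?k (card (S - J)) (?X S)) * ?H (N - S))"
    unfolding sum.distrib[symmetric]
  proof (intro sum.cong refl)
    fix S assume "S \<in> Pow N"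
    hence S: "S \<subseteq> N" by simp
    have "?k (Suc (card S)) (?X S) +
        (\<Sum>A\<in>Pow S. ?k (card A) (x a + ?s A) * ?k (card (S - A)) (x b + ?s (S - A))) =
      ?k (card S) (?X S) + (\<Sum>J\<in>Pow S. ?k (card (S - J)) (?X S) * C0 J)"
      unfolding C0_def
      by (rule kron_identity[OF q w finS[OF S]]) (use S strip in auto)
    also have "?k (card S) (?X S) = (\<Sum>J\<in>Pow S. ?k (card (S - J)) (?X S) * (if J = {} then 1 else 0))"
      using finS[OF S] by (subst sum.remove[of _ "{}"]) auto
    also have "\<dots> + (\<Sum>J\<in>Pow S. ?k (card (S - J)) (?X S) * C0 J) =
        (\<Sum>J\<in>Pow S. C J * ?k (card (S - J)) (?X S))"
      unfolding sum.distrib[symmetric] using C S by (intro sum.cong refl) (auto simp: algebra_simps)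
    finally have e: "?k (Suc (card S)) (?X S) +
        (\<Sum>A\<in>Pow S. ?k (card A) (x a + ?s A) * ?k (card (S - A)) (x b + ?s (S - A))) =
        (\<Sum>J\<in>Pow S. C J * ?k (card (S - J)) (?X S))" .
    show "(\<Sum>A\<in>Pow S. ?k (card A) (x a + ?s A) * ?k (card (S - A)) (x b + ?s (S - A))) * ?H (N - S) +
        ?k (Suc (card S)) (?X S) * ?H (N - S) = (\<Sum>J\<in>Pow S. C J * ?k (card (S - J)) (?X S)) * ?H (N - S)"
      unfolding e[symmetric] by (simp add: distrib_right add.commute)
  qed
  \<comment> \<open>\<open>S\<close> splits into \<open>J\<close>, to be merged with
    \<open>a\<close> and \<open>b\<close>, and \<open>S - J\<close>, the group that an extraction of
    the merged variable takes along.\<close>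
  also have "\<dots> = (\<Sum>S\<in>Pow N. \<Sum>J\<in>Pow S. C J * (?k (card (S - J)) (x a + x b + ?s J + ?s (S - J)) * ?H (N - J - (S - J))))"
  proof (intro sum.cong refl)
    fix S assume S: "S \<in> Pow N"
    have e: "C J * (?k (card (S - J)) (x a + x b + ?s J + ?s (S - J)) * ?H (N - J - (S - J))) =
        C J * ?k (card (S - J)) (?X S) * ?H (N - S)" if J: "J \<in> Pow S" for J
    proof -
      have "N - J - (S - J) = N - S" using J by auto
      moreover have "?s S = ?s (S - J) + ?s J" using S J finS[of S] by (intro sum.subset_diff) auto
      ultimately show ?thesis by (simp add: algebra_simps)
    qed
    show "(\<Sum>J\<in>Pow S. C J * ?k (card (S - J)) (?X S)) * ?H (N - S) =
        (\<Sum>J\<in>Pow S. C J * (?k (card (S - J)) (x a + x b + ?s J + ?s (S - J)) * ?H (N - J - (S - J))))"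
      by (subst sum_distrib_right, intro sum.cong refl, rule e[symmetric])
  qed
  also have "\<dots> = (\<Sum>J\<in>Pow N. \<Sum>B\<in>Pow (N - J). C J * (?k (card B) (?X J + ?s B) * ?H (N - J - B)))"
    by (rule sum_Pow_Pow_Diff[OF fin, symmetric])
  also have "\<dots> = (\<Sum>J\<in>Pow N. corr q w (insert a (N - J)) (x(a := ?X J)) * C J)"
  proof (intro sum.cong refl)
    fix J assume J: "J \<in> Pow N"
    let ?x = "x(a := ?X J)"
    have eqs: "(\<Sum>j\<in>B. ?x j) = ?s B" if "B \<subseteq> N" for B using that ab(2) by (intro sum.cong) auto
    \<comment> \<open>Merging preserves the total of the real parts, hence admissibility.\<close>
    have "(\<Sum>i\<in>insert a (N - J). Re (?x i)) = Re (?X J) + (\<Sum>i\<in>N - J. Re (x i))"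
      using fin ab(2) by (subst sum.insert) (auto intro!: sum.cong)
    also have "\<dots> = (\<Sum>i\<in>insert a (insert b N). Re (x i))"
      using fin ab J by (simp add: sum.subset_diff[of J N "\<lambda>i. Re (x i)"])
    finally have sumeq: "(\<Sum>i\<in>insert a (N - J). Re (?x i)) = (\<Sum>i\<in>insert a (insert b N). Re (x i))" .
    have "0 < Re (?X J)" using strip(3)[of J] J by (simp add: in_strip_def)
    hence adm': "admissible q (insert a (N - J)) ?x"
      using adm unfolding admissible_def sumeq by auto
    have "corr q w (insert a (N - J)) ?x =
        (\<Sum>B\<in>Pow (N - J). ?k (card B) (?x a + (\<Sum>j\<in>B. ?x j)) * corr q w (N - J - B) ?x)"
      by (rule corr_insert[OF adm' _ w]) (use ab in auto)
    also have "\<dots> = (\<Sum>B\<in>Pow (N - J). ?k (card B) (?X J + ?s B) * ?H (N - J - B))"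
    proof (intro sum.cong refl)
      fix B assume B: "B \<in> Pow (N - J)"
      have "(\<Sum>j\<in>B. ?x j) = ?s B" by (rule eqs) (use B in auto)
      moreover have "corr q w (N - J - B) ?x = ?H (N - J - B)"
        by (rule corr_cong) (use ab in auto)
      ultimately show "?k (card B) (?x a + (\<Sum>j\<in>B. ?x j)) * corr q w (N - J - B) ?x =
          ?k (card B) (?X J + ?s B) * ?H (N - J - B)" by simp
    qed
    finally have "corr q w (insert a (N - J)) ?x =
      (\<Sum>B\<in>Pow (N - J). ?k (card B) (?X J + ?s B) * ?H (N - J - B))" .
    thus "(\<Sum>B\<in>Pow (N - J). C J * (?k (card B) (?X J + ?s B) * ?H (N - J - B))) =
        corr q w (insert a (N - J)) ?x * C J"
      by (simp add: sum_distrib_left mult.commute)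
  qed
  finally show ?thesis unfolding C_def .
qed

lemma part_corr_recursion:
  fixes a b :: 'i
  assumes adm: "admissible q (insert a (insert b N)) x"
    and ab: "a \<noteq> b" "a \<notin> N" "b \<notin> N"
    and Zf: "\<And>n u. Zf n u = \<beta> n + zeta_sum q n u" "\<beta> 0 = 1 / 2"
  shows "part_corr q (insert a (insert b N)) x =
    (\<Sum>J\<in>Pow N. part_corr q (insert a (N - J)) (x(a := x a + x b + (\<Sum>j\<in>J. x j))) *
      (\<Sum>I\<in>Pow J. (-1) ^ card (J - I) * (Zf (card J) (x a + (\<Sum>j\<in>I. x j)) + Zf (card J) (x b + (\<Sum>j\<in>I. x j)))))"
    (is "?L = (\<Sum>J\<in>Pow N. ?P J * ?C J)")
proof -
  note q = admissible_norm_less_1[OF adm]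
  have fin: "finite N" using adm by (simp add: admissible_def)
  let ?X = "\<Sum>i\<in>insert a (insert b N). x i"
  \<comment> \<open>The recursion is applied at \<open>w\<close>; regularity of
    \<open>w + ?X\<close> makes the common theta factor nonzero.\<close>
  obtain w where w: "regular q w" "regular q (w + ?X)" using regular_pair[of q ?X] q by auto
  have nz: "jtheta q (w + ?X) \<noteq> 0" by (rule jtheta_nonzero[OF q w(2)])
  have "jtheta q (w + ?X) * ?L = corr q w (insert a (insert b N)) x"
    by (rule corr_factor[OF adm, symmetric])
  also have "\<dots> = (\<Sum>J\<in>Pow N. corr q w (insert a (N - J)) (x(a := x a + x b + (\<Sum>j\<in>J. x j))) * ?C J)"
    by (rule corr_recursion[OF adm ab w(1) Zf])
  also have "\<dots> = (\<Sum>J\<in>Pow N. jtheta q (w + ?X) * (?P J * ?C J))"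
  proof (intro sum.cong refl)
    fix J assume J: "J \<in> Pow N"
    let ?x = "x(a := x a + x b + (\<Sum>j\<in>J. x j))"
    have "(\<Sum>i\<in>N - J. ?x i) = (\<Sum>i\<in>N - J. x i)" using ab(2) by (intro sum.cong) auto
    hence "(\<Sum>i\<in>insert a (N - J). ?x i) = x a + x b + (\<Sum>j\<in>J. x j) + (\<Sum>i\<in>N - J. x i)"
      using fin ab(2) by (subst sum.insert) auto
    also have "\<dots> = ?X" using fin ab J by (simp add: sum.subset_diff[of J N x] algebra_simps)
    finally have sumeq: "(\<Sum>i\<in>insert a (N - J). ?x i) = ?X" .
    have "Re (\<Sum>i\<in>insert a (N - J). ?x i) = Re ?X" by (simp only: sumeq)
    hence Resum: "(\<Sum>i\<in>insert a (N - J). Re (?x i)) = (\<Sum>i\<in>insert a (insert b N). Re (x i))"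
      by (simp only: Re_sum)
    have "0 \<le> (\<Sum>j\<in>J. Re (x j))" using adm J by (intro sum_nonneg) (auto simp: admissible_def intro: less_imp_le)
    hence "0 < Re (x a + x b + (\<Sum>j\<in>J. x j))" using adm by (auto simp: admissible_def intro: add_pos_nonneg)
    hence "admissible q (insert a (N - J)) ?x"
      using adm unfolding admissible_def Resum by auto
    from corr_factor[OF this, of w] show "corr q w (insert a (N - J)) ?x * ?C J = jtheta q (w + ?X) * (?P J * ?C J)"
      unfolding sumeq by (simp only: mult.assoc)
  qed
  also have "\<dots> = jtheta q (w + ?X) * (\<Sum>J\<in>Pow N. ?P J * ?C J)" by (rule sum_distrib_left[symmetric])
  finally show ?thesis by (rule mult_left_cancel[OF nz, THEN iffD1])
qed

lemma part_corr_single: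
  assumes q: "0 < norm q" "norm q < 1" and x: "in_strip q x" and w: "regular q w"
  shows "jtheta q (w + x) * part_corr q {()} (\<lambda>_. x) = kron q 0 w x * jtheta q w * part_corr q {} (\<lambda>_::unit. x)"
proof -
  have adm: "admissible q {()} (\<lambda>_. x)" using x q by (simp add: admissible_def in_strip_def)
  have "corr q w {()} (\<lambda>_. x) = kron q 0 w x * corr q w {} (\<lambda>_::unit. x)"
    using corr_insert[of q "()" "{}" "\<lambda>_. x" w] adm w by simp
  thus ?thesis using corr_factor[OF adm, of w] corr_empty_factor[OF q, of w "\<lambda>_::unit. x"] by simp
qed

section \<open>The theta function\<close>

text \<open>Weierstrass's theorem along the net of finite subsets: the majorant makes the partial
  sums converge uniformly on all of \<open>A\<close>, so derivatives may be taken termwise.\<close>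

lemma infsum_uniform_limit_derivs:
  fixes f :: "'i \<Rightarrow> complex \<Rightarrow> complex"
  assumes "open A" and f: "\<And>i. i \<in> I \<Longrightarrow> f i holomorphic_on A"
    and M: "\<And>i z. i \<in> I \<Longrightarrow> z \<in> A \<Longrightarrow> norm (f i z) \<le> M i" "M summable_on I"
  shows "(\<lambda>z. \<Sum>\<^sub>\<infinity>i\<in>I. f i z) holomorphic_on A"
    and "z \<in> A \<Longrightarrow> (deriv ^^ n) (\<lambda>z. \<Sum>\<^sub>\<infinity>i\<in>I. f i z) z = (\<Sum>\<^sub>\<infinity>i\<in>I. (deriv ^^ n) (f i) z)"
proof -
  let ?g = "\<lambda>z. \<Sum>\<^sub>\<infinity>i\<in>I. f i z" and ?F = "finite_subsets_at_top I"
  have lim: "uniform_limit A (\<lambda>Y z. \<Sum>i\<in>Y. f i z) ?g ?F"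
    by (rule Weierstrass_m_test_general[OF M])
  have ev: "eventually (\<lambda>Y. (\<lambda>z. \<Sum>i\<in>Y. f i z) holomorphic_on A) ?F"
    using eventually_finite_subsets_at_top_weakI
    by (rule eventually_mono) (use f in \<open>auto intro!: holomorphic_intros\<close>)
  show "?g holomorphic_on A"
    unfolding holomorphic_on_open[OF assms(1)]
  proof
    fix z assume z: "z \<in> A"
    obtain r where r: "0 < r" "cball z r \<subseteq> A" using assms(1) z by (meson open_contains_cball)
    have "uniform_limit (cball z r) (\<lambda>Y z. \<Sum>i\<in>Y. f i z) ?g ?F"
      using lim r(2) by (rule uniform_limit_on_subset)
    moreover have "eventually (\<lambda>Y. continuous_on (cball z r) (\<lambda>z. \<Sum>i\<in>Y. f i z) \<and>
        (\<lambda>z. \<Sum>i\<in>Y. f i z) holomorphic_on ball z r) ?F"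
      using ev by (rule eventually_mono)
         (use r(2) ball_subset_cball in \<open>blast intro: holomorphic_on_imp_continuous_on holomorphic_on_subset\<close>)
    ultimately have "?g holomorphic_on ball z r"
      using holomorphic_uniform_limit[of z r "\<lambda>Y z. \<Sum>i\<in>Y. f i z" ?F ?g] by auto
    thus "\<exists>f'. (?g has_field_derivative f') (at z)"
      using r(1) by (simp add: holomorphic_on_open)
  qed
  assume z: "z \<in> A"
  have "((\<lambda>Y. (deriv ^^ n) (\<lambda>z. \<Sum>i\<in>Y. f i z) z) \<longlongrightarrow> (deriv ^^ n) ?g z) ?F"
    by (rule higher_deriv_complex_uniform_limit[OF lim ev]) (use assms(1) z in auto)
  moreover have sum: "(deriv ^^ n) (\<lambda>z. \<Sum>i\<in>Y. f i z) z = (\<Sum>i\<in>Y. (deriv ^^ n) (f i) z)"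
    if "finite Y" "Y \<subseteq> I" for Y
    using that
  proof (induction Y rule: finite_induct)
    case (insert i Y)
    have "(deriv ^^ n) (\<lambda>z. f i z + (\<Sum>i\<in>Y. f i z)) z =
        (deriv ^^ n) (f i) z + (deriv ^^ n) (\<lambda>z. \<Sum>i\<in>Y. f i z) z"
      by (rule higher_deriv_add[OF _ _ assms(1) z]) (use f insert in \<open>auto intro!: holomorphic_intros\<close>)
    thus ?case using insert by simp
  qed simp
  have "eventually (\<lambda>Y. (deriv ^^ n) (\<lambda>z. \<Sum>i\<in>Y. f i z) z = (\<Sum>i\<in>Y. (deriv ^^ n) (f i) z)) ?F"
    by (rule eventually_finite_subsets_at_top_weakI) (rule sum)
  ultimately have "((\<lambda>Y. \<Sum>i\<in>Y. (deriv ^^ n) (f i) z) \<longlongrightarrow> (deriv ^^ n) ?g z) ?F"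
    using tendsto_cong by fast
  thus "(deriv ^^ n) ?g z = (\<Sum>\<^sub>\<infinity>i\<in>I. (deriv ^^ n) (f i) z)"
    by (intro infsumI[symmetric]) (simp add: has_sum_def)
qed

lemma jtheta_holomorphic:
  assumes q: "0 < norm q" "norm q < 1"
  shows "jtheta q holomorphic_on A"
proof -
  have "jtheta q holomorphic_on ball 0 R" for R
    unfolding jtheta_def[abs_def]
  proof (rule infsum_uniform_limit_derivs(1)[OF open_ball])
    \<comment> \<open>The sign of \<open>c\<close> decides which end of the interval from
      \<open>- R\<close> to \<open>R\<close> gives the larger exponential; the sum of both serves in
      either case.\<close>
    let ?M = "\<lambda>c. exp R powi c * norm q powi tri c + exp (- R) powi c * norm q powi tri c"
    show "?M summable_on UNIV" by (intro summable_on_add charge_summable q)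
    fix c :: int and z :: complex assume "z \<in> ball 0 R"
    hence "\<bar>Re z\<bar> \<le> R" using abs_Re_le_cmod[of z] by simp
    hence "real_of_int c * Re z \<le> real_of_int c * R \<or> real_of_int c * Re z \<le> real_of_int c * (- R)"
    proof (cases "0 \<le> c")
      case True
      thus ?thesis using \<open>\<bar>Re z\<bar> \<le> R\<close> by (intro disjI1 mult_left_mono) auto
    next
      case False
      thus ?thesis using \<open>\<bar>Re z\<bar> \<le> R\<close> by (intro disjI2 mult_left_mono_neg) auto
    qed
    hence "exp (real_of_int c * Re z) \<le> exp R powi c + exp (- R) powi c"
      unfolding exp_power_int by (smt (verit) exp_gt_zero exp_le_cancel_iff)
    hence "exp (real_of_int c * Re z) * norm q powi tri c \<le> (exp R powi c + exp (- R) powi c) * norm q powi tri c"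
      by (rule mult_right_mono) simp
    thus "norm ((-1) powi c * exp (of_int c * z) * q powi tri c) \<le> ?M c"
      by (simp add: norm_mult norm_power_int distrib_right)
  qed (intro holomorphic_intros)
  hence "jtheta q field_differentiable (at z)" for z
    using holomorphic_on_imp_differentiable_at[OF _ open_ball, of "jtheta q" 0 "norm z + 1" z] by simp
  thus ?thesis by (auto simp: holomorphic_on_def field_differentiable_at_within)
qed

lemma tri_reflect: "tri (- 1 - c) = tri c"
  using two_tri[of "- 1 - c"] two_tri[of c] by (simp add: algebra_simps)

text \<open>The involution \<open>c \<mapsto> - 1 - c\<close> reverses the sign of every term.\<close>

lemma jtheta_0: "jtheta q 0 = 0"
proof -
  have "jtheta q 0 = (\<Sum>\<^sub>\<infinity>c. - ((-1) powi c * exp (of_int c * 0) * q powi tri c))"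
    unfolding jtheta_def
    by (rule infsum_reindex_bij_witness[where i = "\<lambda>c. - 1 - c" and j = "\<lambda>c. - 1 - c"])
       (auto simp: tri_reflect power_int_diff power_int_minus[of _ 1] power_int_minus_left)
  also have "\<dots> = - jtheta q 0" unfolding jtheta_def by (rule infsum_uminus)
  finally show ?thesis by simp
qed

text \<open>For \<nu> = c + 1/2 the sign exponent \<open>\<lfloor>\<nu>\<rfloor>\<close> is
  \<open>c\<close>, and half the square of \<nu> is \<open>tri c + 1/8\<close>.\<close>

lemma theta_jtheta:
  assumes "q \<noteq> 0"
  shows "theta q z = exp (Ln q / 8) * exp (z / 2) * jtheta q z"
proof -
  have "theta q z = (\<Sum>\<^sub>\<infinity>c. (-1) powi c * exp (of_real (real_of_int c + 1/2) * z) *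
      q powr of_real ((real_of_int c + 1/2)\<^sup>2 / 2))"
    unfolding theta_def by (subst infsum_reindex) (auto simp: inj_on_def o_def)
  also have "\<dots> = (\<Sum>\<^sub>\<infinity>c. (exp (Ln q / 8) * exp (z / 2)) * ((-1) powi c * exp (of_int c * z) * q powi tri c))"
  proof (rule infsum_cong)
    fix c :: int
    have "2 * real_of_int (tri c) = real_of_int (2 * tri c)" by simp
    also have "\<dots> = real_of_int c * (real_of_int c + 1)" unfolding two_tri by simp
    finally have eq: "(real_of_int c + 1/2)\<^sup>2 / 2 = real_of_int (tri c) + 1/8"
      by (simp add: power2_eq_square algebra_simps)
    have "q powr of_real ((real_of_int c + 1/2)\<^sup>2 / 2) = q powr of_real (real_of_int (tri c) + 1/8)"
      by (simp only: eq)
    also have "\<dots> = exp (of_int (tri c) * Ln q + Ln q / 8)"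
      using assms by (simp add: powr_def distrib_right)
    also have "\<dots> = q powi tri c * exp (Ln q / 8)"
      using assms by (simp add: exp_add exp_power_int[symmetric])
    moreover have "exp (of_real (real_of_int c + 1/2) * z) = exp (of_int c * z) * exp (z / 2)"
      by (simp add: exp_add[symmetric] algebra_simps)
    ultimately show "(-1) powi c * exp (of_real (real_of_int c + 1/2) * z) *
        q powr of_real ((real_of_int c + 1/2)\<^sup>2 / 2) =
      (exp (Ln q / 8) * exp (z / 2)) * ((-1) powi c * exp (of_int c * z) * q powi tri c)"
      by simp
  qed
  also have "\<dots> = exp (Ln q / 8) * exp (z / 2) * jtheta q z"
    unfolding jtheta_def by (rule infsum_cmult_right')
  finally show ?thesis .
qed

lemma theta_holomorphic:
  assumes "0 < norm q" "norm q < 1"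
  shows "theta q holomorphic_on A"
proof -
  have "(\<lambda>z. exp (Ln q / 8) * exp (z / 2) * jtheta q z) holomorphic_on A"
    by (intro holomorphic_intros jtheta_holomorphic assms) auto
  moreover have "theta q z = exp (Ln q / 8) * exp (z / 2) * jtheta q z" for z
    using assms by (intro theta_jtheta) auto
  ultimately show ?thesis by (simp add: fun_eq_iff cong: holomorphic_cong)
qed

lemma theta_zero_iff: "q \<noteq> 0 \<Longrightarrow> theta q z = 0 \<longleftrightarrow> jtheta q z = 0"
  by (simp add: theta_jtheta)

lemma deriv_theta_0:
  assumes "0 < norm q" "norm q < 1"
  shows "deriv (theta q) 0 = exp (Ln q / 8) * deriv (jtheta q) 0"
proof -
  have j: "(jtheta q has_field_derivative deriv (jtheta q) 0) (at 0)"
    using holomorphic_derivI[OF jtheta_holomorphic[OF assms, of UNIV]] by simp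
  have "((\<lambda>z. exp (Ln q / 8) * exp (z / 2) * jtheta q z) has_field_derivative
      exp (Ln q / 8) * deriv (jtheta q) 0) (at 0)"
    \<comment> \<open>The derivative of \<open>exp (z / 2)\<close> is multiplied by
      \<open>jtheta q 0 = 0\<close>.\<close>
    by (rule derivative_eq_intros j refl | simp add: jtheta_0)+
  moreover have "theta q = (\<lambda>z. exp (Ln q / 8) * exp (z / 2) * jtheta q z)"
    using assms by (intro ext theta_jtheta) auto
  ultimately show ?thesis by (simp add: DERIV_imp_deriv)
qed

lemma theta_nonzero:
  assumes "0 < norm q" "norm q < 1"
  shows "\<exists>z. theta q z \<noteq> 0"
proof -
  obtain w where "regular q w" using regular_pair[of q 0] assms by auto
  hence "jtheta q w \<noteq> 0" by (rule jtheta_nonzero[OF assms])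
  thus ?thesis using assms theta_zero_iff[of q w] by auto
qed

section \<open>Expansion of the Kronecker sum at zero\<close>

lemma regular_near_0:
  assumes q: "0 < norm q" "norm q < 1"
  shows "eventually (regular q) (at 0)"
proof -
  \<comment> \<open>The bound 1 excludes the nonzero multiples of 2 pi i, which are the poles of the
    site 0; the bound \<open>- ln (norm q)\<close> excludes the poles of all other sites.\<close>
  have "regular q w" if w: "w \<noteq> 0" "norm w < min 1 (- ln (norm q))" for w
    unfolding regular_def regular_set_def
  proof (intro allI CollectI notI)
    fix k assume eq: "exp w * q powi k = 1"
    show False
    proof (cases "k = 0")
      case True
      have "exp w = 1" using eq True by simp
      then obtain n :: int where n: "Re w = 0" "Im w = of_int (2 * n) * pi" by (auto simp: exp_eq_1)
      have "\<bar>Im w\<bar> < 1" using abs_Im_le_cmod[of w] w by simp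
      moreover have "1 \<le> \<bar>of_int (2 * n) * pi\<bar>" if "n \<noteq> 0"
      proof -
        have "1 * 1 \<le> \<bar>real_of_int (2 * n)\<bar> * pi" by (rule mult_mono) (use that pi_ge_two in auto)
        thus ?thesis by (simp add: abs_mult)
      qed
      ultimately have "n = 0" using n by force
      thus False using n w by (simp add: complex_eq_iff)
    next
      case False
      have "norm (exp w * q powi k) = 1" using eq by simp
      hence "exp (Re w) * norm q powi k = 1" by (simp add: norm_mult norm_power_int)
      moreover have "norm q powi k = exp (real_of_int k * ln (norm q))"
        using q by (simp add: exp_power_int[symmetric])
      ultimately have "exp (Re w + real_of_int k * ln (norm q)) = 1" by (simp add: exp_add)
      hence "\<bar>Re w\<bar> = \<bar>real_of_int k\<bar> * \<bar>ln (norm q)\<bar>" by (simp add: abs_mult[symmetric])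
      moreover have "1 * \<bar>ln (norm q)\<bar> \<le> \<bar>real_of_int k\<bar> * \<bar>ln (norm q)\<bar>"
        using False by (intro mult_right_mono) auto
      ultimately have "\<bar>ln (norm q)\<bar> \<le> \<bar>Re w\<bar>" by simp
      thus False using abs_Re_le_cmod[of w] w q by simp
    qed
  qed
  moreover have "0 < min 1 (- ln (norm q))" using q by simp
  ultimately show ?thesis unfolding eventually_at by (metis dist_0_norm dist_commute)
qed

definition kron_tail :: "complex \<Rightarrow> complex \<Rightarrow> complex \<Rightarrow> complex" where
  "kron_tail q x w = (\<Sum>\<^sub>\<infinity>k\<in>- {0}. exp (of_int k * x) * occupation q k w)"

text \<open>A version of \<open>occupation_bound\<close> that is uniform near 0, as the majorant for
  \<open>kron_tail\<close> requires.\<close>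

lemma occupation_near_0:
  assumes q: "0 < norm q" "norm q < 1"
  obtains r C where "0 < r" "0 < C" "\<And>k w. k \<noteq> 0 \<Longrightarrow> w \<in> ball 0 r \<Longrightarrow> w \<in> regular_set q k"
    "\<And>k w. k \<noteq> 0 \<Longrightarrow> w \<in> ball 0 r \<Longrightarrow> norm (occupation q k w) \<le> C * norm q ^ nat k"
proof -
  \<comment> \<open>With half of \<open>- ln (norm q)\<close> the number \<open>s\<close> is the
    square root of \<open>norm q\<close>, and \<open>exp w * q powi k\<close> has norm at most
    \<open>s\<close> for positive \<open>k\<close> and at least \<open>1 / s\<close> for negative
    \<open>k\<close>.\<close>
  define r where "r = - ln (norm q) / 2"
  define s where "s = exp r * norm q"
  have r: "0 < r" using q by (simp add: r_def)
  have "s = exp (- r)"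
  proof -
    have "norm q = exp (- 2 * r)" using q by (simp add: r_def)
    thus ?thesis unfolding s_def by (simp add: exp_add[symmetric])
  qed
  hence s: "0 < s" "s < 1" using r by auto
  have E: "norm (exp w) \<le> exp r" "norm (exp (- w)) \<le> exp r" if "w \<in> ball 0 r" for w :: complex
    using that abs_Re_le_cmod[of w] by auto
  have pos: "norm (exp w * q powi k) \<le> s" "norm (exp w * q powi k) \<le> exp r * norm q ^ nat k"
    if "0 < k" "w \<in> ball 0 r" for k w
  proof -
    have "norm (exp w * q powi k) = norm (exp w) * norm q ^ nat k"
      using that by (simp add: norm_mult norm_power power_int_def)
    also have "\<dots> \<le> exp r * norm q ^ nat k" by (intro mult_right_mono E that) simp
    finally show 1: "norm (exp w * q powi k) \<le> exp r * norm q ^ nat k" .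
    have "norm q ^ nat k \<le> norm q ^ 1" using q that by (intro power_decreasing) auto
    hence "exp r * norm q ^ nat k \<le> s" unfolding s_def by simp
    thus "norm (exp w * q powi k) \<le> s" using 1 by simp
  qed
  have neg: "1 / s \<le> norm (exp w * q powi k)" if "k < 0" "w \<in> ball 0 r" for k w
  proof -
    have "inverse (exp w * q powi k) = exp (- w) * q powi (- k)"
      by (simp add: exp_minus power_int_minus)
    hence "norm (inverse (exp w * q powi k)) \<le> s" using pos(1)[of "- k" "- w"] that by simp
    hence "inverse (norm (exp w * q powi k)) \<le> s" by (simp only: norm_inverse)
    moreover have "0 < norm (exp w * q powi k)" using q by simp
    ultimately show ?thesis using s by (simp add: inverse_eq_divide divide_le_eq mult.commute)
  qed
  have reg: "w \<in> regular_set q k" if "k \<noteq> 0" "w \<in> ball 0 r" for k w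
    using pos(1)[of k w] neg[of k w] that s
    by (cases "0 < k") (auto simp: regular_set_def divide_le_eq)
  have bound: "norm (occupation q k w) \<le> (exp r + 1) / (1 - s) * norm q ^ nat k" if "k \<noteq> 0" "w \<in> ball 0 r" for k w
  proof (cases "0 < k")
    case True
    let ?E = "exp w * q powi k"
    have "1 - s \<le> norm (?E - 1)"
      using pos(1)[OF True that(2)] norm_triangle_ineq2[of 1 ?E] by (simp add: norm_minus_commute)
    hence "norm ?E / norm (?E - 1) \<le> (exp r * norm q ^ nat k) / (1 - s)"
      using pos(2)[OF True that(2)] s by (intro frac_le) auto
    also have "\<dots> \<le> (exp r + 1) / (1 - s) * norm q ^ nat k"
      using s by (simp add: divide_right_mono mult_right_mono)
    finally show ?thesis by (simp add: occupation_def norm_divide)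
  next
    case False
    let ?E = "exp w * q powi k"
    have k: "k < 0" using False that by simp
    have E1: "1 / s \<le> norm ?E" by (rule neg[OF k that(2)])
    have E0: "0 < norm ?E" using E1 s by (metis divide_pos_pos less_le_trans zero_less_one)
    have "norm (1 / ?E) \<le> s" using E1 E0 s by (simp add: norm_divide field_simps)
    hence "1 - s \<le> norm (1 - 1 / ?E)" using norm_triangle_ineq2[of 1 "1 / ?E"] by simp
    moreover have "occupation q k w = 1 / (1 - 1 / ?E)"
      using E0 by (simp add: occupation_def divide_simps)
    ultimately have "norm (occupation q k w) \<le> 1 / (1 - s)"
      using s by (simp add: norm_divide frac_le)
    also have "\<dots> \<le> (exp r + 1) / (1 - s)" using s by (intro divide_right_mono) auto
    finally show ?thesis using k by simp
  qed
  show ?thesis by (rule that[of r "(exp r + 1) / (1 - s)"]) (use r s reg bound in \<open>auto intro!: divide_pos_pos add_pos_pos\<close>)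
qed

lemma kron_tail:
  assumes q: "0 < norm q" "norm q < 1" and x: "in_strip q x"
  obtains r where "0 < r" "kron_tail q x holomorphic_on ball 0 r"
    "\<And>n. (deriv ^^ n) (kron_tail q x) 0 = zeta_sum q n x"
proof -
  obtain r C where r: "0 < r" "0 < C" "\<And>k w. k \<noteq> 0 \<Longrightarrow> w \<in> ball 0 r \<Longrightarrow> w \<in> regular_set q k"
    "\<And>k w. k \<noteq> 0 \<Longrightarrow> w \<in> ball 0 r \<Longrightarrow> norm (occupation q k w) \<le> C * norm q ^ nat k"
    using occupation_near_0[OF q] by metis
  let ?f = "\<lambda>k w. exp (complex_of_int k * x) * occupation q k w"
  let ?M = "\<lambda>k. norm (exp (complex_of_int k * x) * (of_real (C * norm q ^ nat k)))"
  have M: "?M summable_on - {0}"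
    by (rule site_series_summable[OF q x, where C = C]) (use r(2) in \<open>auto simp: norm_mult norm_power\<close>)
  have hol: "occupation q k holomorphic_on ball 0 r" if "k \<noteq> 0" for k
    using occupation_holomorphic by (rule holomorphic_on_subset) (use r(3) that in auto)
  have le: "norm (?f k w) \<le> ?M k" if "k \<in> - {0}" "w \<in> ball 0 r" for k w
    using r(4)[of k w] r(2) that by (simp add: norm_mult norm_power mult_left_mono abs_mult)
  have f: "?f k holomorphic_on ball 0 r" if "k \<in> - {0}" for k
    using that by (intro holomorphic_intros hol) auto
  note lims = infsum_uniform_limit_derivs[of "ball 0 r" "- {0}" ?f ?M, OF open_ball f le M]
  have "kron_tail q x holomorphic_on ball 0 r"
    using lims(1) by (simp add: kron_tail_def[abs_def])
  moreover have "(deriv ^^ n) (kron_tail q x) 0 = zeta_sum q n x" for n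
  proof -
    have "(deriv ^^ n) (kron_tail q x) 0 = (\<Sum>\<^sub>\<infinity>k\<in>- {0}. (deriv ^^ n) (?f k) 0)"
      using lims(2)[of 0 n] r(1) by (simp add: kron_tail_def[abs_def])
    also have "\<dots> = zeta_sum q n x"
      unfolding zeta_sum_def cumulant_def
      by (rule infsum_cong, rule higher_deriv_cmult[OF hol _ open_ball]) (use r(1) in auto)
    finally show ?thesis .
  qed
  ultimately show ?thesis using that r(1) by blast
qed

lemma kron_split:
  assumes q: "0 < norm q" "norm q < 1" and x: "in_strip q x" and w: "regular q w"
  shows "kron q 0 w x = occupation q 0 w + kron_tail q x w"
proof -
  have "UNIV = insert (0::int) (- {0})" by auto
  hence "kron q 0 w x = (\<Sum>\<^sub>\<infinity>k\<in>insert 0 (- {0}). exp (of_int k * x) * cumulant q 0 k w)"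
    by (simp add: kron_def)
  also have "\<dots> = exp (of_int 0 * x) * cumulant q 0 0 w + (\<Sum>\<^sub>\<infinity>k\<in>- {0}. exp (of_int k * x) * cumulant q 0 k w)"
    by (rule infsum_insert) (use abs_summable_summable[OF kron_summable[OF q w x]] in auto)
  finally show ?thesis by (simp add: cumulant_0 kron_tail_def)
qed

lemma exp_minus_1_over: "((\<lambda>w::complex. (exp w - 1) / w) \<longlongrightarrow> 1) (at 0)"
proof -
  have "((\<lambda>w::complex. exp w) has_field_derivative 1) (at 0)" by (rule derivative_eq_intros refl | simp)+
  thus ?thesis by (simp add: has_field_derivative_iff)
qed

text \<open>The limit of \<open>part_corr_single\<close> as \<open>w\<close> tends to 0: the pole of
  the site 0 meets the zero of \<open>jtheta\<close>, which leaves the derivative, and the tail,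
  continuous at 0, is annihilated.\<close>

lemma part_corr_one:
  assumes q: "0 < norm q" "norm q < 1" and x: "in_strip q x"
  shows "jtheta q x * part_corr q {()} (\<lambda>_. x) = deriv (jtheta q) 0 * part_corr q {} (\<lambda>_::unit. x)"
proof -
  let ?j = "jtheta q" and ?G = "part_corr q {()} (\<lambda>_. x)" and ?P = "part_corr q {} (\<lambda>_::unit. x)"
  obtain r where r: "0 < r" "kron_tail q x holomorphic_on ball 0 r" using kron_tail[OF q x] by metis
  have tail: "(kron_tail q x \<longlongrightarrow> kron_tail q x 0) (at 0)"
    using holomorphic_on_imp_continuous_on[OF r(2)] r(1)
    by (simp add: continuous_on_eq_continuous_at isCont_def)
  have jc: "isCont ?j z" for z
    using holomorphic_on_imp_continuous_on[OF jtheta_holomorphic[OF q, of UNIV]]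
    by (simp add: continuous_on_eq_continuous_at)
  have j0: "(?j \<longlongrightarrow> 0) (at 0)" using jc[of 0] by (simp add: isCont_def jtheta_0)
  have "(?j has_field_derivative deriv ?j 0) (at 0)"
    using holomorphic_derivI[OF jtheta_holomorphic[OF q, of UNIV]] by simp
  hence jd: "((\<lambda>w. ?j w / w) \<longlongrightarrow> deriv ?j 0) (at 0)"
    by (simp add: has_field_derivative_iff jtheta_0)
  have "((\<lambda>w. exp w * (?j w / w) / ((exp w - 1) / w) + kron_tail q x w * ?j w) \<longlongrightarrow>
      exp 0 * deriv ?j 0 / 1 + kron_tail q x 0 * 0) (at 0)"
    by (intro tendsto_intros jd exp_minus_1_over tail j0) auto
  hence rhs: "((\<lambda>w. (exp w * (?j w / w) / ((exp w - 1) / w) + kron_tail q x w * ?j w) * ?P) \<longlongrightarrow> deriv ?j 0 * ?P) (at 0)"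
    by (intro tendsto_mult_right) simp
  have "((\<lambda>w. ?j (w + x)) \<longlongrightarrow> ?j (0 + x)) (at 0)"
    by (rule isCont_tendsto_compose[OF jc]) (intro tendsto_intros)
  hence lhs: "((\<lambda>w. ?j (w + x) * ?G) \<longlongrightarrow> ?j x * ?G) (at 0)"
    by (intro tendsto_mult_right) simp
  have "eventually (\<lambda>w. (exp w * (?j w / w) / ((exp w - 1) / w) + kron_tail q x w * ?j w) * ?P = ?j (w + x) * ?G) (at 0)"
    using regular_near_0[OF q] eventually_at_ball'[OF zero_less_one, of 0 UNIV]
  proof eventually_elim
    case (elim w)
    have "w \<in> regular_set q 0" using elim by (simp add: regular_def)
    hence "exp w - 1 \<noteq> 0" by (simp add: regular_set_def)
    hence "exp w * (?j w / w) / ((exp w - 1) / w) = occupation q 0 w * ?j w"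
      using elim by (simp add: occupation_def)
    thus ?case using part_corr_single[OF q x] kron_split[OF q x] elim by (simp add: distrib_right)
  qed
  from tendsto_cong[OF this] rhs have "((\<lambda>w. ?j (w + x) * ?G) \<longlongrightarrow> deriv ?j 0 * ?P) (at 0)" by simp
  with lhs show ?thesis by (intro tendsto_unique[OF _ lhs]) auto
qed

text \<open>The one-variable sum is eliminated between \<open>part_corr_single\<close> and
  \<open>part_corr_one\<close>.\<close>

lemma theta_quotient:
  assumes q: "0 < norm q" "norm q < 1" and x: "in_strip q x" "theta q x \<noteq> 0" and v: "regular q v"
  shows "theta q (x + v) * deriv (theta q) 0 / (theta q x * theta q v) = kron q 0 v x"
proof -
  have q0: "q \<noteq> 0" using q by auto
  let ?j = "jtheta q" and ?G = "part_corr q {()} (\<lambda>_. x)" and ?P = "part_corr q {} (\<lambda>_::unit. x)"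
  have nz: "?j x \<noteq> 0" "?j v \<noteq> 0" "?P \<noteq> 0"
    using x(2) theta_zero_iff[OF q0] jtheta_nonzero[OF q v] part_corr_empty_nonzero[OF q] by auto
  have 1: "?j x * ?G = deriv ?j 0 * ?P" by (rule part_corr_one[OF q x(1)])
  have 2: "?j (v + x) * ?G = kron q 0 v x * ?j v * ?P" by (rule part_corr_single[OF q x(1) v])
  have "?j (v + x) * deriv ?j 0 * ?P = ?j (v + x) * ?G * ?j x" using 1 by (simp add: mult_ac)
  also have "\<dots> = kron q 0 v x * ?j v * ?P * ?j x" by (simp only: 2)
  finally have "?j (x + v) * deriv ?j 0 = kron q 0 v x * (?j x * ?j v)"
    using nz(3) by (simp add: add.commute mult_ac)
  hence "?j (x + v) * deriv ?j 0 / (?j x * ?j v) = kron q 0 v x" using nz by (simp add: field_simps)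
  moreover have "theta q (x + v) * deriv (theta q) 0 / (theta q x * theta q v) =
      ?j (x + v) * deriv ?j 0 / (?j x * ?j v)"
  proof -
    have "exp ((x + v) / 2) = exp (x / 2) * exp (v / 2)" by (simp add: exp_add[symmetric] add_divide_distrib)
    thus ?thesis by (simp add: theta_jtheta[OF q0] deriv_theta_0[OF q])
  qed
  ultimately show ?thesis by simp
qed

text \<open>The contribution of the site 0 to the expansion at \<open>w = 0\<close>. These are the
  numbers B_{l+1} / (l+1), with Bernoulli numbers in the convention B_1 = 1/2.\<close>

definition occupation_coeff :: "nat \<Rightarrow> complex" where
  "occupation_coeff l = fact l * fls_nth (fps_to_fls (fps_exp 1) / (fps_to_fls (fps_exp 1) - 1)) (int l)"

lemma occupation_laurent:
  "occupation q 0 has_laurent_expansion fps_to_fls (fps_exp 1) / (fps_to_fls (fps_exp 1) - 1)"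
proof -
  have e: "exp has_laurent_expansion fps_to_fls (fps_exp (1::complex))"
    using has_laurent_expansion_fps[OF has_fps_expansion_exp1] by simp
  have "(\<lambda>w. exp w / (exp w - 1)) has_laurent_expansion fps_to_fls (fps_exp 1) / (fps_to_fls (fps_exp 1) - 1)"
    by (intro laurent_expansion_intros e)
  thus ?thesis by (simp add: occupation_def[abs_def])
qed

lemma occupation_coeff_0: "occupation_coeff 0 = 1 / 2"
proof -
  define E :: "complex fls" where "E = fps_to_fls (fps_exp 1)"
  define f where "f = E / (E - 1)"
  \<comment> \<open>The series of (exp w - 1) / w. The value sought is the coefficient of w in exp w
    divided by \<open>g\<close>, that is 1 - 1/2.\<close>
  define g :: "complex fps" where "g = fps_shift 1 (fps_exp 1 - 1)"
  have g: "fps_exp 1 - 1 = fps_X * g"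
    unfolding g_def by (rule fps_ext) (auto simp: fps_X_mult_nth)
  have g0: "fps_nth g 0 = 1" "fps_nth g 1 = 1 / 2"
    by (simp_all add: g_def fact_numeral numeral_2_eq_2)
  hence gn: "g \<noteq> 0" by auto
  have "E - 1 = fls_X * fps_to_fls g"
    unfolding E_def by (metis fps_to_fls_minus fps_one_to_fls g fls_times_fps_to_fls fps_X_to_fls)
  moreover have "E = fls_X_inv * fps_to_fls (fps_exp 1 * inverse g) * (fls_X * fps_to_fls g)"
  proof -
    have "fps_exp 1 * inverse g * g = (fps_exp 1 :: complex fps)"
      using inverse_mult_eq_1[of g] g0 by (simp add: mult.assoc)
    hence "E = fps_to_fls (fps_exp 1 * inverse g) * fps_to_fls g"
      unfolding E_def by (metis fls_times_fps_to_fls)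
    moreover have "fls_X_inv * fls_X = (1 :: complex fls)" by (simp add: fls_X_inv_times_conv_shift)
    hence "fls_X_inv * a * (fls_X * b) = a * b" for a b :: "complex fls"
      by (metis mult.assoc mult.commute mult_1)
    ultimately show ?thesis by (simp only:)
  qed
  moreover have "fls_X * fps_to_fls g \<noteq> 0" using gn by simp
  ultimately have "f = fls_X_inv * fps_to_fls (fps_exp 1 * inverse g)"
    unfolding f_def by (metis nonzero_mult_div_cancel_right)
  hence "fls_nth f 0 = fps_nth (fps_exp 1 * inverse g) 1" by (simp add: fls_X_inv_times_conv_shift)
  also have "\<dots> = 1 / 2"
    using g0 by (simp add: fps_mult_nth fps_inverse_def)
  finally show ?thesis by (simp add: occupation_coeff_def f_def E_def)
qed

text \<open>Near 0 the theta quotient is the occupation number of the site 0, which carries the pole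
  in \<open>v\<close>, plus a holomorphic tail whose derivatives at 0 are the values of
  \<open>zeta_sum\<close>.\<close>

lemma Z_in_strip:
  assumes q: "0 < norm q" "norm q < 1" and x: "in_strip q x" "theta q x \<noteq> 0"
  shows "Z q l x = occupation_coeff l + zeta_sum q l x"
proof -
  obtain r where r: "0 < r" "kron_tail q x holomorphic_on ball 0 r"
    "\<And>n. (deriv ^^ n) (kron_tail q x) 0 = zeta_sum q n x"
    using kron_tail[OF q x(1)] by metis
  have "kron_tail q x analytic_on {0}"
    using r(1,2) by (metis analytic_at centre_in_ball open_ball)
  hence "kron_tail q x has_laurent_expansion fps_to_fls (fps_expansion (kron_tail q x) 0)"
    using analytic_at_imp_has_fps_expansion_0 has_laurent_expansion_fps by blast
  hence L: "(\<lambda>v. occupation q 0 v + kron_tail q x v) has_laurent_expansion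
      fps_to_fls (fps_exp 1) / (fps_to_fls (fps_exp 1) - 1) + fps_to_fls (fps_expansion (kron_tail q x) 0)"
    by (intro laurent_expansion_intros occupation_laurent)
  have ev: "eventually (\<lambda>v. theta q (x + v) * deriv (theta q) 0 / (theta q x * theta q v) =
      occupation q 0 v + kron_tail q x v) (at 0)"
    using regular_near_0[OF q]
    by eventually_elim (use theta_quotient[OF q x] kron_split[OF q x(1)] in simp)
  have "(\<lambda>v. theta q (x + v) * deriv (theta q) 0 / (theta q x * theta q v)) has_laurent_expansion
      fps_to_fls (fps_exp 1) / (fps_to_fls (fps_exp 1) - 1) + fps_to_fls (fps_expansion (kron_tail q x) 0)"
    by (subst has_laurent_expansion_cong[OF ev refl]) (rule L)
  from laurent_expansion_0_eqI[OF this]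
  show ?thesis
    by (simp add: Z_def occupation_coeff_def distrib_left fps_expansion_def r(3))
qed

lemma Z_quotient:
  assumes q: "0 < norm q" "norm q < 1"
  obtains g where "g holomorphic_on UNIV" "\<And>x. theta q x \<noteq> 0 \<Longrightarrow> Z q l x = g x / theta q x"
proof -
  let ?t = "theta q"
  have hol: "?t holomorphic_on A" for A by (rule theta_holomorphic[OF q])
  have an: "?t analytic_on A" for A using hol[of UNIV] analytic_on_open analytic_on_subset by blast
  have tL: "?t has_laurent_expansion fps_to_fls (fps_expansion ?t 0)"
    using analytic_at_imp_has_fps_expansion_0[OF an] has_laurent_expansion_fps by blast
  define E where "E = fls_const (deriv ?t 0) / fps_to_fls (fps_expansion ?t 0)"
  have E: "(\<lambda>v. deriv ?t 0 / ?t v) has_laurent_expansion E"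
    unfolding E_def by (intro laurent_expansion_intros tL)
  define e where "e = fls_base_factor_to_fps E"
  define s where "s = - fls_subdegree E"
  have Ee: "E = fls_shift s (fps_to_fls e)"
    unfolding e_def s_def by (rule fls_conv_base_factor_to_fps_shift_subdegree)
  \<comment> \<open>\<open>E\<close> is the power series \<open>e\<close> divided by the power
    \<open>s\<close> of the variable, so coefficient \<open>l\<close> of the product is coefficient
    \<open>l + s\<close> of a product of power series, and 0 if that index is negative.\<close>
  define g where "g = (\<lambda>x. if int l + s < 0 then 0 else
      fact l * (\<Sum>i\<le>nat (int l + s). (deriv ^^ i) ?t x / fact i * fps_nth e (nat (int l + s) - i)))"
  have "g holomorphic_on UNIV"
    unfolding g_def by (cases "int l + s < 0") (auto intro!: holomorphic_intros holomorphic_higher_deriv hol)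
  moreover have "Z q l x = g x / ?t x" if nz: "?t x \<noteq> 0" for x
  proof -
    let ?T = "fps_to_fls (fps_expansion ?t x)"
    have T: "(\<lambda>v. ?t (x + v)) has_laurent_expansion ?T"
      using analytic_at_imp_has_fps_expansion[OF an] has_laurent_expansion_fps by blast
    have "(\<lambda>v. inverse (?t x) * (?t (x + v) * (deriv ?t 0 / ?t v))) has_laurent_expansion
        fls_const (inverse (?t x)) * (?T * E)"
      by (intro laurent_expansion_intros T E)
    moreover have "inverse (?t x) * (?t (x + v) * (deriv ?t 0 / ?t v)) = ?t (x + v) * deriv ?t 0 / (?t x * ?t v)" for v
      by (simp add: divide_inverse mult_ac)
    ultimately have "(\<lambda>v. ?t (x + v) * deriv ?t 0 / (?t x * ?t v)) has_laurent_expansion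
        fls_const (inverse (?t x)) * (?T * E)" by simp
    from laurent_expansion_0_eqI[OF this]
    have "Z q l x = fact l * (inverse (?t x) * fls_nth (?T * E) (int l))" by (simp add: Z_def)
    also have "?T * E = fls_shift s (fps_to_fls (fps_expansion ?t x * e))"
      unfolding Ee by (simp add: fls_times_fps_to_fls fls_shifted_times_simps)
    also have "fact l * (inverse (?t x) * fls_nth (fls_shift s (fps_to_fls (fps_expansion ?t x * e))) (int l)) = g x / ?t x"
      by (simp add: g_def fps_mult_nth atMost_atLeast0 fps_expansion_def inverse_eq_divide)
    finally show ?thesis .
  qed
  ultimately show ?thesis using that by blast
qed

section \<open>The generating series of the shifted power sums\<close>

lemma fps_half: "f / 2 = fps_const (1/2) * (f :: complex fps)"
proof -
  have "inverse (2 :: complex fps) = fps_const (1/2)"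
  proof (rule fps_inverse_unique)
    show "2 * fps_const (1/2) = (1 :: complex fps)"
      by (rule fps_ext) (simp add: numeral_fps_const fps_mult_left_const_nth)
  qed
  thus ?thesis by (simp add: fps_divide_unit mult.commute)
qed

text \<open>The formal quotient in the definition of \<open>beta\<close> becomes the expansion of an
  actual function; the value 1 at 0 fills the removable singularity.\<close>

lemma beta_has_fps_expansion:
  "(\<lambda>x. if x = 0 then 1 else x / (exp (x / 2) - exp (- (x / 2)))) has_fps_expansion Abs_fps beta"
proof -
  define S :: "complex fps" where "S = (fps_exp (1/2) - fps_exp (- (1/2))) / 2"
  have S01: "fps_nth S 0 = 0" "fps_nth S 1 = 1/2" by (simp_all add: S_def fps_half)
  hence S0: "S \<noteq> 0" by auto
  have subS: "subdegree S = 1" by (rule subdegreeI) (use S01 in auto)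
  have subX: "subdegree (fps_X / 2 :: complex fps) = 1" by (rule subdegreeI) (auto simp: fps_half)
  have e: "(\<lambda>x. exp (c * x)) has_fps_expansion fps_exp c" for c :: complex
    by (rule has_fps_expansion_exp)
  have sh: "(\<lambda>x. 1/2 * (exp (1/2 * x) - exp (- (1/2) * x))) has_fps_expansion S"
    unfolding S_def fps_half by (intro fps_expansion_intros e)
  have num: "(\<lambda>x :: complex. 1/2 * x) has_fps_expansion (fps_X / 2)"
    unfolding fps_half by (intro fps_expansion_intros)
  have "(\<lambda>x. if x = 0 then 1 else (1/2 * x) / (1/2 * (exp (1/2 * x) - exp (- (1/2) * x)))) has_fps_expansion (fps_X / 2 / S)"
    by (rule has_fps_expansion_divide[OF num sh]) (use S0 subS subX S01 in \<open>auto simp: fps_half mult.commute\<close>)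
  moreover have "fps_X / 2 / S = Abs_fps beta" by (rule fps_ext) (simp add: beta_def S_def)
  moreover have "(1/2 * x) / (1/2 * (exp (1/2 * x) - exp (- (1/2) * x))) = x / (exp (x / 2) - exp (- (x / 2)))"
    for x :: complex by simp
  ultimately show ?thesis by (simp only:)
qed

lemma beta_0: "beta 0 = 1"
  using has_fps_expansion_imp_0_eq_fps_nth_0[OF beta_has_fps_expansion] by simp

lemma beta_expansion:
  obtains r where "0 < r" "(\<lambda>k. norm (beta k) * r ^ k) summable_on UNIV"
    "\<And>x. x \<noteq> 0 \<Longrightarrow> norm x \<le> r \<Longrightarrow> ((\<lambda>k. beta k * x ^ k) has_sum (x / (exp (x / 2) - exp (- (x / 2))))) UNIV"
proof -
  define G where "G = Abs_fps beta"
  have bG: "beta k = fps_nth G k" for k by (simp add: G_def)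
  let ?b = "\<lambda>x :: complex. if x = 0 then 1 else x / (exp (x / 2) - exp (- (x / 2)))"
  have R: "0 < fps_conv_radius G" and ev: "eventually (\<lambda>x. eval_fps G x = ?b x) (nhds 0)"
    using beta_has_fps_expansion by (auto simp: has_fps_expansion_def G_def)
  obtain d where d: "0 < d" "\<And>x. norm x < d \<Longrightarrow> eval_fps G x = ?b x"
    using ev by (auto simp: eventually_nhds_metric dist_norm)
  obtain R' where R': "0 < R'" "ereal R' < fps_conv_radius G"
    using R ereal_dense2[of 0 "fps_conv_radius G"] by (auto simp: zero_ereal_def)
  define r where "r = min (d / 2) R'"
  have r: "0 < r" "r < d" "r \<le> R'" using d R' by (auto simp: r_def)
  have ns: "summable (\<lambda>k. norm (beta k * x ^ k))" if "norm x \<le> r" for x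
  proof -
    have "ereal (norm x) \<le> ereal R'" using that r(3) by simp
    hence "ereal (norm x) < fps_conv_radius G" using R'(2) by (rule le_less_trans)
    thus ?thesis unfolding bG by (rule norm_summable_fps)
  qed
  show ?thesis
  proof (rule that[OF r(1)])
    have "summable (\<lambda>k. norm (beta k) * r ^ k)"
      using ns[of "of_real r"] r(1) by (simp add: norm_mult norm_power)
    thus "(\<lambda>k. norm (beta k) * r ^ k) summable_on UNIV"
      using r(1) by (intro summable_nonneg_imp_summable_on) auto
    fix x :: complex assume x: "x \<noteq> 0" "norm x \<le> r"
    have "((\<lambda>k. beta k * x ^ k) has_sum (\<Sum>k. beta k * x ^ k)) UNIV"
      using ns[OF x(2)] by (intro norm_summable_imp_has_sum) (auto intro: summable_norm_cancel summable_sums)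
    moreover have "(\<Sum>k. beta k * x ^ k) = x / (exp (x / 2) - exp (- (x / 2)))"
      using d(2)[of x] x r(2) by (simp add: eval_fps_def bG)
    ultimately show "((\<lambda>k. beta k * x ^ k) has_sum (x / (exp (x / 2) - exp (- (x / 2))))) UNIV" by simp
  qed
qed

section \<open>The generating series of a single partition\<close>

lemma part_zero_beyond_size:
  assumes lam: "lam \<in> partitions" and i: "psize lam \<le> i"
  shows "lam i = 0"
proof (rule ccontr)
  assume nz: "lam i \<noteq> 0"
  have am: "antimono lam" and fin: "finite {i. lam i \<noteq> 0}" using lam by (auto simp: partitions_def)
  have pos: "lam j \<ge> 1" if "j \<le> i" for j using antimonoD[OF am that] nz by simp
  have "i + 1 = (\<Sum>j\<le>i. 1)" by simp
  also have "\<dots> \<le> (\<Sum>j\<le>i. lam j)" by (rule sum_mono) (use pos in auto)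
  also have "\<dots> \<le> psize lam" unfolding psize_def
  proof (rule sum_mono2[OF fin])
    show "{..i} \<subseteq> {i. lam i \<noteq> 0}"
    proof
      fix j assume "j \<in> {..i}"
      thus "j \<in> {i. lam i \<noteq> 0}" using pos[of j] by auto
    qed
  qed simp
  finally show False using i by simp
qed

definition shifted :: "(nat \<Rightarrow> nat) \<Rightarrow> nat \<Rightarrow> complex" where
  "shifted lam i = of_nat (lam i) - of_nat i - 1/2"

text \<open>The size bounds the number of nonzero parts, which gives a finite range of summation
  independent of \<open>k\<close>. The case \<open>k = 0\<close> is covered by
  \<open>beta 0 = 1\<close>.\<close>

lemma Q_finite:
  assumes lam: "lam \<in> partitions"
  shows "Q k lam = beta k + (if k = 0 then 0 else
    (\<Sum>i<psize lam. shifted lam i ^ (k - 1) - (- of_nat i - 1/2) ^ (k - 1)) / fact (k - 1))"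
proof -
  have "(\<Sum>i. shifted lam i ^ (k - 1) - (- of_nat i - 1/2) ^ (k - 1)) =
      (\<Sum>i<psize lam. shifted lam i ^ (k - 1) - (- of_nat i - 1/2) ^ (k - 1))"
    by (rule suminf_finite) (use part_zero_beyond_size[OF lam] in \<open>auto simp: shifted_def not_less\<close>)
  thus ?thesis by (simp add: Q_def shifted_def beta_0)
qed

lemma norm_shifted:
  assumes lam: "lam \<in> partitions" and i: "i < psize lam"
  shows "norm (shifted lam i) \<le> real (psize lam)" "norm (- of_nat i - 1/2 :: complex) \<le> real (psize lam)"
proof -
  have l: "lam i \<le> psize lam" by (rule psize_ge_part[OF lam])
  have "shifted lam i = of_real (real (lam i) - real i - 1/2)" by (simp add: shifted_def)
  hence "norm (shifted lam i) = \<bar>real (lam i) - real i - 1/2\<bar>" by (simp only: norm_of_real)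
  thus "norm (shifted lam i) \<le> real (psize lam)" using l i by linarith
  have "- of_nat i - 1/2 = (of_real (- real i - 1/2) :: complex)" by simp
  hence "norm (- of_nat i - 1/2 :: complex) = \<bar>- real i - 1/2\<bar>" by (simp only: norm_of_real)
  thus "norm (- of_nat i - 1/2 :: complex) \<le> real (psize lam)" using i by linarith
qed

lemma has_sum_finite_sum:
  fixes f :: "'i \<Rightarrow> 'b \<Rightarrow> 'c :: {topological_comm_monoid_add}"
  assumes "\<And>i. i \<in> I \<Longrightarrow> (f i has_sum S i) A"
  shows "((\<lambda>k. \<Sum>i\<in>I. f i k) has_sum (\<Sum>i\<in>I. S i)) A"
  using assms by (induction I rule: infinite_finite_induct) (auto intro!: has_sum_add)

lemma exp_has_sum_shifted:
  fixes a x :: complex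
  shows "((\<lambda>k. if k = 0 then 0 else a ^ (k - 1) / fact (k - 1) * x ^ k) has_sum (x * exp (a * x))) UNIV"
    and "((\<lambda>k. norm (if k = 0 then 0 else a ^ (k - 1) / fact (k - 1) * x ^ k)) has_sum (norm x * exp (norm a * norm x))) UNIV"
proof -
  have s: "((\<lambda>k. (y ^ k / fact k)) has_sum exp y) UNIV" for y :: "'b :: {banach, real_normed_field}"
    using exp_converges[of y] summable_norm_exp[of y]
    by (intro norm_summable_imp_has_sum) (simp_all add: scaleR_conv_of_real divide_inverse mult.commute)
  have re: "((\<lambda>k. if k = 0 then 0 else f (k - 1)) has_sum S) UNIV"
    if "(f has_sum S) UNIV" for f :: "nat \<Rightarrow> 'b :: {banach, real_normed_field}" and S
  proof -
    have "((\<lambda>k. if k = 0 then 0 else f (k - 1)) has_sum S) (range Suc)"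
      by (subst has_sum_reindex) (use that in \<open>auto simp: o_def\<close>)
    moreover have "((\<lambda>k. if k = 0 then 0 else f (k - 1)) has_sum S) (range Suc) \<longleftrightarrow>
        ((\<lambda>k. if k = 0 then 0 else f (k - 1)) has_sum S) UNIV"
      by (rule has_sum_cong_neutral) (auto simp: image_iff gr0_conv_Suc)
    ultimately show ?thesis by simp
  qed
  have "((\<lambda>k. if k = 0 then 0 else x * ((a * x) ^ (k - 1) / fact (k - 1))) has_sum (x * exp (a * x))) UNIV"
    by (rule re[OF has_sum_cmult_right[OF s]])
  moreover have "(if k = 0 then 0 else x * ((a * x) ^ (k - 1) / fact (k - 1))) =
      (if k = 0 then 0 else a ^ (k - 1) / fact (k - 1) * x ^ k)" for k
    by (cases k) (auto simp: power_mult_distrib)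
  ultimately show "((\<lambda>k. if k = 0 then 0 else a ^ (k - 1) / fact (k - 1) * x ^ k) has_sum (x * exp (a * x))) UNIV"
    by simp
  have "((\<lambda>k. if k = 0 then 0 else norm x * ((norm a * norm x) ^ (k - 1) / fact (k - 1))) has_sum (norm x * exp (norm a * norm x))) UNIV"
    by (rule re[OF has_sum_cmult_right[OF s]])
  moreover have "(if k = 0 then 0 else norm x * ((norm a * norm x) ^ (k - 1) / fact (k - 1))) =
      norm (if k = 0 then 0 else a ^ (k - 1) / fact (k - 1) * x ^ k)" for k
    by (cases k) (auto simp: power_mult_distrib norm_mult norm_divide norm_power)
  ultimately show "((\<lambda>k. norm (if k = 0 then 0 else a ^ (k - 1) / fact (k - 1) * x ^ k)) has_sum (norm x * exp (norm a * norm x))) UNIV"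
    by simp
qed

text \<open>The generating series of the \<open>Q k lam\<close> multiplied by \<open>x\<close>, so
  that it is a power series.\<close>

definition Qser :: "(nat \<Rightarrow> nat) \<Rightarrow> complex \<Rightarrow> complex" where
  "Qser lam x = (\<Sum>\<^sub>\<infinity>k. Q k lam * x ^ k)"

text \<open>The terms subtracted in \<open>Q\<close>, summed over all parts, form a geometric series
  with value 1 / (exp (x / 2) - exp (- (x / 2))) for positive real part of \<open>x\<close>; the
  series of \<open>beta\<close>, divided by \<open>x\<close>, is exactly this function. So the
  regularization in \<open>Q\<close> restores the full sum over the parts. The radius and the
  constant do not depend on \<open>lam\<close>.\<close>

lemma Qser:
  obtains r C where "0 < r" "0 < C"
    "\<And>lam x \<rho>. lam \<in> partitions \<Longrightarrow> norm x \<le> \<rho> \<Longrightarrow> \<rho> \<le> r \<Longrightarrow> (\<lambda>k. norm (Q k lam * x ^ k)) summable_on UNIV"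
    "\<And>lam x \<rho>. lam \<in> partitions \<Longrightarrow> norm x \<le> \<rho> \<Longrightarrow> \<rho> \<le> r \<Longrightarrow>
       infsum (\<lambda>k. norm (Q k lam * x ^ k)) UNIV \<le> C * exp (2 * \<rho>) ^ psize lam"
    "\<And>lam x. lam \<in> partitions \<Longrightarrow> norm x \<le> r \<Longrightarrow> 0 < Re x \<Longrightarrow> Qser lam x = x * exp (- (x / 2)) * part_sum x lam"
proof -
  obtain r where r: "0 < r" "(\<lambda>k. norm (beta k) * r ^ k) summable_on UNIV"
    "\<And>x. x \<noteq> 0 \<Longrightarrow> norm x \<le> r \<Longrightarrow> ((\<lambda>k. beta k * x ^ k) has_sum (x / (exp (x / 2) - exp (- (x / 2))))) UNIV"
    using beta_expansion by blast
  define B where "B = infsum (\<lambda>k. norm (beta k) * r ^ k) UNIV"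
  have B0: "0 \<le> B" using r(1) by (simp add: B_def infsum_nonneg)
  let ?t = "\<lambda>a x k. if k = (0::nat) then 0 else a ^ (k - 1) / fact (k - 1) * x ^ k :: complex"
  let ?T = "\<lambda>lam x k. \<Sum>i<psize lam. ?t (shifted lam i) x k - ?t (- of_nat i - 1/2) x k"
  have Qx: "Q k lam * x ^ k = beta k * x ^ k + ?T lam x k" if "lam \<in> partitions" for k lam x
    unfolding Q_finite[OF that] by (cases k) (auto simp: algebra_simps sum_distrib_left sum_divide_distrib sum_distrib_right diff_divide_distrib intro!: sum.cong)
  have bs: "(\<lambda>k. norm (beta k * x ^ k)) summable_on UNIV" "infsum (\<lambda>k. norm (beta k * x ^ k)) UNIV \<le> B"
    if "norm x \<le> r" for x
  proof -
    have le: "norm (beta k * x ^ k) \<le> norm (beta k) * r ^ k" for k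
      unfolding norm_mult norm_power using that by (intro mult_left_mono power_mono) auto
    show s: "(\<lambda>k. norm (beta k * x ^ k)) summable_on UNIV"
      by (rule summable_on_comparison_test[OF r(2)]) (use le in auto)
    show "infsum (\<lambda>k. norm (beta k * x ^ k)) UNIV \<le> B"
      unfolding B_def by (rule infsum_mono[OF s r(2)]) (use le in auto)
  qed
  let ?N = "\<lambda>lam x k. norm (beta k * x ^ k) + (\<Sum>i<psize lam. norm (?t (shifted lam i) x k) + norm (?t (- of_nat i - 1/2) x k))"
  have N: "(?N lam x has_sum (infsum (\<lambda>k. norm (beta k * x ^ k)) UNIV +
      (\<Sum>i<psize lam. norm x * exp (norm (shifted lam i) * norm x) + norm x * exp (norm (- of_nat i - 1/2 :: complex) * norm x)))) UNIV"
    if "norm x \<le> r" for lam x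
  proof (rule has_sum_add)
    show "((\<lambda>k. \<Sum>i<psize lam. norm (?t (shifted lam i) x k) + norm (?t (- of_nat i - 1/2) x k)) has_sum
      (\<Sum>i<psize lam. norm x * exp (norm (shifted lam i) * norm x) + norm x * exp (norm (- of_nat i - 1/2 :: complex) * norm x))) UNIV"
      by (intro has_sum_finite_sum has_sum_add exp_has_sum_shifted)
  qed (use bs(1)[OF that] in \<open>simp add: has_sum_infsum\<close>)
  have le: "norm (Q k lam * x ^ k) \<le> ?N lam x k" if "lam \<in> partitions" for k lam x
  proof -
    have "norm (?T lam x k) \<le> (\<Sum>i<psize lam. norm (?t (shifted lam i) x k) + norm (?t (- of_nat i - 1/2) x k))"
      by (rule sum_norm_le) (rule norm_triangle_ineq4)
    thus ?thesis unfolding Qx[OF that] using norm_triangle_ineq[of "beta k * x ^ k" "?T lam x k"] by linarith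
  qed
  have s: "(\<lambda>k. norm (Q k lam * x ^ k)) summable_on UNIV" if "lam \<in> partitions" "norm x \<le> r" for lam x
    by (rule summable_on_comparison_test[OF has_sum_imp_summable[OF N[OF that(2)]]]) (use le that in auto)
  show ?thesis
  proof (rule that[of r "B + 2"])
    show "(\<lambda>k. norm (Q k lam * x ^ k)) summable_on UNIV" if "lam \<in> partitions" "norm x \<le> \<rho>" "\<rho> \<le> r" for lam x \<rho>
      using s that by simp
    show "infsum (\<lambda>k. norm (Q k lam * x ^ k)) UNIV \<le> (B + 2) * exp (2 * \<rho>) ^ psize lam"
      if lam: "lam \<in> partitions" and x: "norm x \<le> \<rho>" "\<rho> \<le> r" for lam x \<rho>
    proof -
      let ?L = "real (psize lam)"
      have xr: "norm x \<le> r" and \<rho>: "0 \<le> \<rho>" using x norm_ge_zero[of x] by linarith+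
      have "infsum (\<lambda>k. norm (Q k lam * x ^ k)) UNIV \<le> infsum (?N lam x) UNIV"
        by (rule infsum_mono[OF s[OF lam xr] has_sum_imp_summable[OF N[OF xr]] le[OF lam]])
      also have "\<dots> = infsum (\<lambda>k. norm (beta k * x ^ k)) UNIV +
        (\<Sum>i<psize lam. norm x * exp (norm (shifted lam i) * norm x) + norm x * exp (norm (- of_nat i - 1/2 :: complex) * norm x))"
        by (rule infsumI[OF N[OF xr]])
      also have "\<dots> \<le> B + (\<Sum>i<psize lam. 2 * (\<rho> * exp (?L * \<rho>)))"
      proof (intro add_mono bs(2) xr sum_mono)
        fix i assume "i \<in> {..<psize lam}"
        hence i: "i < psize lam" by simp
        have "norm x * exp (a * norm x) \<le> \<rho> * exp (?L * \<rho>)" if "0 \<le> a" "a \<le> ?L" for a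
        proof -
          have "a * norm x \<le> ?L * \<rho>" by (intro mult_mono) (use that x in auto)
          thus ?thesis by (intro mult_mono) (use x \<rho> in auto)
        qed
        from this[of "norm (shifted lam i)"] this[of "norm (- of_nat i - 1/2 :: complex)"]
        show "norm x * exp (norm (shifted lam i) * norm x) + norm x * exp (norm (- of_nat i - 1/2 :: complex) * norm x)
            \<le> 2 * (\<rho> * exp (?L * \<rho>))"
          using norm_shifted[OF lam i] by simp
      qed
      also have "\<dots> = B + 2 * ((?L * \<rho>) * exp (?L * \<rho>))" by simp
      \<comment> \<open>One factor \<open>exp (?L * \<rho>)\<close> bounds the exponentials, a
        second one pays for the number of summands.\<close>
      also have "\<dots> \<le> B * exp (2 * \<rho>) ^ psize lam + 2 * exp (2 * \<rho>) ^ psize lam"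
      proof (intro add_mono)
        have "(?L * \<rho>) * exp (?L * \<rho>) \<le> exp (?L * \<rho>) * exp (?L * \<rho>)"
        proof (rule mult_right_mono)
          show "?L * \<rho> \<le> exp (?L * \<rho>)" using exp_ge_add_one_self[of "?L * \<rho>"] by linarith
        qed simp
        also have "\<dots> = exp (?L * (2 * \<rho>))" by (simp add: exp_add[symmetric])
        finally show "2 * ((?L * \<rho>) * exp (?L * \<rho>)) \<le> 2 * exp (2 * \<rho>) ^ psize lam"
          by (simp only: exp_of_nat_mult)
        have "1 \<le> exp (2 * \<rho>) ^ psize lam" using \<rho> by (intro one_le_power) simp
        from mult_left_mono[OF this B0] show "B \<le> B * exp (2 * \<rho>) ^ psize lam" by simp
      qed
      finally show ?thesis by (simp add: distrib_right)
    qed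
    show "Qser lam x = x * exp (- (x / 2)) * part_sum x lam"
      if lam: "lam \<in> partitions" and x: "norm x \<le> r" "0 < Re x" for lam x
    proof -
      let ?n = "psize lam"
      have x0: "x \<noteq> 0" using x by auto
      note b = r(3)[OF x0 x(1)]
      have "((\<lambda>k. ?T lam x k) has_sum (\<Sum>i<?n. x * exp (shifted lam i * x) - x * exp ((- of_nat i - 1/2) * x))) UNIV"
        unfolding diff_conv_add_uminus
        by (intro has_sum_finite_sum has_sum_add has_sum_uminusI exp_has_sum_shifted)
      from has_sum_add[OF b this] have Qs: "Qser lam x = x / (exp (x / 2) - exp (- (x / 2))) +
          (\<Sum>i<?n. x * exp (shifted lam i * x) - x * exp ((- of_nat i - 1/2) * x))"
        unfolding Qser_def Qx[OF lam] by (rule infsumI)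
      let ?f = "\<lambda>i. exp (of_int (int (lam i) - int i) * x)" and ?g = "\<lambda>i. exp (- x) ^ i"
      have ex: "norm (exp (- x)) < 1" using x by simp
      have geo: "(?g has_sum (1 / (1 - exp (- x)))) UNIV"
        using geometric_sums[OF ex] ex
        by (intro norm_summable_imp_has_sum) (auto simp: norm_power intro!: summable_geometric)
      have fg: "?f i = ?g i" if "i \<notin> {..<?n}" for i
        using part_zero_beyond_size[OF lam, of i] that by (simp add: exp_of_nat_mult[symmetric])
      have "((\<lambda>i. ?f i - ?g i) has_sum (\<Sum>i<?n. ?f i - ?g i)) UNIV"
        by (rule has_sum_finite_neutralI[of "{..<?n}"]) (use fg in auto)
      from has_sum_add[OF this geo] have "part_sum x lam = (\<Sum>i<?n. ?f i - ?g i) + 1 / (1 - exp (- x))"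
        unfolding part_sum_def by (intro infsumI) simp
      hence "x * exp (- (x / 2)) * part_sum x lam =
          (\<Sum>i<?n. x * exp (- (x / 2)) * (?f i - ?g i)) + x * (exp (- (x / 2)) / (1 - exp (- x)))"
        by (simp add: distrib_left sum_distrib_left)
      also have "(\<Sum>i<?n. x * exp (- (x / 2)) * (?f i - ?g i)) =
          (\<Sum>i<?n. x * exp (shifted lam i * x) - x * exp ((- of_nat i - 1/2) * x))"
      proof (intro sum.cong refl)
        fix i
        have "exp (- (x / 2)) * ?f i = exp (shifted lam i * x)"
          by (simp add: exp_add[symmetric] shifted_def algebra_simps)
        moreover have "exp (- (x / 2)) * ?g i = exp ((- of_nat i - 1/2) * x)"
          by (simp add: exp_add[symmetric] exp_of_nat_mult[symmetric] algebra_simps)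
        ultimately show "x * exp (- (x / 2)) * (?f i - ?g i) = x * exp (shifted lam i * x) - x * exp ((- of_nat i - 1/2) * x)"
          by (simp add: right_diff_distrib mult.assoc)
      qed
      also have "exp (- (x / 2)) / (1 - exp (- x)) = 1 / (exp (x / 2) - exp (- (x / 2)))"
      proof -
        have e: "exp (- x) = exp (- (x / 2)) * exp (- (x / 2))" "exp (x / 2) * exp (- (x / 2)) = 1"
          by (simp_all add: exp_add[symmetric])
        have "1 - exp (- x) = exp (- (x / 2)) * (exp (x / 2) - exp (- (x / 2)))"
          using e by (simp add: right_diff_distrib mult.commute)
        thus ?thesis by simp
      qed
      finally show ?thesis unfolding Qs by simp
    qed
  qed (use r B0 in auto)
qed

section \<open>The series of the correlator\<close>

lemma multi_index_product:
  fixes a :: "nat \<Rightarrow> nat \<Rightarrow> 'c :: {real_normed_field, banach}"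
  assumes "\<And>i. i < m \<Longrightarrow> (\<lambda>n. norm (a i n)) summable_on UNIV"
  shows "(\<lambda>k. norm (\<Prod>i<m. a i (k i))) summable_on {k. \<forall>i\<ge>m. k i = 0} \<and>
    infsum (\<lambda>k. \<Prod>i<m. a i (k i)) {k :: nat \<Rightarrow> nat. \<forall>i\<ge>m. k i = 0} = (\<Prod>i<m. infsum (a i) UNIV)"
  using assms
proof (induction m)
  case 0
  have "{k :: nat \<Rightarrow> nat. \<forall>i\<ge>0. k i = 0} = {\<lambda>_. 0}" by auto
  thus ?case by simp
next
  case (Suc m)
  let ?K = "\<lambda>m. {k :: nat \<Rightarrow> nat. \<forall>i\<ge>m. k i = 0}"
  let ?p = "\<lambda>m k. \<Prod>i<m. a i (k i)"
  let ?h = "\<lambda>(k, n). ?p m k * a m n"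
  have IH: "(\<lambda>k. norm (?p m k)) summable_on ?K m" "infsum (?p m) (?K m) = (\<Prod>i<m. infsum (a i) UNIV)"
    using Suc by auto
  have eq: "?h (k(m := 0), k m) = ?p (Suc m) k" for k by simp
  have sn: "(\<lambda>z. norm (?h z)) summable_on (?K m \<times> UNIV)"
    using summable_on_product[OF IH(1) Suc.prems[of m]] by (simp add: case_prod_unfold norm_mult)
  have "(\<lambda>k. norm (?p (Suc m) k)) summable_on ?K (Suc m) \<longleftrightarrow> (\<lambda>z. norm (?h z)) summable_on (?K m \<times> UNIV)"
    by (rule summable_on_reindex_bij_witness[where i = "\<lambda>(k, n). k(m := n)" and j = "\<lambda>k. (k(m := 0), k m)"])
       (auto simp: fun_eq_iff)
  moreover have "infsum (?p (Suc m)) (?K (Suc m)) = infsum ?h (?K m \<times> UNIV)"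
    by (rule infsum_reindex_bij_witness[where i = "\<lambda>(k, n). k(m := n)" and j = "\<lambda>k. (k(m := 0), k m)"])
       (auto simp: fun_eq_iff)
  moreover have "infsum ?h (?K m \<times> UNIV) = (\<Prod>i<Suc m. infsum (a i) UNIV)"
  proof -
    have "?h summable_on (?K m \<times> UNIV)" using sn by (rule abs_summable_summable)
    from infsum_Sigma_banach[OF this]
    have "infsum ?h (?K m \<times> UNIV) = (\<Sum>\<^sub>\<infinity>k\<in>?K m. \<Sum>\<^sub>\<infinity>n. ?p m k * a m n)" by simp
    also have "\<dots> = (\<Sum>\<^sub>\<infinity>k\<in>?K m. ?p m k) * infsum (a m) UNIV"
      by (simp only: infsum_cmult_right' infsum_cmult_left')
    finally show ?thesis using IH(2) by simp
  qed
  ultimately show ?case using sn by simp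
qed

definition Qcorr :: "complex \<Rightarrow> nat \<Rightarrow> (nat \<Rightarrow> complex) \<Rightarrow> complex" where
  "Qcorr q m x = (\<Sum>\<^sub>\<infinity>lam\<in>partitions. q ^ psize lam * (\<Prod>i<m. Qser lam (x i)))"

text \<open>One majorant over the partitions serves both the holomorphy and the exchange of the sums
  over partitions and exponents. Dividing by the product of the variables lowers every exponent by 1
  and produces the Laurent series of the correlator.\<close>

lemma Qcorr:
  assumes q: "0 < norm q" "norm q < 1"
  obtains R where "0 < R"
    "holomorphic_several m {x \<in> complex_space m. \<forall>i<m. norm (x i) < R} (Qcorr q m)"
    "\<And>x. x \<in> complex_space m \<Longrightarrow> (\<And>i. i < m \<Longrightarrow> 0 < norm (x i) \<and> norm (x i) < R) \<Longrightarrow>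
      ((\<lambda>k. qbracket q (\<lambda>lam. \<Prod>i<m. Q (k i) lam) * (\<Prod>i<m. x i powi (int (k i) - 1))) has_sum
         (Qcorr q m x / (\<Prod>i<m. x i) / (\<Sum>\<^sub>\<infinity>lam\<in>partitions. q ^ psize lam))) {k :: nat \<Rightarrow> nat. \<forall>i\<ge>m. k i = 0}"
    "\<And>x. (\<And>i. i < m \<Longrightarrow> 0 < Re (x i) \<and> norm (x i) < R) \<Longrightarrow>
      Qcorr q m x / (\<Prod>i<m. x i) = exp (- (\<Sum>i<m. x i) / 2) * part_corr q {..<m} x"
proof -
  obtain r C where r: "0 < r" "0 < C"
    "\<And>lam x \<rho>. lam \<in> partitions \<Longrightarrow> norm x \<le> \<rho> \<Longrightarrow> \<rho> \<le> r \<Longrightarrow> (\<lambda>k. norm (Q k lam * x ^ k)) summable_on UNIV"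
    "\<And>lam x \<rho>. lam \<in> partitions \<Longrightarrow> norm x \<le> \<rho> \<Longrightarrow> \<rho> \<le> r \<Longrightarrow>
       infsum (\<lambda>k. norm (Q k lam * x ^ k)) UNIV \<le> C * exp (2 * \<rho>) ^ psize lam"
    "\<And>lam x. lam \<in> partitions \<Longrightarrow> norm x \<le> r \<Longrightarrow> 0 < Re x \<Longrightarrow> Qser lam x = x * exp (- (x / 2)) * part_sum x lam"
    using Qser by blast
  \<comment> \<open>Each variable costs a factor \<open>exp (2 * R)\<close> per box, so
    \<open>real m * (2 * R)\<close> has to stay below \<open>- ln (norm q)\<close>.\<close>
  define R where "R = min r (- ln (norm q) / (4 * (real m + 1)))"
  have lnq: "ln (norm q) < 0" using q by simp
  have R: "0 < R" "R \<le> r" using r(1) lnq by (auto simp: R_def divide_neg_pos)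
  have q2: "norm q * exp (2 * R) ^ m < 1"
  proof -
    have "R \<le> - ln (norm q) / (4 * (real m + 1))" unfolding R_def by (rule min.cobounded2)
    moreover have "0 < 4 * (real m + 1)" by simp
    ultimately have "R * (4 * (real m + 1)) \<le> - ln (norm q)" using pos_le_divide_eq by blast
    moreover have "real m * (2 * R) < R * (4 * (real m + 1))" using R(1) by (simp add: algebra_simps add_pos_nonneg)
    ultimately have "real m * (2 * R) + ln (norm q) < 0" by linarith
    hence "exp (real m * (2 * R) + ln (norm q)) < 1" by simp
    moreover have "exp (real m * (2 * R) + ln (norm q)) = norm q * exp (2 * R) ^ m"
      using q unfolding exp_add exp_of_nat_mult by simp
    ultimately show ?thesis by simp
  qed
  let ?a = "\<lambda>lam x k. Q k lam * x ^ k"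
  let ?M = "\<lambda>lam. C ^ m * (norm q * exp (2 * R) ^ m) ^ psize lam"
  have M: "?M summable_on partitions"
    by (intro summable_on_cmult_right psize_summable q2) (use q in auto)
  have as: "(\<lambda>k. norm (?a lam x k)) summable_on UNIV" if "lam \<in> partitions" "norm x \<le> R" for lam x
    using r(3)[OF that R(2)] .
  have bound: "norm q ^ psize lam * (\<Prod>i<m. infsum (\<lambda>k. norm (?a lam (x i) k)) UNIV) \<le> ?M lam"
    if "lam \<in> partitions" "\<And>i. i < m \<Longrightarrow> norm (x i) \<le> R" for lam x
  proof -
    have "(\<Prod>i<m. infsum (\<lambda>k. norm (?a lam (x i) k)) UNIV) \<le> (\<Prod>i<m. C * exp (2 * R) ^ psize lam)"
      by (rule prod_mono) (use r(4)[OF that(1) that(2) R(2)] in \<open>auto simp: infsum_nonneg\<close>)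
    hence "norm q ^ psize lam * (\<Prod>i<m. infsum (\<lambda>k. norm (?a lam (x i) k)) UNIV) \<le>
        norm q ^ psize lam * (C * exp (2 * R) ^ psize lam) ^ m"
      by (intro mult_left_mono) auto
    also have "\<dots> = ?M lam" by (simp add: power_mult_distrib power_mult[symmetric] mult.commute)
    finally show ?thesis .
  qed
  have Qb: "norm (Qser lam x) \<le> infsum (\<lambda>k. norm (?a lam x k)) UNIV" if "lam \<in> partitions" "norm x \<le> R" for lam x
    unfolding Qser_def by (rule norm_infsum_bound[OF as[OF that]])
  have Mb: "norm (q ^ psize lam * (\<Prod>i<m. Qser lam (x i))) \<le> ?M lam"
    if "lam \<in> partitions" "\<And>i. i < m \<Longrightarrow> norm (x i) \<le> R" for lam x
  proof -
    have "(\<Prod>i<m. norm (Qser lam (x i))) \<le> (\<Prod>i<m. infsum (\<lambda>k. norm (?a lam (x i) k)) UNIV)"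
      by (rule prod_mono) (use Qb that in auto)
    hence "norm (q ^ psize lam * (\<Prod>i<m. Qser lam (x i))) \<le>
        norm q ^ psize lam * (\<Prod>i<m. infsum (\<lambda>k. norm (?a lam (x i) k)) UNIV)"
      by (simp add: norm_mult norm_power prod_norm[symmetric] mult_left_mono)
    also have "\<dots> \<le> ?M lam" by (rule bound[OF that])
    finally show ?thesis .
  qed
  have Qhol: "Qser lam holomorphic_on ball 0 R" if "lam \<in> partitions" for lam
    unfolding Qser_def[abs_def]
  proof (rule infsum_uniform_limit_derivs(1)[OF open_ball])
    show "(\<lambda>k. norm (?a lam (of_real R) k)) summable_on UNIV" by (rule as[OF that]) (use R in auto)
    show "norm (?a lam z k) \<le> norm (?a lam (of_real R) k)" if "z \<in> ball 0 R" for k z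
      using that R(1) by (auto simp: norm_mult norm_power intro!: mult_left_mono power_mono)
  qed (intro holomorphic_intros)
  let ?D = "{x \<in> complex_space m. \<forall>i<m. norm (x i) < R}"
  have "continuous_on ?D (Qcorr q m)"
    unfolding Qcorr_def[abs_def]
  proof (rule uniform_limit_theorem[OF _ Weierstrass_m_test_general[OF _ M]])
    show "eventually (\<lambda>Y. continuous_on ?D (\<lambda>x. \<Sum>lam\<in>Y. q ^ psize lam * (\<Prod>i<m. Qser lam (x i))))
        (finite_subsets_at_top partitions)"
    proof (rule eventually_finite_subsets_at_top_weakI)
      fix Y assume Y: "Y \<subseteq> partitions"
      show "continuous_on ?D (\<lambda>x. \<Sum>lam\<in>Y. q ^ psize lam * (\<Prod>i<m. Qser lam (x i)))"
      proof (intro continuous_intros)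
        fix lam i assume "lam \<in> Y" "i \<in> {..<m}"
        thus "continuous_on ?D (\<lambda>x. Qser lam (x i))"
          using Y by (intro continuous_on_compose2[OF holomorphic_on_imp_continuous_on[OF Qhol]]
              continuous_on_subset[OF continuous_on_product_coordinates]) auto
      qed
    qed
    show "norm (q ^ psize lam * (\<Prod>i<m. Qser lam (x i))) \<le> ?M lam" if "lam \<in> partitions" "x \<in> ?D" for lam x
      by (rule Mb) (use that in \<open>auto intro: less_imp_le\<close>)
  qed simp
  moreover have "(\<lambda>w. Qcorr q m (x(j := w))) field_differentiable at (x j)" if x: "x \<in> ?D" and j: "j < m" for x j
  proof -
    have "(\<lambda>w. Qcorr q m (x(j := w))) holomorphic_on ball 0 R"
      unfolding Qcorr_def
    proof (rule infsum_uniform_limit_derivs(1)[OF open_ball _ _ M])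
      fix lam assume lam: "lam \<in> partitions"
      show "(\<lambda>w. q ^ psize lam * (\<Prod>i<m. Qser lam ((x(j := w)) i))) holomorphic_on ball 0 R"
      proof (intro holomorphic_intros)
        fix i
        show "(\<lambda>w. Qser lam ((x(j := w)) i)) holomorphic_on ball 0 R"
          using Qhol[OF lam] by (cases "i = j") auto
      qed
      show "norm (q ^ psize lam * (\<Prod>i<m. Qser lam ((x(j := w)) i))) \<le> ?M lam" if "w \<in> ball 0 R" for w
        by (rule Mb[OF lam]) (use x that in \<open>auto intro: less_imp_le\<close>)
    qed
    thus ?thesis
      by (rule holomorphic_on_imp_differentiable_at) (use x j in auto)
  qed
  ultimately have hol: "holomorphic_several m ?D (Qcorr q m)" by (simp add: holomorphic_several_def)
  let ?K = "{k :: nat \<Rightarrow> nat. \<forall>i\<ge>m. k i = 0}"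
  let ?P = "\<Sum>\<^sub>\<infinity>lam\<in>partitions. q ^ psize lam"
  have series: "((\<lambda>k. qbracket q (\<lambda>lam. \<Prod>i<m. Q (k i) lam) * (\<Prod>i<m. x i powi (int (k i) - 1))) has_sum
      (Qcorr q m x / (\<Prod>i<m. x i) / ?P)) ?K"
    if x: "\<And>i. i < m \<Longrightarrow> 0 < norm (x i) \<and> norm (x i) < R" for x
  proof -
    have xR: "norm (x i) \<le> R" if "i < m" for i using x[OF that] by simp
    let ?g = "\<lambda>(lam, k). q ^ psize lam * (\<Prod>i<m. ?a lam (x i) (k i))"
    have mi: "(\<lambda>k. norm (\<Prod>i<m. ?a lam (x i) (k i))) summable_on ?K"
      "infsum (\<lambda>k. \<Prod>i<m. ?a lam (x i) (k i)) ?K = (\<Prod>i<m. Qser lam (x i))"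
      if "lam \<in> partitions" for lam
      using multi_index_product[of m "\<lambda>i. ?a lam (x i)"] as[OF that xR] unfolding Qser_def by auto
    have min: "infsum (\<lambda>k. norm (\<Prod>i<m. ?a lam (x i) (k i))) ?K = (\<Prod>i<m. infsum (\<lambda>k. norm (?a lam (x i) k)) UNIV)"
      if "lam \<in> partitions" for lam
      using multi_index_product[of m "\<lambda>i k. norm (?a lam (x i) k)"] as[OF that xR] by (simp add: prod_norm)
    have "(\<lambda>z. norm (?g z)) summable_on (partitions \<times> ?K)"
    proof (subst Infinite_Sum.abs_summable_on_Sigma_iff, intro conjI ballI)
      fix lam assume "lam \<in> partitions"
      thus "(\<lambda>k. norm (?g (lam, k))) summable_on ?K"
        using summable_on_cmult_right[OF mi(1), of lam "norm q ^ psize lam"] by (simp add: norm_mult norm_power)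
    next
      show "(\<lambda>lam. norm (infsum (\<lambda>k. norm (?g (lam, k))) ?K)) summable_on partitions"
      proof (rule summable_on_comparison_test[OF M])
        fix lam assume lam: "lam \<in> partitions"
        have "infsum (\<lambda>k. norm (?g (lam, k))) ?K = norm q ^ psize lam * infsum (\<lambda>k. norm (\<Prod>i<m. ?a lam (x i) (k i))) ?K"
          unfolding prod.case norm_mult norm_power by (rule infsum_cmult_right')
        also have "\<dots> \<le> ?M lam" unfolding min[OF lam] by (rule bound[OF lam xR])
        finally show "norm (infsum (\<lambda>k. norm (?g (lam, k))) ?K) \<le> ?M lam" by (simp add: infsum_nonneg)
      qed simp
    qed
    hence sg: "?g summable_on (partitions \<times> ?K)" by (rule abs_summable_summable)
    have "infsum ?g (partitions \<times> ?K) = (\<Sum>\<^sub>\<infinity>lam\<in>partitions. \<Sum>\<^sub>\<infinity>k\<in>?K. ?g (lam, k))"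
      by (rule infsum_Sigma_banach[OF sg, symmetric])
    also have "\<dots> = Qcorr q m x"
      unfolding Qcorr_def prod.case by (rule infsum_cong) (simp only: infsum_cmult_right' mi(2))
    finally have "(?g has_sum Qcorr q m x) (partitions \<times> ?K)" using sg by (simp add: has_sum_iff)
    hence sw: "((\<lambda>(k, lam). ?g (lam, k)) has_sum Qcorr q m x) (?K \<times> partitions)"
      by (subst (asm) has_sum_swap) (simp add: case_prod_unfold)
    have "((\<lambda>k. \<Sum>\<^sub>\<infinity>lam\<in>partitions. ?g (lam, k)) has_sum Qcorr q m x) ?K"
    proof (rule has_sum_SigmaD[OF sw])
      fix k assume "k \<in> ?K"
      thus "((\<lambda>lam. (\<lambda>(k, lam). ?g (lam, k)) (k, lam)) has_sum (\<Sum>\<^sub>\<infinity>lam\<in>partitions. ?g (lam, k))) partitions"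
        using summable_on_SigmaD1[of "\<lambda>k lam. ?g (lam, k)" ?K "\<lambda>_. partitions" k] has_sum_imp_summable[OF sw]
        by (simp add: has_sum_infsum)
    qed
    from has_sum_cmult_right[OF this, of "1 / (\<Prod>i<m. x i) / ?P"]
    have "((\<lambda>k. 1 / (\<Prod>i<m. x i) / ?P * (\<Sum>\<^sub>\<infinity>lam\<in>partitions. ?g (lam, k))) has_sum
        (Qcorr q m x / (\<Prod>i<m. x i) / ?P)) ?K" by (simp add: mult.commute)
    moreover have "1 / (\<Prod>i<m. x i) / ?P * (\<Sum>\<^sub>\<infinity>lam\<in>partitions. ?g (lam, k)) =
        qbracket q (\<lambda>lam. \<Prod>i<m. Q (k i) lam) * (\<Prod>i<m. x i powi (int (k i) - 1))" for k
    proof -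
      have "(\<Prod>i<m. x i powi (int (k i) - 1)) = (\<Prod>i<m. x i ^ k i) / (\<Prod>i<m. x i)"
        unfolding prod_dividef[symmetric]
        by (rule prod.cong[OF refl]) (use x in \<open>auto simp: power_int_diff\<close>)
      moreover have "(\<Sum>\<^sub>\<infinity>lam\<in>partitions. ?g (lam, k)) =
          (\<Sum>\<^sub>\<infinity>lam\<in>partitions. (\<Prod>i<m. Q (k i) lam) * q ^ psize lam) * (\<Prod>i<m. x i ^ k i)"
        unfolding prod.case by (subst infsum_cmult_left'[symmetric], rule infsum_cong) (simp add: prod.distrib mult_ac)
      ultimately show ?thesis by (simp add: qbracket_def)
    qed
    ultimately show ?thesis by simp
  qed
  have part: "Qcorr q m x / (\<Prod>i<m. x i) = exp (- (\<Sum>i<m. x i) / 2) * part_corr q {..<m} x"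
    if x: "\<And>i. i < m \<Longrightarrow> 0 < Re (x i) \<and> norm (x i) < R" for x
  proof -
    have x0: "(\<Prod>i<m. x i) \<noteq> 0" using x by force
    have "Qcorr q m x = (\<Sum>\<^sub>\<infinity>lam\<in>partitions. ((\<Prod>i<m. x i) * exp (- (\<Sum>i<m. x i) / 2)) *
        (q ^ psize lam * (\<Prod>i<m. part_sum (x i) lam)))"
      unfolding Qcorr_def
    proof (rule infsum_cong)
      fix lam assume lam: "lam \<in> partitions"
      have "(\<Prod>i<m. Qser lam (x i)) = (\<Prod>i<m. x i * exp (- (x i / 2)) * part_sum (x i) lam)"
        by (rule prod.cong[OF refl]) (use x R(2) r(5)[OF lam] in \<open>auto intro: less_imp_le less_le_trans\<close>)
      also have "\<dots> = (\<Prod>i<m. x i) * exp (- (\<Sum>i<m. x i) / 2) * (\<Prod>i<m. part_sum (x i) lam)"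
        by (simp add: prod.distrib exp_sum[symmetric] sum_negf sum_divide_distrib)
      finally show "q ^ psize lam * (\<Prod>i<m. Qser lam (x i)) = ((\<Prod>i<m. x i) * exp (- (\<Sum>i<m. x i) / 2)) *
        (q ^ psize lam * (\<Prod>i<m. part_sum (x i) lam))" by simp
    qed
    also have "\<dots> = ((\<Prod>i<m. x i) * exp (- (\<Sum>i<m. x i) / 2)) * part_corr q {..<m} x"
      unfolding part_corr_def by (rule infsum_cmult_right')
    finally show ?thesis using x0 by simp
  qed
  show ?thesis by (rule that[OF R(1) hol series part])
qed

section \<open>Existence of the correlators and the global recursion\<close>

definition partition_fn :: "complex \<Rightarrow> complex" where
  "partition_fn q = (\<Sum>\<^sub>\<infinity>lam\<in>partitions. q ^ psize lam)"

text \<open>For small \<open>e\<close>, points at which the Laurent series converges and the site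
  sums exist as well; a nonempty open set is all that the identity theorem asks for.\<close>

definition small_region :: "nat \<Rightarrow> real \<Rightarrow> (nat \<Rightarrow> complex) set" where
  "small_region m e = {x \<in> complex_space m. \<forall>i<m. 0 < Re (x i) \<and> norm (x i) < e}"

definition local_corr :: "complex \<Rightarrow> nat \<Rightarrow> (nat \<Rightarrow> complex) \<Rightarrow> complex" where
  "local_corr q m x = exp (- (\<Sum>i<m. x i) / 2) * part_corr q {..<m} x / partition_fn q"

lemma open_small_region: "open_in_space m (small_region m e)"
proof -
  have "open {x :: nat \<Rightarrow> complex. 0 < Re (x i)}" for i
    by (intro open_Collect_less continuous_intros continuous_on_product_coordinates)
  hence "open (\<Inter>i\<in>{..<m}. {x :: nat \<Rightarrow> complex. 0 < Re (x i)})" by (intro open_INT) auto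
  from open_Int[OF this open_coordinates[of m "\<lambda>_. 0" e]]
  have "open_in_space m (complex_space m \<inter> ((\<Inter>i\<in>{..<m}. {x :: nat \<Rightarrow> complex. 0 < Re (x i)}) \<inter>
      {x. \<forall>i<m. norm (x i - 0) < e}))"
    by (rule open_in_space_Int_open)
  moreover have "complex_space m \<inter> ((\<Inter>i\<in>{..<m}. {x :: nat \<Rightarrow> complex. 0 < Re (x i)}) \<inter>
      {x. \<forall>i<m. norm (x i - 0) < e}) = small_region m e"
    by (auto simp: small_region_def)
  ultimately show ?thesis by simp
qed

lemma small_region_nonempty: "0 < e \<Longrightarrow> small_region m e \<noteq> {}"
proof -
  assume "0 < e"
  hence "(\<lambda>i. if i < m then of_real (e / 2) else 0) \<in> small_region m e"
    by (auto simp: small_region_def complex_space_def)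
  thus ?thesis by blast
qed

lemma small_region_mono: "d \<le> e \<Longrightarrow> small_region m d \<subseteq> small_region m e"
  by (force simp: small_region_def)

lemma holomorphic_several_prod: "holomorphic_several m U (\<lambda>x. \<Prod>i<m. x i)"
  unfolding holomorphic_several_def
proof (intro conjI ballI allI impI)
  show "continuous_on U (\<lambda>x. \<Prod>i<m. x i)"
    by (intro continuous_intros continuous_on_subset[OF continuous_on_product_coordinates]) auto
  fix x :: "nat \<Rightarrow> complex" and i
  have "(\<lambda>w. \<Prod>j<m. (x(i := w)) j) holomorphic_on UNIV"
  proof (intro holomorphic_intros)
    fix j show "(\<lambda>w. (x(i := w)) j) holomorphic_on UNIV" by (cases "j = i") auto
  qed
  thus "(\<lambda>w. \<Prod>j<m. (x(i := w)) j) field_differentiable at (x i)"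
    by (rule holomorphic_on_imp_differentiable_at) auto
qed

lemma is_correlator_local:
  assumes q: "0 < norm q" "norm q < 1" and f: "is_correlator q m f"
  obtains e where "0 < e" "\<And>x. x \<in> small_region m e \<Longrightarrow> f x = local_corr q m x"
proof -
  let ?K = "{k :: nat \<Rightarrow> nat. \<forall>i\<ge>m. k i = 0}"
  let ?s = "\<lambda>x k. qbracket q (\<lambda>lam. \<Prod>i<m. Q (k i) lam) * (\<Prod>i<m. x i powi (int (k i) - 1))"
  obtain R where R: "0 < R" "holomorphic_several m {x \<in> complex_space m. \<forall>i<m. norm (x i) < R} (Qcorr q m)"
    "\<And>x. x \<in> complex_space m \<Longrightarrow> (\<And>i. i < m \<Longrightarrow> 0 < norm (x i) \<and> norm (x i) < R) \<Longrightarrow>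
      (?s x has_sum (Qcorr q m x / (\<Prod>i<m. x i) / (\<Sum>\<^sub>\<infinity>lam\<in>partitions. q ^ psize lam))) ?K"
    "\<And>x. (\<And>i. i < m \<Longrightarrow> 0 < Re (x i) \<and> norm (x i) < R) \<Longrightarrow>
      Qcorr q m x / (\<Prod>i<m. x i) = exp (- (\<Sum>i<m. x i) / 2) * part_corr q {..<m} x"
    using Qcorr[OF q, of m] by blast
  obtain r where r: "0 < r"
    "\<And>x. x \<in> complex_space m \<Longrightarrow> (\<forall>i<m. 0 < norm (x i) \<and> norm (x i) < r) \<Longrightarrow> (?s x has_sum f x) ?K"
    using f unfolding is_correlator_def by blast
  show ?thesis
  proof (rule that[of "min r R"])
    fix x assume x: "x \<in> small_region m (min r R)"
    hence xs: "x \<in> complex_space m" "\<And>i. i < m \<Longrightarrow> 0 < Re (x i) \<and> norm (x i) < R"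
      "\<And>i. i < m \<Longrightarrow> 0 < norm (x i) \<and> norm (x i) < R" "\<forall>i<m. 0 < norm (x i) \<and> norm (x i) < r"
      by (auto simp: small_region_def)
    from has_sum_unique[OF r(2)[OF xs(1,4)] R(3)[OF xs(1,3)]] R(4)[OF xs(2)]
    show "f x = local_corr q m x" by (simp add: local_corr_def partition_fn_def)
  qed (use r R in auto)
qed

text \<open>
  A meromorphic function that agrees with the series somewhere is the continuation of the series;
  redefining it on the punctured polydisc gives a correlator in the sense of the definition.
\<close>

lemma is_correlatorI:
  assumes q: "0 < norm q" "norm q < 1" and f: "meromorphic_in m (complex_space m) f"
    and e: "0 < e" "\<And>x. x \<in> small_region m e \<Longrightarrow> f x = local_corr q m x"
  shows "\<exists>g. is_correlator q m g"
proof -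
  obtain R where R: "0 < R"
    "holomorphic_several m {x \<in> complex_space m. \<forall>i<m. norm (x i) < R} (Qcorr q m)"
    "\<And>x. x \<in> complex_space m \<Longrightarrow> (\<And>i. i < m \<Longrightarrow> 0 < norm (x i) \<and> norm (x i) < R) \<Longrightarrow>
      ((\<lambda>k. qbracket q (\<lambda>lam. \<Prod>i<m. Q (k i) lam) * (\<Prod>i<m. x i powi (int (k i) - 1))) has_sum
         (Qcorr q m x / (\<Prod>i<m. x i) / (\<Sum>\<^sub>\<infinity>lam\<in>partitions. q ^ psize lam))) {k :: nat \<Rightarrow> nat. \<forall>i\<ge>m. k i = 0}"
    "\<And>x. (\<And>i. i < m \<Longrightarrow> 0 < Re (x i) \<and> norm (x i) < R) \<Longrightarrow>
      Qcorr q m x / (\<Prod>i<m. x i) = exp (- (\<Sum>i<m. x i) / 2) * part_corr q {..<m} x"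
    using Qcorr[OF q, of m] by blast
  let ?W = "polydisc m (\<lambda>_. 0) R"
  let ?h = "\<lambda>x. \<Prod>i<m. x i"
  let ?V = "{x \<in> ?W. ?h x \<noteq> 0}"
  define T where "T = (\<lambda>x. Qcorr q m x / ?h x / partition_fn q)"
  have W: "?W = {x \<in> complex_space m. \<forall>i<m. norm (x i) < R}" by (simp add: polydisc_def)
  have Wo: "open_in_space m ?W" by (rule open_in_space_polydisc)
  have hol: "holomorphic_several m ?W (Qcorr q m)" "holomorphic_several m ?W ?h"
    using R(2) W by (auto intro: holomorphic_several_prod)
  have nz: "\<exists>x\<in>?W. ?h x \<noteq> 0"
  proof
    show "(\<lambda>i. if i < m then of_real (R / 2) else 0) \<in> ?W"
      using R(1) by (auto simp: polydisc_def complex_space_def)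
  qed (use R(1) in simp)
  have T_mero: "meromorphic_in m ?W T"
  proof (rule meromorphic_in_quotient[OF Wo])
    show "holomorphic_several m ?W (\<lambda>x. Qcorr q m x * inverse (partition_fn q))"
      by (intro holomorphic_several_mult hol holomorphic_several_const)
    show "\<exists>x\<in>U. ?h x \<noteq> 0" if "open_in_space m U" "U \<noteq> {}" "U \<subseteq> ?W" for U
      by (rule polydisc_nonzero_dense[OF hol(2) nz that])
    show "T x = Qcorr q m x * inverse (partition_fn q) / ?h x" for x
      by (simp add: T_def divide_inverse mult_ac)
  qed (rule hol(2))
  have d_mero: "meromorphic_in m ?W (\<lambda>x. f x + (- 1) * T x)"
    by (intro meromorphic_in_add meromorphic_in_mult meromorphic_in_const T_mero
        meromorphic_in_subset[OF f] polydisc_subset_space)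
  have zero: "f x + (- 1) * T x = 0" if "x \<in> small_region m (min e R)" for x
  proof -
    have "x \<in> small_region m e" using that small_region_mono[of "min e R" e m] by auto
    moreover have "\<And>i. i < m \<Longrightarrow> 0 < Re (x i) \<and> norm (x i) < R" using that by (auto simp: small_region_def)
    ultimately have "f x = local_corr q m x" "T x = local_corr q m x"
      using e(2)[of x] R(4)[of x] unfolding T_def local_corr_def by (simp_all only:)
    thus ?thesis by simp
  qed
  have sub: "small_region m (min e R) \<subseteq> ?W" by (auto simp: small_region_def polydisc_def)
  obtain D where D: "open_in_space m D" "D \<subseteq> ?W" "?W \<subseteq> closure D" "\<And>x. x \<in> D \<Longrightarrow> f x + (- 1) * T x = 0"
    using meromorphic_identity[OF d_mero Wo connected_polydisc open_small_region _ sub zero]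
      small_region_nonempty[of "min e R" m] e(1) R(1) by auto
  have V: "open_in_space m ?V"
    by (rule open_in_space_nonzero[OF _ Wo]) (use hol(2) in \<open>simp add: holomorphic_several_def\<close>)
  have "continuous_on ?V T"
    unfolding T_def
    by (intro continuous_intros continuous_on_subset[OF conjunct1[OF hol(1)[unfolded holomorphic_several_def]]]
        continuous_on_subset[OF conjunct1[OF hol(2)[unfolded holomorphic_several_def]]])
       (use part_corr_empty_nonzero[OF q, of "\<lambda>_::unit. 0"] in \<open>auto simp: partition_fn_def part_corr_def\<close>)
  from meromorphic_in_modify[OF f order_refl V this, of D] D polydisc_subset_space[of m "\<lambda>_. 0" R]
  have "meromorphic_in m (complex_space m) (\<lambda>x. if x \<in> ?V then T x else f x)"
    by (force simp: add_eq_0_iff2)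
  moreover have "x \<in> ?V" if "x \<in> complex_space m" "\<forall>i<m. 0 < norm (x i) \<and> norm (x i) < R" for x
    using that by (auto simp: polydisc_def)
  ultimately have "is_correlator q m (\<lambda>x. if x \<in> ?V then T x else f x)"
    unfolding is_correlator_def meromorphic_several_iff T_def partition_fn_def using R(1,3) by auto
  thus ?thesis by blast
qed

section \<open>The correlator of one variable\<close>

lemma theta_nonzero_near_0:
  assumes q: "0 < norm q" "norm q < 1"
  obtains e where "0 < e" "\<And>z. z \<noteq> 0 \<Longrightarrow> norm z < e \<Longrightarrow> theta q z \<noteq> 0"
proof -
  obtain \<beta> where \<beta>: "theta q \<beta> \<noteq> 0" using theta_nonzero[OF q] by blast
  have 0: "theta q 0 = 0" using theta_jtheta[of q 0] q by (auto simp: jtheta_0)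
  obtain e where "0 < e" "\<And>z. z \<in> ball 0 e - {0} \<Longrightarrow> theta q z \<noteq> 0"
    using isolated_zeros[OF theta_holomorphic[OF q, of UNIV] open_UNIV connected_UNIV UNIV_I 0 UNIV_I \<beta>]
    by metis
  thus ?thesis using that[of e] by auto
qed

text \<open>The base of the induction: \<open>part_corr_one\<close> identifies the local form with a
  quotient that is meromorphic everywhere.\<close>

lemma correlator_1_exists:
  assumes q: "0 < norm q" "norm q < 1"
  shows "\<exists>f. is_correlator q 1 f"
proof -
  have q0: "q \<noteq> 0" using q by auto
  obtain e where e: "0 < e" "\<And>z. z \<noteq> 0 \<Longrightarrow> norm z < e \<Longrightarrow> theta q z \<noteq> 0"
    using theta_nonzero_near_0[OF q] by metis
  \<comment> \<open>\<open>e\<close> keeps clear of the zeros of theta other than 0, the logarithm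
    keeps within the strip.\<close>
  let ?d = "min e (- ln (norm q))"
  show ?thesis
  proof (rule is_correlatorI[OF q])
    show "meromorphic_in 1 (complex_space 1) (\<lambda>x. deriv (theta q) 0 / theta q (x 0))"
      by (rule meromorphic_in_one[of "\<lambda>_. deriv (theta q) 0" "theta q"])
         (use theta_holomorphic[OF q] theta_nonzero[OF q] in auto)
    show "0 < ?d" using e(1) q by simp
    fix x assume x: "x \<in> small_region 1 ?d"
    hence x0: "0 < Re (x 0)" "norm (x 0) < e" "norm (x 0) < - ln (norm q)"
      by (auto simp: small_region_def)
    have t0: "theta q (x 0) \<noteq> 0" using x0 by (intro e(2)) auto
    have "ln (norm q) + Re (x 0) < 0" using x0 complex_Re_le_cmod[of "x 0"] by linarith
    hence "exp (ln (norm q) + Re (x 0)) < 1" by simp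
    hence "norm q * exp (Re (x 0)) < 1" using q by (simp add: exp_add)
    hence strip: "in_strip q (x 0)" using x0 by (simp add: in_strip_def)
    have P: "part_corr q {} (\<lambda>_::unit. x 0) = partition_fn q" by (simp add: part_corr_def partition_fn_def)
    have P0: "partition_fn q \<noteq> 0" using part_corr_empty_nonzero[OF q, of "\<lambda>_::unit. x 0"] P by simp
    have G: "part_corr q {..<1} x = part_corr q {()} (\<lambda>_. x 0)"
      by (simp add: part_corr_def)
    have "jtheta q (x 0) * part_corr q {..<1} x = deriv (jtheta q) 0 * partition_fn q"
      unfolding G using part_corr_one[OF q strip] P by simp
    moreover have "jtheta q (x 0) \<noteq> 0" using t0 theta_zero_iff[OF q0] by simp
    ultimately have "part_corr q {..<1} x / partition_fn q = deriv (jtheta q) 0 / jtheta q (x 0)"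
      using P0 by (simp add: divide_simps mult_ac)
    \<comment> \<open>The factor \<open>exp (x 0 / 2)\<close> of theta, in the denominator, is the
      exponential in \<open>local_corr\<close>.\<close>
    thus "deriv (theta q) 0 / theta q (x 0) = local_corr q 1 x"
      using t0 by (simp add: local_corr_def deriv_theta_0[OF q] theta_jtheta[OF q0] exp_minus divide_simps)
  qed
qed

text \<open>Removes the index set, so that sums over differently labelled variables can be
  compared.\<close>

lemma part_corr_list:
  "part_corr q {..<length xs} (nth_default 0 xs) =
    (\<Sum>\<^sub>\<infinity>lam\<in>partitions. q ^ psize lam * prod_list (map (\<lambda>y. part_sum y lam) xs))"
  unfolding part_corr_def
proof (intro infsum_cong arg_cong2[where f = "(*)"] refl)
  fix lam
  have "(\<Prod>i<length xs. part_sum (nth_default 0 xs i) lam) = (\<Prod>i<length xs. map (\<lambda>y. part_sum y lam) xs ! i)"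
    by (rule prod.cong) (auto simp: nth_default_nth)
  thus "(\<Prod>i<length xs. part_sum (nth_default 0 xs i) lam) = prod_list (map (\<lambda>y. part_sum y lam) xs)"
    by (simp add: prod.list_conv_set_nth atLeast0LessThan)
qed

lemma sum_list_nth_default: "(\<Sum>i<length xs. nth_default 0 xs i) = sum_list xs"
proof -
  have "(\<Sum>i<length xs. nth_default 0 xs i) = (\<Sum>i<length xs. xs ! i)"
    by (rule sum.cong) (auto simp: nth_default_nth)
  thus ?thesis by (simp add: sum_list_sum_nth atLeast0LessThan)
qed

lemma nth_default_in_space: "nth_default 0 xs \<in> complex_space (length xs)"
  by (auto simp: complex_space_def nth_default_beyond)

lemma F_local:
  assumes q: "0 < norm q" "norm q < 1" and ex: "\<exists>f. is_correlator q m f"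
  obtains e where "0 < e" "\<And>xs. length xs = m \<Longrightarrow> (\<And>y. y \<in> set xs \<Longrightarrow> 0 < Re y \<and> norm y < e) \<Longrightarrow>
    F q xs = exp (- sum_list xs / 2) * part_corr q {..<length xs} (nth_default 0 xs) / partition_fn q"
proof -
  have c: "is_correlator q m (correlator q m)" unfolding correlator_def using ex by (rule someI_ex)
  obtain e where e: "0 < e" "\<And>x. x \<in> small_region m e \<Longrightarrow> correlator q m x = local_corr q m x"
    using is_correlator_local[OF q c] by metis
  show ?thesis
  proof (rule that[OF e(1)])
    fix xs :: "complex list" assume xs: "length xs = m" "\<And>y. y \<in> set xs \<Longrightarrow> 0 < Re y \<and> norm y < e"
    have "nth_default 0 xs \<in> small_region m e"
      using xs nth_default_in_space[of xs] by (auto simp: small_region_def nth_default_nth)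
    thus "F q xs = exp (- sum_list xs / 2) * part_corr q {..<length xs} (nth_default 0 xs) / partition_fn q"
      using e(2) xs(1) by (simp add: F_def local_corr_def flip: sum_list_nth_default)
  qed
qed

text \<open>The coordinates are \<open>x 0\<close> for u, \<open>x 1\<close> for v and
  \<open>x (j + 1)\<close> for z_j. The correlators that occur have between 1 and
  \<open>n + 1\<close> variables, fewer than the \<open>n + 2\<close> on the left, which is what the
  induction uses.\<close>

definition recursion_rhs :: "complex \<Rightarrow> nat \<Rightarrow> (nat \<Rightarrow> complex) \<Rightarrow> complex" where
  "recursion_rhs q n x = (\<Sum>J\<in>Pow {1..n}.
     F q ((x 0 + x 1 + (\<Sum>j\<in>J. x (j + 1))) # map (\<lambda>j. x (j + 1)) (sorted_list_of_set ({1..n} - J))) *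
     (\<Sum>I\<in>Pow J. (-1) ^ card (J - I) *
       (Z q (card J) (x 0 + (\<Sum>j\<in>I. x (j + 1))) + Z q (card J) (x 1 + (\<Sum>j\<in>I. x (j + 1))))))"

lemma Z_meromorphic:
  assumes q: "0 < norm q" "norm q < 1"
  shows "meromorphic_in 1 (complex_space 1) (\<lambda>x. Z q l (x 0))"
proof -
  obtain g where g: "g holomorphic_on UNIV" "\<And>x. theta q x \<noteq> 0 \<Longrightarrow> Z q l x = g x / theta q x"
    using Z_quotient[OF q] by blast
  show ?thesis
    by (rule meromorphic_in_one[OF g(1) theta_holomorphic[OF q]]) (use theta_nonzero[OF q] g(2) in auto)
qed

lemma Z_form_meromorphic:
  assumes q: "0 < norm q" "norm q < 1" and I: "I \<subseteq> {1..n}" and a: "a < 2"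
  shows "meromorphic_in (n + 2) (complex_space (n + 2)) (\<lambda>x. Z q l (x a + (\<Sum>j\<in>I. x (j + 1))))"
proof -
  \<comment> \<open>The target has the single coordinate 0, so label 1 drops a variable.\<close>
  define s :: "nat \<Rightarrow> nat" where "s = (\<lambda>i. if i = a \<or> i \<in> Suc ` I then 0 else 1)"
  have "collect (n + 2) 1 s x 0 = x a + (\<Sum>j\<in>I. x (j + 1))" for x
  proof -
    have aI: "a \<notin> Suc ` I" using a I by auto
    have fin: "finite I" using I by (rule finite_subset) simp
    have "{i. i < n + 2 \<and> s i = 0} = insert a (Suc ` I)" using a I by (auto simp: s_def)
    hence "collect (n + 2) 1 s x 0 = (\<Sum>i\<in>insert a (Suc ` I). x i)" by (simp add: collect_def)
    also have "\<dots> = x a + (\<Sum>i\<in>Suc ` I. x i)" using aI fin by (intro sum.insert) auto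
    also have "(\<Sum>i\<in>Suc ` I. x i) = (\<Sum>j\<in>I. x (j + 1))" by (simp add: sum.reindex)
    finally show ?thesis .
  qed
  moreover have "meromorphic_in (n + 2) (complex_space (n + 2)) (\<lambda>x. Z q l (collect (n + 2) 1 s x 0))"
    by (rule meromorphic_in_collect[OF Z_meromorphic[OF q]])
       (use a in \<open>auto simp: s_def intro!: image_eqI[of _ _ a]\<close>)
  ultimately show ?thesis by simp
qed

lemma F_merged_meromorphic:
  assumes J: "J \<subseteq> {1..n}" and ex: "\<exists>f. is_correlator q (Suc (card ({1..n} - J))) f"
  shows "meromorphic_in (n + 2) (complex_space (n + 2)) (\<lambda>x. F q ((x 0 + x 1 + (\<Sum>j\<in>J. x (j + 1))) #
    map (\<lambda>j. x (j + 1)) (sorted_list_of_set ({1..n} - J))))"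
proof -
  let ?N = "{1..n} - J"
  define ls where "ls = sorted_list_of_set ?N"
  have ls: "distinct ls" "set ls = ?N" "length ls = card ?N" by (simp_all add: ls_def)
  let ?m = "Suc (card ?N)"
  have bij: "bij_betw ((!) ls) {..<length ls} ?N" by (rule bij_betw_nth[OF ls(1) refl ls(2)[symmetric]])
  define p where "p = inv_into {..<length ls} ((!) ls)"
  have p: "p j < length ls" "ls ! p j = j" if "j \<in> ?N" for j
    using bij that unfolding p_def bij_betw_def by (metis inv_into_into lessThan_iff, metis f_inv_into_f)
  have p': "p (ls ! i) = i" if "i < length ls" for i
    using bij that unfolding p_def by (simp add: bij_betw_def inv_into_f_f)
  \<comment> \<open>u, v and the variables of \<open>J\<close> are merged into coordinate 0; every
    other variable gets its position in the sorted list, counted after that coordinate.\<close>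
  define s where "s = (\<lambda>i. if i < 2 \<or> i - 1 \<in> J then 0 else Suc (p (i - 1)))"
  have fin: "finite J" using J by (rule finite_subset) simp
  have coll: "nth_default 0 ((x 0 + x 1 + (\<Sum>j\<in>J. x (j + 1))) # map (\<lambda>j. x (j + 1)) ls) = collect (n + 2) ?m s x" for x
  proof
    fix i
    show "nth_default 0 ((x 0 + x 1 + (\<Sum>j\<in>J. x (j + 1))) # map (\<lambda>j. x (j + 1)) ls) i = collect (n + 2) ?m s x i"
    proof (cases i)
      case 0
      have "{i. i < n + 2 \<and> s i = 0} = insert 0 (insert 1 (Suc ` J))"
      proof
        show "{i. i < n + 2 \<and> s i = 0} \<subseteq> insert 0 (insert 1 (Suc ` J))"
        proof
          fix i assume "i \<in> {i. i < n + 2 \<and> s i = 0}"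
          hence "i < 2 \<or> i - 1 \<in> J" by (auto simp: s_def split: if_splits)
          thus "i \<in> insert 0 (insert 1 (Suc ` J))"
            by (cases "i < 2") (auto intro!: image_eqI[of _ _ "i - 1"])
        qed
      qed (use J in \<open>auto simp: s_def\<close>)
      hence "collect (n + 2) ?m s x 0 = (\<Sum>i\<in>insert 0 (insert 1 (Suc ` J)). x i)" by (simp add: collect_def)
      also have "\<dots> = x 0 + (x 1 + (\<Sum>i\<in>Suc ` J. x i))"
        using fin J by (subst sum.insert; (subst sum.insert)?) auto
      also have "(\<Sum>i\<in>Suc ` J. x i) = (\<Sum>j\<in>J. x (j + 1))" by (simp add: sum.reindex)
      finally show ?thesis using 0 by (simp add: add.assoc)
    next
      case (Suc k)
      show ?thesis
      proof (cases "k < length ls")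
        case True
        hence lk: "ls ! k \<in> ?N" using ls(2) nth_mem by blast
        have "{i. i < n + 2 \<and> s i = Suc k} = {ls ! k + 1}"
        proof
          show "{i. i < n + 2 \<and> s i = Suc k} \<subseteq> {ls ! k + 1}"
          proof
            fix i assume i: "i \<in> {i. i < n + 2 \<and> s i = Suc k}"
            hence "\<not> i < 2" "i - 1 \<notin> J" "p (i - 1) = k" "i < n + 2" by (auto simp: s_def split: if_splits)
            moreover from this have "i - 1 \<in> ?N" by auto
            ultimately show "i \<in> {ls ! k + 1}" using p(2)[of "i - 1"] by auto
          qed
          show "{ls ! k + 1} \<subseteq> {i. i < n + 2 \<and> s i = Suc k}"
            using lk p'[OF True] by (auto simp: s_def)
        qed
        hence "collect (n + 2) ?m s x i = x (ls ! k + 1)" using Suc True ls(3) by (simp add: collect_def)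
        thus ?thesis using Suc True by (simp add: nth_default_def)
      next
        case False
        thus ?thesis using Suc ls(3) by (simp add: collect_def nth_default_def)
      qed
    qed
  qed
  have "{..<?m} \<subseteq> s ` {..<n + 2}"
  proof
    fix i assume i: "i \<in> {..<?m}"
    show "i \<in> s ` {..<n + 2}"
    proof (cases i)
      case 0
      thus ?thesis by (intro image_eqI[of _ _ 0]) (auto simp: s_def)
    next
      case (Suc k)
      hence k: "k < length ls" using i ls(3) by simp
      hence "ls ! k \<in> ?N" using ls(2) nth_mem by blast
      thus ?thesis using Suc p'[OF k] by (intro image_eqI[of _ _ "ls ! k + 1"]) (auto simp: s_def)
    qed
  qed
  moreover have "is_correlator q ?m (correlator q ?m)" unfolding correlator_def using ex by (rule someI_ex)
  ultimately have "meromorphic_in (n + 2) (complex_space (n + 2)) (\<lambda>x. correlator q ?m (collect (n + 2) ?m s x))"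
    by (intro meromorphic_in_collect) (auto simp: is_correlator_def meromorphic_several_iff)
  moreover have "F q ((x 0 + x 1 + (\<Sum>j\<in>J. x (j + 1))) # map (\<lambda>j. x (j + 1)) ls) =
      correlator q ?m (collect (n + 2) ?m s x)" for x
    unfolding F_def coll using ls(3) by simp
  ultimately show ?thesis unfolding ls_def by simp
qed

lemma recursion_rhs_meromorphic:
  assumes q: "0 < norm q" "norm q < 1" and ex: "\<And>m. 1 \<le> m \<Longrightarrow> m \<le> n + 1 \<Longrightarrow> \<exists>f. is_correlator q m f"
  shows "meromorphic_in (n + 2) (complex_space (n + 2)) (recursion_rhs q n)"
  unfolding recursion_rhs_def[abs_def]
proof (intro meromorphic_in_sum meromorphic_in_mult meromorphic_in_add meromorphic_in_const order_refl)
  fix J assume "J \<in> Pow {1..n}"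
  hence J: "J \<subseteq> {1..n}" by simp
  have "card ({1..n} - J) \<le> card {1..n}" by (rule card_mono) auto
  hence "\<exists>f. is_correlator q (Suc (card ({1..n} - J))) f" by (intro ex) auto
  from F_merged_meromorphic[OF J this]
  show "meromorphic_in (n + 2) (complex_space (n + 2)) (\<lambda>x. F q ((x 0 + x 1 + (\<Sum>j\<in>J. x (j + 1))) #
    map (\<lambda>j. x (j + 1)) (sorted_list_of_set ({1..n} - J))))" .
  fix I assume "I \<in> Pow J"
  hence I: "I \<subseteq> {1..n}" using J by auto
  show "meromorphic_in (n + 2) (complex_space (n + 2)) (\<lambda>x. Z q (card J) (x 0 + (\<Sum>j\<in>I. x (j + 1))))"
    "meromorphic_in (n + 2) (complex_space (n + 2)) (\<lambda>x. Z q (card J) (x 1 + (\<Sum>j\<in>I. x (j + 1))))"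
    by (rule Z_form_meromorphic[OF q I]; simp)+
qed

text \<open>Here \<open>F\<close>, given by choice, and \<open>Z\<close>, given by Laurent
  expansions, meet the sums over partitions: the region is so small that every partial sum of the
  variables is an argument at which their local formulas hold.\<close>

lemma recursion_rhs_local:
  assumes q: "0 < norm q" "norm q < 1" and ex: "\<And>m. 1 \<le> m \<Longrightarrow> m \<le> n + 1 \<Longrightarrow> \<exists>f. is_correlator q m f"
  obtains e where "0 < e" "\<And>x. x \<in> small_region (n + 2) e \<Longrightarrow> recursion_rhs q n x = local_corr q (n + 2) x"
proof -
  let ?P = "partition_fn q"
  have "\<exists>e. 0 < e \<and> (\<forall>xs. length xs = m \<longrightarrow> (\<forall>y\<in>set xs. 0 < Re y \<and> norm y < e) \<longrightarrow>
    F q xs = exp (- sum_list xs / 2) * part_corr q {..<length xs} (nth_default 0 xs) / ?P)"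
    if "m \<in> {1..n + 1}" for m
    using F_local[OF q ex[of m]] that by (metis atLeastAtMost_iff)
  then obtain ee where ee: "\<And>m. m \<in> {1..n + 1} \<Longrightarrow> 0 < ee m"
    "\<And>m xs. m \<in> {1..n + 1} \<Longrightarrow> length xs = m \<Longrightarrow> (\<forall>y\<in>set xs. 0 < Re y \<and> norm y < ee m) \<Longrightarrow>
      F q xs = exp (- sum_list xs / 2) * part_corr q {..<length xs} (nth_default 0 xs) / ?P"
    by metis
  obtain et where et: "0 < et" "\<And>z. z \<noteq> 0 \<Longrightarrow> norm z < et \<Longrightarrow> theta q z \<noteq> 0"
    using theta_nonzero_near_0[OF q] by metis
  \<comment> \<open>Below \<open>E\<close> theta has no zeros besides 0, the strip condition on the
    norm holds, and every correlator on the right-hand side has its local form.\<close>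
  define E where "E = Min (insert et (insert (- ln (norm q)) (ee ` {1..n + 1})))"
  have E0: "0 < E" using ee(1) et(1) q by (auto simp: E_def)
  have E: "E \<le> et" "E \<le> - ln (norm q)" "\<And>m. m \<in> {1..n + 1} \<Longrightarrow> E \<le> ee m"
    unfolding E_def by (rule Min_le; simp)+
  \<comment> \<open>Sums of up to \<open>n + 2\<close> variables stay below
    \<open>E\<close>.\<close>
  define e where "e = E / (real n + 2)"
  have e0: "0 < e" using E0 by (simp add: e_def)
  show ?thesis
  proof (rule that[OF e0])
    fix x assume x: "x \<in> small_region (n + 2) e"
    define z where "z = (\<lambda>j. x (j + 1))"
    \<comment> \<open>The lemma \<open>part_corr_recursion\<close> takes its two distinguished
      indices outside \<open>N\<close>: u is placed at 0 and v at \<open>Suc n\<close>, while each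
      z_j keeps its index.\<close>
    define X where "X = z(0 := x 0, Suc n := x 1)"
    let ?N = "{1..n}"
    let ?A = "insert 0 (insert (Suc n) ?N)"
    have XN: "X j = z j" if "j \<in> ?N" for j using that by (auto simp: X_def)
    have X0: "X 0 = x 0" "X (Suc n) = x 1" by (auto simp: X_def)
    have Xs: "0 < Re (X i)" "norm (X i) < e" if "i \<in> ?A" for i
      using x that by (auto simp: X_def z_def small_region_def)
    have cardA: "card ?A = n + 2" by simp
    have small: "norm (\<Sum>i\<in>B. X i) < E" "0 < Re (\<Sum>i\<in>B. X i)" "(\<Sum>i\<in>B. norm (X i)) < E"
      if "B \<subseteq> ?A" "B \<noteq> {}" for B
    proof -
      have fB: "finite B" using that(1) by (rule finite_subset) simp
      have "card B \<le> n + 2" using card_mono[OF _ that(1)] cardA by simp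
      have "(\<Sum>i\<in>B. norm (X i)) < (\<Sum>i\<in>B. e)"
        by (rule sum_strict_mono) (use Xs that fB in auto)
      also have "\<dots> \<le> real (n + 2) * e" using \<open>card B \<le> n + 2\<close> e0 by (simp add: mult_right_mono)
      also have "\<dots> = E" by (simp add: e_def add.commute)
      finally show "(\<Sum>i\<in>B. norm (X i)) < E" .
      thus "norm (\<Sum>i\<in>B. X i) < E" using norm_sum[of X B] by linarith
      show "0 < Re (\<Sum>i\<in>B. X i)" unfolding Re_sum by (rule sum_pos) (use Xs that fB in auto)
    qed
    have strip: "in_strip q (\<Sum>i\<in>B. X i)" "theta q (\<Sum>i\<in>B. X i) \<noteq> 0" if "B \<subseteq> ?A" "B \<noteq> {}" for B
    proof -
      note sB = small[OF that]
      have "ln (norm q) + Re (\<Sum>i\<in>B. X i) < 0" using sB(1) E(2) complex_Re_le_cmod[of "\<Sum>i\<in>B. X i"] by linarith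
      hence "exp (ln (norm q) + Re (\<Sum>i\<in>B. X i)) < 1" by simp
      hence "norm q * exp (Re (\<Sum>i\<in>B. X i)) < 1" using q by (simp add: exp_add)
      thus "in_strip q (\<Sum>i\<in>B. X i)" using sB(2) by (simp add: in_strip_def)
      have "(\<Sum>i\<in>B. X i) \<noteq> 0" using sB(2) by (metis less_irrefl zero_complex.sel(1))
      thus "theta q (\<Sum>i\<in>B. X i) \<noteq> 0" using sB(1) E(1) by (intro et(2)) auto
    qed
    have adm: "admissible q ?A X"
      using strip(1)[of ?A] Xs q by (simp add: admissible_def in_strip_def)
    have Zx: "Z q l (X a + (\<Sum>j\<in>I. X j)) = occupation_coeff l + zeta_sum q l (X a + (\<Sum>j\<in>I. X j))"
      if "I \<subseteq> ?N" "a \<in> {0, Suc n}" for I a l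
    proof -
      have "finite I" using that(1) by (rule finite_subset) simp
      hence "X a + (\<Sum>j\<in>I. X j) = (\<Sum>j\<in>insert a I. X j)" using that by (subst sum.insert) auto
      thus ?thesis using strip[of "insert a I"] Z_in_strip[OF q] that by auto
    qed
    have zX: "(\<Sum>j\<in>I. z j) = (\<Sum>j\<in>I. X j)" if "I \<subseteq> ?N" for I
      using XN that by (intro sum.cong) (auto simp: subset_iff)
    define X' where "X' = (\<lambda>J. X(0 := X 0 + X (Suc n) + (\<Sum>j\<in>J. X j)))"
    have part: "F q ((x 0 + x 1 + (\<Sum>j\<in>J. z j)) # map z (sorted_list_of_set (?N - J))) =
        exp (- (\<Sum>i\<in>?A. X i) / 2) * part_corr q (insert 0 (?N - J)) (X' J) / ?P" if J: "J \<subseteq> ?N" for J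
    proof -
      let ?ls = "sorted_list_of_set (?N - J)"
      let ?xs = "(x 0 + x 1 + (\<Sum>j\<in>J. z j)) # map z ?ls"
      have fJ: "finite J" using J by (rule finite_subset) simp
      have hd: "x 0 + x 1 + (\<Sum>j\<in>J. z j) = (\<Sum>j\<in>insert 0 (insert (Suc n) J). X j)"
        using J fJ by (subst sum.insert; (subst sum.insert)?) (auto simp: zX X0)
      have len: "length ?xs = Suc (card (?N - J))" by simp
      have "card (?N - J) \<le> card ?N" by (rule card_mono) auto
      hence m: "Suc (card (?N - J)) \<in> {1..n + 1}" by simp
      have "0 < Re y \<and> norm y < E" if "y \<in> set ?xs" for y
      proof -
        from that consider "y = x 0 + x 1 + (\<Sum>j\<in>J. z j)" | j where "j \<in> ?N" "y = z j" by auto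
        thus ?thesis
        proof cases
          case 1
          thus ?thesis unfolding hd using small[of "insert 0 (insert (Suc n) J)"] J by auto
        next
          case 2
          thus ?thesis using small[of "{j}"] XN by auto
        qed
      qed
      hence "F q ?xs = exp (- sum_list ?xs / 2) * part_corr q {..<length ?xs} (nth_default 0 ?xs) / ?P"
        using E(3)[OF m] by (intro ee(2)[OF m len]) (auto intro: less_le_trans)
      also have "sum_list ?xs = (\<Sum>i\<in>?A. X i)"
      proof -
        have "sum_list (map z ?ls) = (\<Sum>j\<in>?N - J. z j)"
          by (subst sum.distinct_set_conv_list[symmetric]) auto
        also have "\<dots> = (\<Sum>j\<in>?N - J. X j)" by (rule zX) auto
        finally have "sum_list ?xs = (\<Sum>j\<in>insert 0 (insert (Suc n) J). X j) + (\<Sum>j\<in>?N - J. X j)"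
          unfolding hd[symmetric] by simp
        also have "\<dots> = (\<Sum>j\<in>insert 0 (insert (Suc n) J) \<union> (?N - J). X j)"
          by (rule sum.union_disjoint[symmetric]) (use fJ J in auto)
        also have "insert 0 (insert (Suc n) J) \<union> (?N - J) = ?A" using J by auto
        finally show ?thesis .
      qed
      also have "part_corr q {..<length ?xs} (nth_default 0 ?xs) = part_corr q (insert 0 (?N - J)) (X' J)"
        unfolding part_corr_list unfolding part_corr_def
      proof (intro infsum_cong arg_cong2[where f = "(*)"] refl)
        fix lam
        have "(\<Prod>i\<in>insert 0 (?N - J). part_sum (X' J i) lam) =
            part_sum (X' J 0) lam * (\<Prod>i\<in>?N - J. part_sum (X' J i) lam)"
          by (rule prod.insert) auto
        also have "(\<Prod>i\<in>?N - J. part_sum (X' J i) lam) = (\<Prod>i\<in>?N - J. part_sum (z i) lam)"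
          by (rule prod.cong) (auto simp: X'_def XN)
        also have "\<dots> = prod_list (map (\<lambda>i. part_sum (z i) lam) ?ls)"
          by (subst prod.distinct_set_conv_list[symmetric]) auto
        also have "X' J 0 = x 0 + x 1 + (\<Sum>j\<in>J. z j)" by (simp add: X'_def X0 zX[OF J])
        finally show "prod_list (map (\<lambda>y. part_sum y lam) ?xs) = (\<Prod>i\<in>insert 0 (?N - J). part_sum (X' J i) lam)"
          by (simp add: o_def)
      qed
      finally show ?thesis .
    qed
    let ?Zf = "\<lambda>l u. occupation_coeff l + zeta_sum q l u"
    \<comment> \<open>The exponential in the local form depends only on the sum of all arguments,
      which is the same for every \<open>J\<close>, so it can be pulled out together with the
      normalization.\<close>
    have "recursion_rhs q n x = (\<Sum>J\<in>Pow ?N. exp (- (\<Sum>i\<in>?A. X i) / 2) / ?P *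
        (part_corr q (insert 0 (?N - J)) (X' J) * (\<Sum>I\<in>Pow J. (-1) ^ card (J - I) *
          (?Zf (card J) (X 0 + (\<Sum>j\<in>I. X j)) + ?Zf (card J) (X (Suc n) + (\<Sum>j\<in>I. X j))))))"
      unfolding recursion_rhs_def z_def[symmetric]
    proof (intro sum.cong refl)
      fix J assume "J \<in> Pow ?N"
      hence J: "J \<subseteq> ?N" by simp
      have "(\<Sum>I\<in>Pow J. (-1) ^ card (J - I) * (Z q (card J) (x 0 + (\<Sum>j\<in>I. z j)) + Z q (card J) (x 1 + (\<Sum>j\<in>I. z j)))) =
        (\<Sum>I\<in>Pow J. (-1) ^ card (J - I) * (?Zf (card J) (X 0 + (\<Sum>j\<in>I. X j)) + ?Zf (card J) (X (Suc n) + (\<Sum>j\<in>I. X j))))"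
      proof (intro sum.cong refl)
        fix I assume "I \<in> Pow J"
        hence I: "I \<subseteq> ?N" using J by auto
        show "(-1) ^ card (J - I) * (Z q (card J) (x 0 + (\<Sum>j\<in>I. z j)) + Z q (card J) (x 1 + (\<Sum>j\<in>I. z j))) =
          (-1) ^ card (J - I) * (?Zf (card J) (X 0 + (\<Sum>j\<in>I. X j)) + ?Zf (card J) (X (Suc n) + (\<Sum>j\<in>I. X j)))"
          using Zx[OF I, of 0 "card J"] Zx[OF I, of "Suc n" "card J"] by (simp add: zX[OF I] X0)
      qed
      thus "F q ((x 0 + x 1 + (\<Sum>j\<in>J. z j)) # map z (sorted_list_of_set (?N - J))) *
          (\<Sum>I\<in>Pow J. (-1) ^ card (J - I) * (Z q (card J) (x 0 + (\<Sum>j\<in>I. z j)) + Z q (card J) (x 1 + (\<Sum>j\<in>I. z j)))) =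
        exp (- (\<Sum>i\<in>?A. X i) / 2) / ?P *
        (part_corr q (insert 0 (?N - J)) (X' J) * (\<Sum>I\<in>Pow J. (-1) ^ card (J - I) *
          (?Zf (card J) (X 0 + (\<Sum>j\<in>I. X j)) + ?Zf (card J) (X (Suc n) + (\<Sum>j\<in>I. X j)))))"
        unfolding part[OF J] by (simp only: times_divide_eq_left mult.assoc)
    qed
    also have "\<dots> = exp (- (\<Sum>i\<in>?A. X i) / 2) / ?P * part_corr q ?A X"
      unfolding sum_distrib_left[symmetric] X'_def
      by (subst part_corr_recursion[OF adm, of ?Zf occupation_coeff]) (auto simp: occupation_coeff_0)
    also have "\<dots> = local_corr q (n + 2) x"
    proof -
      \<comment> \<open>Back from the labels of \<open>X\<close> to the order u, v, z_1, ..., z_n of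
        the coordinates of \<open>x\<close>.\<close>
      have bij: "bij_betw (\<lambda>i. if i = 0 then 0 else if i = Suc n then 1 else Suc i) ?A {..<n + 2}"
        by (rule bij_betwI[where g = "\<lambda>i. if i = 0 then 0 else if i = 1 then Suc n else i - 1"])
           (auto split: if_splits)
      have Xx: "X i = x (if i = 0 then 0 else if i = Suc n then 1 else Suc i)" for i
        by (simp add: X_def z_def)
      have "(\<Sum>i\<in>?A. X i) = (\<Sum>i<n + 2. x i)"
        unfolding Xx by (rule sum.reindex_bij_betw[OF bij])
      moreover have "part_corr q ?A X = part_corr q {..<n + 2} x"
        unfolding part_corr_def Xx
        by (intro infsum_cong arg_cong2[where f = "(*)"] refl prod.reindex_bij_betw[OF bij])
      ultimately show ?thesis by (simp add: local_corr_def)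
    qed
    finally show "recursion_rhs q n x = local_corr q (n + 2) x" .
  qed
qed

section \<open>Existence of all correlators and the identity of meromorphic functions\<close>

lemma correlator_exists:
  assumes q: "0 < norm q" "norm q < 1"
  shows "1 \<le> m \<Longrightarrow> \<exists>f. is_correlator q m f"
proof (induction m rule: less_induct)
  case (less m)
  show ?case
  proof (cases "m = 1")
    case True
    thus ?thesis using correlator_1_exists[OF q] by simp
  next
    case False
    define n where "n = m - 2"
    have m: "m = n + 2" using False less.prems by (simp add: n_def)
    have ex: "\<exists>f. is_correlator q k f" if "1 \<le> k" "k \<le> n + 1" for k using that by (intro less.IH) (auto simp: m)
    obtain e where e: "0 < e" "\<And>x. x \<in> small_region (n + 2) e \<Longrightarrow> recursion_rhs q n x = local_corr q (n + 2) x"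
      using recursion_rhs_local[OF q ex] by blast
    show ?thesis unfolding m by (rule is_correlatorI[OF q recursion_rhs_meromorphic[OF q ex] e])
  qed
qed

theorem theorem15p1:
  fixes q :: complex and n :: nat
  assumes "0 < norm q" and "norm q < 1"
  shows "generically (n + 2) (\<lambda>x.
    let u = x 0; v = x 1; z = (\<lambda>j. x (j + 1)); N = {1..n};
        Zs = (\<lambda>J. map z (sorted_list_of_set J)); zsum = (\<lambda>J. \<Sum>j\<in>J. z j)
    in F q (u # v # Zs N) =
       (\<Sum>J\<in>Pow N. F q ((u + v + zsum J) # Zs (N - J)) *
          (\<Sum>I\<in>Pow J. (-1) ^ card (J - I) *
             (Z q (card J) (u + zsum I) + Z q (card J) (v + zsum I)))))"
proof -
  note q = assms
  let ?C = "complex_space (n + 2)" and ?f = "correlator q (n + 2)"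
  have ex: "\<exists>f. is_correlator q m f" if "1 \<le> m" for m using correlator_exists[OF q that] .
  have c: "is_correlator q (n + 2) ?f" unfolding correlator_def by (rule someI_ex[OF ex]) simp
  obtain e1 where e1: "0 < e1" "\<And>x. x \<in> small_region (n + 2) e1 \<Longrightarrow> ?f x = local_corr q (n + 2) x"
    using is_correlator_local[OF q c] by metis
  obtain e2 where e2: "0 < e2" "\<And>x. x \<in> small_region (n + 2) e2 \<Longrightarrow> recursion_rhs q n x = local_corr q (n + 2) x"
    using recursion_rhs_local[OF q ex] by blast
  let ?O = "small_region (n + 2) (min e1 e2)"
  \<comment> \<open>The difference of the two sides; on the open set \<open>?O\<close> both are
    equal to \<open>local_corr\<close>.\<close>
  have mero: "meromorphic_in (n + 2) ?C (\<lambda>x. ?f x + (- 1) * recursion_rhs q n x)"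
    using c by (intro meromorphic_in_add meromorphic_in_mult meromorphic_in_const order_refl
        recursion_rhs_meromorphic[OF q ex]) (auto simp: is_correlator_def meromorphic_several_iff)
  have zero: "?f x + (- 1) * recursion_rhs q n x = 0" if "x \<in> ?O" for x
  proof -
    have "x \<in> small_region (n + 2) e1" "x \<in> small_region (n + 2) e2"
      using that small_region_mono[of "min e1 e2" e1 "n + 2"] small_region_mono[of "min e1 e2" e2 "n + 2"]
      by (auto simp del: add_2_eq_Suc')
    from e1(2)[OF this(1)] e2(2)[OF this(2)] show ?thesis by simp
  qed
  have sub: "?O \<subseteq> ?C" by (auto simp: small_region_def)
  obtain D where D: "open_in_space (n + 2) D" "D \<subseteq> ?C" "?C \<subseteq> closure D"
    "\<And>x. x \<in> D \<Longrightarrow> ?f x + (- 1) * recursion_rhs q n x = 0"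
    using meromorphic_identity[OF mero open_in_space_whole connected_complex_space open_small_region _ sub zero]
      small_region_nonempty[of "min e1 e2" "n + 2"] e1(1) e2(1) by auto
  have "F q (x 0 # x 1 # map (\<lambda>j. x (j + 1)) (sorted_list_of_set {1..n})) = recursion_rhs q n x" if "x \<in> D" for x
  proof -
    let ?xs = "x 0 # x 1 # map (\<lambda>j. x (j + 1)) (sorted_list_of_set {1..n})"
    have ls: "sorted_list_of_set {1..n} = [1..<Suc n]"
      by (metis atLeastLessThanSuc_atLeastAtMost sorted_list_of_set_range)
    \<comment> \<open>\<open>D\<close> lies in the space, so the coordinates of \<open>x\<close>
      from \<open>n + 2\<close> on are 0, the default value used for the list.\<close>
    have "nth_default 0 ?xs i = x i" for i
    proof -
      consider "i = 0" | "i = 1" | k where "i = Suc (Suc k)" by (metis One_nat_def not0_implies_Suc)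
      thus ?thesis
      proof cases
        case 3
        have "x i = 0" if "n \<le> k" using that 3 D(2) \<open>x \<in> D\<close> by (auto simp: complex_space_def)
        thus ?thesis using 3 unfolding ls by (auto simp: nth_default_def simp del: upt_Suc)
      qed (auto simp: nth_default_def)
    qed
    hence "nth_default 0 ?xs = x" by auto
    moreover have "length ?xs = n + 2" by simp
    ultimately have "F q ?xs = ?f x" unfolding F_def by simp
    thus ?thesis using D(4)[OF that] by simp
  qed
  thus ?thesis
    unfolding generically_def Let_def recursion_rhs_def using D(1,3) by blast
qed

end
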